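(* Let $A=(A_1,\dots,A_n)$ be a contractive $n$-tuple on a nonzero finite dimensional Hilbert space $\mathcal V$, let $S$ be its joint minimal isometric dilation and $\mathfrak S$ the WOT-closed unital algebra generated by $S_1,\dots,S_n$. Let $\Phi(X)=\sum_{i=1}^nA_iXA_i^*$ on $\mathcal B(\mathcal V)$. Then $\mathfrak S$ is irreducible if and only if either (1) $\operatorname{Ran}\bigl(I-\sum_{i=1}^nA_iA_i^*\bigr)=\mathbb Cv\ne0$ and $v$ is cyclic for $\mathfrak A$ (in this case, $\mathfrak S$ is unitarily equivalent to $\mathfrak L_n$); or (2) $\sum_{i=1}^nA_iA_i^*=I$ and $\mathfrak A^*$ has a minimal invariant subspace $\mathcal V_0$ which is cyclic for $\mathfrak A$ (in this case, $\mathfrak S$ is unitarily equivalent to $\mathfrak B_{n,d_0}$ where $d_0=\dim\mathcal V_0$). These conditions are respectively equivalent to (1′) $\operatorname{rank}(I-\Phi(I))=1$ and $\Phi^\infty(I)=0$; (2′) $\{X\in\mathcal B(\mathcal V):\Phi(X)=X\}=\mathbb CI$.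
   Context: Fix an integer $n\ge2$. $\mathcal F_n$ is the unital free semigroup on letters $1,\dots,n$; for an $n$-tuple $T$ and $w=i_1\cdots i_k$, $T_w=T_{i_1}\cdots T_{i_k}$. $A$ is contractive if $\sum_iA_iA_i^*\le I$. Its minimal joint isometric dilation is an $n$-tuple $S$ of isometries with pairwise orthogonal ranges on $\mathcal H\supseteq\mathcal V$ with $\mathcal V$ invariant for each $S_i^*$, $S_i^*|_{\mathcal V}=A_i^*$ and $\mathcal H$ the closed span of $\{S_w\mathcal V:w\in\mathcal F_n\}$; it exists and is unique up to a unitary equivalence fixing $\mathcal V$. WOT is the weak operator topology. $\mathfrak A$ is the unital algebra generated by $A_1,\dots,A_n$ and $\mathfrak A^*$ the algebra of adjoints. A vector $v$ (subspace $\mathcal V_0$) is cyclic for $\mathfrak A$ if $\mathfrak Av=\mathcal V$ (resp. the span of $\mathfrak A\mathcal V_0$ is $\mathcal V$). "Minimal invariant subspace" means minimal among nonzero invariant subspaces. $\mathfrak S$ is irreducible if it has no closed reducing subspaces other than $0$ and $\mathcal H$. $\Phi^\infty(I)=\lim_{k\to\infty}\Phi^k(I)$, the limit of a decreasing sequence of positive operators. $\mathcal K_n=\ell^2(\mathcal F_n)$ with orthonormal basis $\{\xi_w\}$, $L_i\xi_w=\xi_{iw}$, $\mathfrak L_n$ is the WOT-closed unital algebra generated by $L_1,\dots,L_n$, and $\mathfrak L_n^{(\alpha)}=\{X^{(\alpha)}:X\in\mathfrak L_n\}$, where $X^{(\alpha)}$ is the direct sum of $\alpha$ copies. For $d\ge1$,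 $\mathfrak B_{n,d}$ is the WOT-closed algebra on $\mathcal H'=\mathcal V'\oplus\mathcal K_n^{(d(n-1))}$, $\dim\mathcal V'=d$, given by $\mathfrak B_{n,d}=\mathcal B(\mathcal H')P_{\mathcal V'}+\bigl(0_{\mathcal V'}\oplus\mathfrak L_n^{(d(n-1))}\bigr)$. *)

theory Defs
  imports "HOL-Analysis.Analysis"
begin

section \<open>Complex inner product spaces and Hilbert spaces\<close>

text \<open>The norm and the topology are those of the underlying real inner product space, whose inner
  product is the real part of \<open>cinner\<close>; \<open>cinner\<close> is linear in its first argument.\<close>

class complex_inner = real_inner +
  fixes scaleC :: "complex \<Rightarrow> 'a \<Rightarrow> 'a"  (infixr "*\<^sub>C" 75)
    and cinner :: "'a \<Rightarrow> 'a \<Rightarrow> complex"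
  assumes scaleC_add_right: "c *\<^sub>C (x + y) = c *\<^sub>C x + c *\<^sub>C y"
    and scaleC_add_left: "(b + c) *\<^sub>C x = b *\<^sub>C x + c *\<^sub>C x"
    and scaleC_scaleC: "b *\<^sub>C (c *\<^sub>C x) = (b * c) *\<^sub>C x"
    and scaleC_complex_of_real: "Complex r 0 *\<^sub>C x = r *\<^sub>R x"
    and cinner_commute: "cinner y x = cnj (cinner x y)"
    and cinner_add_left: "cinner (x + y) z = cinner x z + cinner y z"
    and cinner_scaleC_left: "cinner (c *\<^sub>C x) y = c * cinner x y"
    and Re_cinner: "Re (cinner x y) = inner x y"

class chilbert_space = complex_inner + complete_space

lemma scaleC_of_real: "of_real r *\<^sub>C x = r *\<^sub>R (x :: 'a :: complex_inner)"
  using scaleC_complex_of_real[of r x] by (simp add: complex_of_real_def)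

global_interpretation complex_vector: vector_space "scaleC :: complex \<Rightarrow> 'a \<Rightarrow> 'a :: complex_inner"
  defines csubspace = complex_vector.subspace
    and cspan = complex_vector.span
    and cdim = complex_vector.dim
  by unfold_locales
    (simp_all add: scaleC_add_right scaleC_add_left scaleC_scaleC scaleC_of_real[of 1, simplified])

definition bounded_clinear :: "('a :: complex_inner \<Rightarrow> 'b :: complex_inner) \<Rightarrow> bool" where
  "bounded_clinear T \<longleftrightarrow> bounded_linear T \<and> (\<forall>c x. T (c *\<^sub>C x) = c *\<^sub>C T x)"

definition cadjoint :: "('a :: complex_inner \<Rightarrow> 'b :: complex_inner) \<Rightarrow> 'b \<Rightarrow> 'a" where
  "cadjoint T = (THE T'. bounded_clinear T' \<and> (\<forall>x y. cinner (T x) y = cinner x (T' y)))"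

lemma riesz_real:
  fixes f :: "'a :: {real_inner, complete_space} \<Rightarrow> real"
  assumes "bounded_linear f"
  obtains z where "\<And>x. f x = inner x z"
proof -
  interpret f: bounded_linear f by fact
  obtain K where K: "\<And>x. norm (f x) \<le> norm x * K" using f.bounded by blast
  define q where "q x = inner x x / 2 - f x" for x
  have lb: "q x \<ge> - (K\<^sup>2 / 2)" for x
  proof -
    have "f x \<le> norm x * K" using K[of x] by (simp add: abs_le_iff)
    moreover have "0 \<le> (norm x - K)\<^sup>2" by simp
    ultimately show ?thesis
      unfolding q_def power2_norm_eq_inner[symmetric] by (simp add: power2_diff field_simps)
  qed
  define m where "m = Inf (range q)"
  have bdd: "bdd_below (range q)" using lb by (intro bdd_belowI[of _ "- (K\<^sup>2 / 2)"]) auto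
  have m_le: "m \<le> q x" for x unfolding m_def using bdd by (auto intro: cInf_lower)
  have "\<exists>x. q x < m + inverse (real (Suc k))" for k
    using cInf_lessD[of "range q" "m + inverse (real (Suc k))"] unfolding m_def by auto
  then obtain s where s: "\<And>k. q (s k) < m + inverse (real (Suc k))" by metis
  have par: "(norm (x - y))\<^sup>2 \<le> 4 * (q x + q y - 2 * m)" for x y
  proof -
    have "q ((1/2) *\<^sub>R (x + y)) \<ge> m" by (rule m_le)
    then show ?thesis
      unfolding q_def power2_norm_eq_inner
      by (simp add: f.add f.scaleR inner_simps inner_commute[of y x] field_simps)
  qed
  have "Cauchy s"
  proof (rule metric_CauchyI)
    fix e :: real assume e: "e > 0"
    then obtain N where N: "inverse (real (Suc N)) < e\<^sup>2 / 8"
      using reals_Archimedean[of "e\<^sup>2 / 8"] by auto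
    have "dist (s i) (s j) < e" if "i \<ge> N" "j \<ge> N" for i j
    proof -
      define r where "r k = inverse (real (Suc k))" for k
      have "r i \<le> r N" "r j \<le> r N" using that by (auto simp: r_def intro!: le_imp_inverse_le)
      moreover have "q (s i) < m + r i" "q (s j) < m + r j" "r N < e\<^sup>2 / 8"
        using s N by (simp_all only: r_def)
      ultimately have "(norm (s i - s j))\<^sup>2 < e\<^sup>2"
        using par[of "s i" "s j"] by argo
      then show ?thesis using e by (simp add: dist_norm power2_less_imp_less)
    qed
    then show "\<exists>M. \<forall>i\<ge>M. \<forall>j\<ge>M. dist (s i) (s j) < e" by blast
  qed
  then obtain z where z: "s \<longlonglongrightarrow> z" using Cauchy_convergent convergent_def by blast
  have "(\<lambda>k. q (s k)) \<longlonglongrightarrow> q z"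
    unfolding q_def by (intro tendsto_intros z f.tendsto) auto
  moreover have "(\<lambda>k. m + inverse (real (Suc k))) \<longlonglongrightarrow> m + 0"
    by (intro tendsto_intros LIMSEQ_inverse_real_of_nat)
  ultimately have "q z \<le> m + 0"
    by (rule LIMSEQ_le) (use s in \<open>auto intro: less_imp_le\<close>)
  then have qz: "q z \<le> q x" for x using m_le[of x] by linarith
  have "f x = inner x z" for x
  proof (rule ccontr)
    assume ne: "f x \<noteq> inner x z"
    define d where "d = f x - inner x z"
    define t where "t = d / (inner x x + 1)"
    have pos: "inner x x + 1 > 0" by (simp add: add_nonneg_pos)
    have "0 \<le> t\<^sup>2 * inner x x / 2 - t * d"
      using qz[of "z + t *\<^sub>R x"] unfolding q_def d_def
      by (simp add: f.add f.scaleR inner_simps inner_commute[of z x] power2_eq_square field_simps)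
    moreover have "t * (inner x x + 1) = d" using pos by (simp add: t_def)
    then have "t\<^sup>2 * (inner x x + 1) = t * d" by (simp only: power2_eq_square mult.assoc)
    ultimately have "0 \<le> - (t\<^sup>2 * inner x x) / 2 - t\<^sup>2" by (simp add: algebra_simps)
    moreover have "t\<^sup>2 > 0" using ne pos by (simp add: t_def d_def)
    moreover have "t\<^sup>2 * inner x x \<ge> 0" by simp
    ultimately show False by linarith
  qed
  then show ?thesis using that by blast
qed

lemma Im_cinner: "Im (cinner x y) = - inner (\<i> *\<^sub>C x) (y :: 'a :: complex_inner)"
  by (simp add: Re_cinner[symmetric] cinner_scaleC_left)

lemma cinner_eqI:
  assumes "\<And>x. cinner x y = cinner x (z :: 'a :: complex_inner)"
  shows "y = z"
proof -
  have "inner x y = inner x z" for x by (metis Re_cinner assms)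
  then have "inner (y - z) (y - z) = 0" by (simp add: inner_diff_right)
  then show ?thesis by simp
qed

lemma cinner_add_right: "cinner x (y + z) = cinner x y + cinner x (z :: 'a :: complex_inner)"
  by (metis cinner_commute cinner_add_left complex_cnj_add)

lemma cinner_scaleC_right: "cinner x (c *\<^sub>C y) = cnj c * cinner x (y :: 'a :: complex_inner)"
  by (metis cinner_commute cinner_scaleC_left complex_cnj_mult)

lemma cadjoint:
  fixes T :: "'a :: chilbert_space \<Rightarrow> 'b :: complex_inner"
  assumes T: "bounded_clinear T"
  shows bounded_clinear_cadjoint: "bounded_clinear (cadjoint T)"
    and cinner_cadjoint: "cinner (T x) y = cinner x (cadjoint T y)"
proof -
  interpret T: bounded_linear T using T by (simp add: bounded_clinear_def)
  have TC: "T (c *\<^sub>C x) = c *\<^sub>C T x" for c x using T by (simp add: bounded_clinear_def)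
  have "\<exists>z. \<forall>x. cinner (T x) y = cinner x z" for y
  proof -
    have "bounded_linear (\<lambda>x. inner (T x) y)"
      by (rule bounded_linear_compose[OF bounded_linear_inner_left T.bounded_linear_axioms])
    then obtain z where z: "\<And>x. inner (T x) y = inner x z" using riesz_real by blast
    have "cinner (T x) y = cinner x z" for x
      by (rule complex_eqI) (simp_all add: Re_cinner Im_cinner z TC[symmetric])
    then show ?thesis by blast
  qed
  then obtain T' where T': "\<And>x y. cinner (T x) y = cinner x (T' y)" by metis
  have add: "T' (y + z) = T' y + T' z" for y z
    by (rule cinner_eqI) (simp add: cinner_add_right T'[symmetric])
  have sc: "T' (c *\<^sub>C y) = c *\<^sub>C T' y" for c y
    by (rule cinner_eqI) (simp add: cinner_scaleC_right T'[symmetric])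
  obtain K where K: "K > 0" "\<And>x. norm (T x) \<le> norm x * K" using T.pos_bounded by blast
  have bd: "norm (T' y) \<le> norm y * K" for y
  proof -
    have "(norm (T' y))\<^sup>2 = inner (T (T' y)) y"
      by (metis Re_cinner T' power2_norm_eq_inner)
    also have "\<dots> \<le> norm (T (T' y)) * norm y" by (rule norm_cauchy_schwarz)
    also have "\<dots> \<le> norm (T' y) * K * norm y" by (intro mult_right_mono K) auto
    finally have "norm (T' y) * norm (T' y) \<le> norm (T' y) * (norm y * K)"
      by (simp add: power2_eq_square mult_ac)
    then show ?thesis using K(1) by (cases "norm (T' y) = 0") auto
  qed
  have "bounded_linear T'"
    by (rule bounded_linear_intro[OF add _ bd]) (metis sc scaleC_of_real)
  then have P: "bounded_clinear T' \<and> (\<forall>x y. cinner (T x) y = cinner x (T' y))"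
    by (simp add: bounded_clinear_def sc T')
  have "bounded_clinear (cadjoint T) \<and> (\<forall>x y. cinner (T x) y = cinner x (cadjoint T y))"
    unfolding cadjoint_def
  proof (rule theI[where P = "\<lambda>T'. bounded_clinear T' \<and> (\<forall>x y. cinner (T x) y = cinner x (T' y))", OF P])
    fix R assume R: "bounded_clinear R \<and> (\<forall>x y. cinner (T x) y = cinner x (R y))"
    show "R = T'"
    proof
      fix y show "R y = T' y" by (rule cinner_eqI) (use R T' in metis)
    qed
  qed
  then show "bounded_clinear (cadjoint T)" "cinner (T x) y = cinner x (cadjoint T y)" by auto
qed

definition finite_cdim :: "'a :: complex_inner set \<Rightarrow> bool" where
  "finite_cdim M \<longleftrightarrow> (\<exists>B. finite B \<and> M \<subseteq> cspan B)"

definition orthocompl :: "'a :: complex_inner set \<Rightarrow> 'a set" where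
  "orthocompl M = {x. \<forall>y\<in>M. cinner x y = 0}"

definition isometry :: "('a :: complex_inner \<Rightarrow> 'b :: complex_inner) \<Rightarrow> bool" where
  "isometry T \<longleftrightarrow> bounded_clinear T \<and> (\<forall>x. norm (T x) = norm x)"

definition op_le :: "('a :: complex_inner \<Rightarrow> 'a) \<Rightarrow> ('a \<Rightarrow> 'a) \<Rightarrow> bool" where
  "op_le X Y \<longleftrightarrow> (\<forall>x. cinner (Y x - X x) x \<in> \<real>\<^sub>\<ge>\<^sub>0)"


section \<open>Operator algebras\<close>

inductive_set unital_algebra :: "('a :: complex_inner \<Rightarrow> 'a) set \<Rightarrow> ('a \<Rightarrow> 'a) set"
  for G :: "('a \<Rightarrow> 'a) set" where
  gen: "T \<in> G \<Longrightarrow> T \<in> unital_algebra G"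
| one: "id \<in> unital_algebra G"
| add: "\<lbrakk>T \<in> unital_algebra G; R \<in> unital_algebra G\<rbrakk> \<Longrightarrow> (\<lambda>x. T x + R x) \<in> unital_algebra G"
| scale: "T \<in> unital_algebra G \<Longrightarrow> (\<lambda>x. c *\<^sub>C T x) \<in> unital_algebra G"
| mult: "\<lbrakk>T \<in> unital_algebra G; R \<in> unital_algebra G\<rbrakk> \<Longrightarrow> T \<circ> R \<in> unital_algebra G"

definition wot :: "('a :: complex_inner \<Rightarrow> 'a) topology" where
  "wot = pullback_topology {T. bounded_clinear T}
     (\<lambda>T (x, y). cinner (T x) y) (euclidean :: ('a \<times> 'a \<Rightarrow> complex) topology)"

definition wot_algebra :: "('a :: complex_inner \<Rightarrow> 'a) set \<Rightarrow> ('a \<Rightarrow> 'a) set" where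
  "wot_algebra G = wot closure_of (unital_algebra G)"

definition invariant :: "('a \<Rightarrow> 'a) set \<Rightarrow> 'a set \<Rightarrow> bool" where
  "invariant \<A> M \<longleftrightarrow> (\<forall>T\<in>\<A>. T ` M \<subseteq> M)"

definition reducing :: "('a :: complex_inner \<Rightarrow> 'a) set \<Rightarrow> 'a set \<Rightarrow> bool" where
  "reducing \<A> M \<longleftrightarrow> csubspace M \<and> invariant \<A> M \<and> invariant \<A> (orthocompl M)"

definition irreducible_algebra :: "('a :: complex_inner \<Rightarrow> 'a) set \<Rightarrow> bool" where
  "irreducible_algebra \<A> \<longleftrightarrow> (\<forall>M. closed M \<and> reducing \<A> M \<longrightarrow> M = {0} \<or> M = UNIV)"

definition minimal_invariant :: "('a :: complex_inner \<Rightarrow> 'a) set \<Rightarrow> 'a set \<Rightarrow> bool" where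
  "minimal_invariant \<A> M \<longleftrightarrow> csubspace M \<and> M \<noteq> {0} \<and> invariant \<A> M \<and>
     (\<forall>N. csubspace N \<and> N \<noteq> {0} \<and> invariant \<A> N \<and> N \<subseteq> M \<longrightarrow> N = M)"

definition cyclic_vector :: "('a :: complex_inner \<Rightarrow> 'a) set \<Rightarrow> 'a \<Rightarrow> bool" where
  "cyclic_vector \<A> v \<longleftrightarrow> {T v |T. T \<in> \<A>} = UNIV"

definition cyclic_subspace :: "('a :: complex_inner \<Rightarrow> 'a) set \<Rightarrow> 'a set \<Rightarrow> bool" where
  "cyclic_subspace \<A> M \<longleftrightarrow> cspan {T x |T x. T \<in> \<A> \<and> x \<in> M} = UNIV"

text \<open>Operators on a closed subspace \<open>M\<close> are represented by operators on the ambient space which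
  have range in \<open>M\<close> and vanish on its orthogonal complement.\<close>

definition bounded_ops_on :: "'a :: complex_inner set \<Rightarrow> ('a \<Rightarrow> 'a) set" where
  "bounded_ops_on M = {X. bounded_clinear X \<and> range X \<subseteq> M \<and> (\<forall>x\<in>orthocompl M. X x = 0)}"

text \<open>\<open>unitarily_equivalent \<A> M \<B>\<close>: there is a unitary \<open>U\<close> from the whole space on which \<open>\<A>\<close>
  acts onto the closed subspace \<open>M\<close> on which \<open>\<B>\<close> acts, with \<open>U \<A> U\<^sup>* = \<B>\<close>. The latter is written
  \<open>U \<A> = \<B> U\<close>.\<close>

definition unitarily_equivalent ::
    "('a :: complex_inner \<Rightarrow> 'a) set \<Rightarrow> 'b :: complex_inner set \<Rightarrow> ('b \<Rightarrow> 'b) set \<Rightarrow> bool" where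
  "unitarily_equivalent \<A> M \<B> \<longleftrightarrow>
     (\<exists>U. isometry U \<and> range U = M \<and> (\<lambda>T. U \<circ> T) ` \<A> = (\<lambda>X. X \<circ> U) ` \<B>)"


section \<open>Row contractions and isometric dilations\<close>

text \<open>The letters are the elements of a finite type \<open>'n\<close>, and the words are the lists over it.\<close>

definition word_op :: "('n \<Rightarrow> 'a \<Rightarrow> 'a) \<Rightarrow> 'n list \<Rightarrow> 'a \<Rightarrow> 'a" where
  "word_op T w = foldr (\<lambda>i R. T i \<circ> R) w id"

definition cp_map :: "('n :: finite \<Rightarrow> 'a :: complex_inner \<Rightarrow> 'a) \<Rightarrow> ('a \<Rightarrow> 'a) \<Rightarrow> 'a \<Rightarrow> 'a" where
  "cp_map A X = (\<lambda>x. \<Sum>i\<in>UNIV. A i (X (cadjoint (A i) x)))"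

definition contractive :: "('n :: finite \<Rightarrow> 'a :: complex_inner \<Rightarrow> 'a) \<Rightarrow> bool" where
  "contractive A \<longleftrightarrow> (\<forall>i. bounded_clinear (A i)) \<and>
     op_le (\<lambda>x. \<Sum>i\<in>UNIV. A i (cadjoint (A i) x)) id"

text \<open>Limit in the strong operator topology.\<close>

definition cp_limit :: "('n :: finite \<Rightarrow> 'a :: complex_inner \<Rightarrow> 'a) \<Rightarrow> 'a \<Rightarrow> 'a" where
  "cp_limit A = (\<lambda>x. lim (\<lambda>k. (cp_map A ^^ k) id x))"

text \<open>The space of \<open>A\<close> is identified with its image under the isometry \<open>J\<close>. The third clause says
  that this image is invariant under the adjoints of the \<open>S i\<close>, which restrict there to the
  adjoints of the \<open>A i\<close>.\<close>

definition minimal_isometric_dilation ::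
    "('n :: finite \<Rightarrow> 'v :: complex_inner \<Rightarrow> 'v) \<Rightarrow> ('v \<Rightarrow> 'h :: complex_inner) \<Rightarrow> ('n \<Rightarrow> 'h \<Rightarrow> 'h) \<Rightarrow> bool" where
  "minimal_isometric_dilation A J S \<longleftrightarrow> isometry J \<and>
     (\<forall>i. isometry (S i)) \<and> (\<forall>i j x y. i \<noteq> j \<longrightarrow> cinner (S i x) (S j y) = 0) \<and>
     (\<forall>i v. cadjoint (S i) (J v) = J (cadjoint (A i) v)) \<and>
     closure (cspan {word_op S w (J v) |w v. True}) = UNIV"


section \<open>Square-summable families\<close>

definition square_summable :: "('i \<Rightarrow> complex) \<Rightarrow> bool" where
  "square_summable f \<longleftrightarrow> (\<lambda>i. (cmod (f i))\<^sup>2) summable_on UNIV"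

lemma square_summable_0: "square_summable (\<lambda>_. 0)"
  by (simp add: square_summable_def)

lemma square_summable_scale:
  assumes "square_summable f"
  shows "square_summable (\<lambda>i. c * f i)"
  using summable_on_cmult_right[OF assms[unfolded square_summable_def], of "(cmod c)\<^sup>2"]
  by (simp add: square_summable_def norm_mult power_mult_distrib)

lemma square_summable_add:
  assumes "square_summable f" "square_summable g"
  shows "square_summable (\<lambda>i. f i + g i)"
  unfolding square_summable_def
proof (rule summable_on_comparison_test)
  show "(\<lambda>i. 2 * (cmod (f i))\<^sup>2 + 2 * (cmod (g i))\<^sup>2) summable_on UNIV"
    using assms[unfolded square_summable_def, THEN summable_on_cmult_right, of 2] by (rule summable_on_add)
  fix i
  have "(cmod (f i + g i))\<^sup>2 \<le> (cmod (f i) + cmod (g i))\<^sup>2"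
    by (intro power_mono norm_triangle_ineq norm_ge_zero)
  also have "\<dots> \<le> 2 * (cmod (f i))\<^sup>2 + 2 * (cmod (g i))\<^sup>2"
    using zero_le_power2[of "cmod (f i) - cmod (g i)"]
    by (simp only: power2_sum power2_diff)
  finally show "(cmod (f i + g i))\<^sup>2 \<le> 2 * (cmod (f i))\<^sup>2 + 2 * (cmod (g i))\<^sup>2" .
qed simp

lemma square_summable_mult:
  assumes "square_summable f" "square_summable g"
  shows "(\<lambda>i. f i * cnj (g i)) summable_on UNIV"
proof (rule abs_summable_summable, rule summable_on_comparison_test)
  show "(\<lambda>i. (cmod (f i))\<^sup>2 + (cmod (g i))\<^sup>2) summable_on UNIV"
    using assms unfolding square_summable_def by (rule summable_on_add)
  fix i
  show "norm (f i * cnj (g i)) \<le> (cmod (f i))\<^sup>2 + (cmod (g i))\<^sup>2"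
    using zero_le_power2[of "cmod (f i) - cmod (g i)"]
      mult_nonneg_nonneg[OF norm_ge_zero[of "f i"] norm_ge_zero[of "g i"]]
    unfolding norm_mult complex_mod_cnj power2_diff by linarith
qed auto

typedef 'i ell2 = "{f :: 'i \<Rightarrow> complex. square_summable f}"
  morphisms ell2_coeff Abs_ell2
  using square_summable_0 by blast

setup_lifting type_definition_ell2

lemma square_summable_coeff: "square_summable (ell2_coeff f)"
  using ell2_coeff by blast

instantiation ell2 :: (type) complex_inner
begin

lift_definition zero_ell2 :: "'a ell2" is "\<lambda>_. 0" by (rule square_summable_0)

lift_definition plus_ell2 :: "'a ell2 \<Rightarrow> 'a ell2 \<Rightarrow> 'a ell2" is "\<lambda>f g i. f i + g i"
  by (rule square_summable_add)

lift_definition scaleC_ell2 :: "complex \<Rightarrow> 'a ell2 \<Rightarrow> 'a ell2" is "\<lambda>c f i. c * f i"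
  by (rule square_summable_scale)

definition scaleR_ell2 :: "real \<Rightarrow> 'a ell2 \<Rightarrow> 'a ell2" where
  "scaleR_ell2 r f = scaleC (of_real r) f"

definition uminus_ell2 :: "'a ell2 \<Rightarrow> 'a ell2" where
  "uminus_ell2 f = scaleC (-1) f"

definition minus_ell2 :: "'a ell2 \<Rightarrow> 'a ell2 \<Rightarrow> 'a ell2" where
  "minus_ell2 f g = f + - (g :: 'a ell2)"

definition cinner_ell2 :: "'a ell2 \<Rightarrow> 'a ell2 \<Rightarrow> complex" where
  "cinner_ell2 f g = (\<Sum>\<^sub>\<infinity>i. ell2_coeff f i * cnj (ell2_coeff g i))"

definition inner_ell2 :: "'a ell2 \<Rightarrow> 'a ell2 \<Rightarrow> real" where
  "inner_ell2 f g = Re (cinner f g)"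

definition norm_ell2 :: "'a ell2 \<Rightarrow> real" where
  "norm_ell2 f = sqrt (inner f f)"

definition sgn_ell2 :: "'a ell2 \<Rightarrow> 'a ell2" where
  "sgn_ell2 f = inverse (norm f) *\<^sub>R f"

definition dist_ell2 :: "'a ell2 \<Rightarrow> 'a ell2 \<Rightarrow> real" where
  "dist_ell2 f g = norm (f - g)"

definition uniformity_ell2 :: "('a ell2 \<times> 'a ell2) filter" where
  "uniformity_ell2 = (INF e\<in>{0 <..}. principal {(x, y). dist x y < e})"

definition open_ell2 :: "'a ell2 set \<Rightarrow> bool" where
  "open_ell2 U = (\<forall>x\<in>U. eventually (\<lambda>(x', y). x' = x \<longrightarrow> y \<in> U) uniformity)"

lemma inner_ell2_self: "inner f f = (\<Sum>\<^sub>\<infinity>i. (cmod (ell2_coeff f i))\<^sup>2)" for f :: "'a ell2"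
proof -
  have "(\<lambda>i. ell2_coeff f i * cnj (ell2_coeff f i)) summable_on UNIV"
    by (intro square_summable_mult square_summable_coeff)
  moreover have "Re (z * cnj z) = (cmod z)\<^sup>2" for z
    using arg_cong[OF complex_norm_square, of Re z] by simp
  ultimately show ?thesis
    unfolding inner_ell2_def cinner_ell2_def by (simp only: infsum_Re[symmetric])
qed

instance
proof
  fix x y z :: "'a ell2" and r s :: real and b c :: complex
  show "x + y + z = x + (y + z)" by transfer (simp add: add.assoc)
  show "x + y = y + x" by transfer (simp add: add.commute)
  show "0 + x = x" by transfer simp
  show "- x + x = 0" unfolding uminus_ell2_def by transfer simp
  show "x - y = x + - y" by (rule minus_ell2_def)
  show C1: "c *\<^sub>C (x + y) = c *\<^sub>C x + c *\<^sub>C y" for c and x y :: "'a ell2"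
    by transfer (simp add: algebra_simps)
  show C2: "(b + c) *\<^sub>C x = b *\<^sub>C x + c *\<^sub>C x" for b c and x :: "'a ell2"
    by transfer (simp add: algebra_simps)
  show C3: "b *\<^sub>C (c *\<^sub>C x) = (b * c) *\<^sub>C x" for b c and x :: "'a ell2"
    by transfer (simp add: mult.assoc)
  show "Complex r 0 *\<^sub>C x = r *\<^sub>R x" by (simp add: scaleR_ell2_def complex_of_real_def)
  show "r *\<^sub>R (x + y) = r *\<^sub>R x + r *\<^sub>R y" by (simp add: scaleR_ell2_def C1)
  show "(r + s) *\<^sub>R x = r *\<^sub>R x + s *\<^sub>R x" by (simp add: scaleR_ell2_def C2)
  show "r *\<^sub>R (s *\<^sub>R x) = (r * s) *\<^sub>R x" by (simp add: scaleR_ell2_def C3)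
  show "1 *\<^sub>R x = x" unfolding scaleR_ell2_def by transfer simp
  show "sgn x = inverse (norm x) *\<^sub>R x" by (rule sgn_ell2_def)
  show "dist x y = norm (x - y)" by (rule dist_ell2_def)
  show "uniformity = (INF e\<in>{0 <..}. principal {(x :: 'a ell2, y). dist x y < e})"
    by (rule uniformity_ell2_def)
  show "open U = (\<forall>x\<in>U. eventually (\<lambda>(x', y). x' = x \<longrightarrow> y \<in> U) uniformity)" for U :: "'a ell2 set"
    by (rule open_ell2_def)
  show comm: "cinner y x = cnj (cinner x y)" for x y :: "'a ell2"
    unfolding cinner_ell2_def infsum_cnj[symmetric] by (simp add: mult.commute)
  have sm: "(\<lambda>i. ell2_coeff f i * cnj (ell2_coeff g i)) summable_on UNIV" for f g :: "'a ell2"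
    by (intro square_summable_mult square_summable_coeff)
  show add: "cinner (x + y) z = cinner x z + cinner y z"
    unfolding cinner_ell2_def infsum_add[OF sm sm, symmetric]
    by (simp add: plus_ell2.rep_eq distrib_right)
  show scale: "cinner (c *\<^sub>C x) y = c * cinner x y" for c
    unfolding cinner_ell2_def infsum_cmult_right[OF sm, symmetric]
    by (simp add: scaleC_ell2.rep_eq mult.assoc)
  show "Re (cinner x y) = inner x y" by (simp add: inner_ell2_def)
  show "inner x y = inner y x" unfolding inner_ell2_def comm[of x y] by simp
  show "inner (x + y) z = inner x z + inner y z" by (simp add: inner_ell2_def add)
  show "inner (r *\<^sub>R x) y = r * inner x y" by (simp add: inner_ell2_def scaleR_ell2_def scale)
  show "0 \<le> inner x x" by (simp add: inner_ell2_self infsum_nonneg)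
  show "inner x x = 0 \<longleftrightarrow> x = 0"
  proof
    assume "inner x x = 0"
    then have "(\<Sum>\<^sub>\<infinity>i. (cmod (ell2_coeff x i))\<^sup>2) \<le> 0" by (simp only: inner_ell2_self)
    from nonneg_infsum_le_0D[OF this square_summable_coeff[unfolded square_summable_def]]
    have "(cmod (ell2_coeff x i))\<^sup>2 = 0" for i by simp
    then show "x = 0" by (auto simp: ell2_coeff_inject[symmetric] zero_ell2.rep_eq)
  next
    assume "x = 0"
    then show "inner x x = 0" by (simp add: inner_ell2_self zero_ell2.rep_eq)
  qed
  show "norm x = sqrt (inner x x)" by (rule norm_ell2_def)
qed

end

lemma ell2_coeff_diff: "ell2_coeff (f - g) i = ell2_coeff f i - ell2_coeff g i"
  by (simp only: minus_ell2_def uminus_ell2_def plus_ell2.rep_eq scaleC_ell2.rep_eq) simp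

lemma power2_norm_ell2: "(norm f)\<^sup>2 = (\<Sum>\<^sub>\<infinity>i. (cmod (ell2_coeff f i))\<^sup>2)"
  by (simp add: power2_norm_eq_inner inner_ell2_self)

lemma sum_ell2_coeff_le: "finite F \<Longrightarrow> (\<Sum>i\<in>F. (cmod (ell2_coeff f i))\<^sup>2) \<le> (norm f)\<^sup>2"
  unfolding power2_norm_ell2
  by (rule finite_sum_le_infsum[OF square_summable_coeff[unfolded square_summable_def]]) simp_all

instance ell2 :: (type) chilbert_space
proof
  fix X :: "nat \<Rightarrow> 'a ell2"
  assume X: "Cauchy X"
  have "Cauchy (\<lambda>k. ell2_coeff (X k) i)" for i
  proof (rule metric_CauchyI)
    fix e :: real assume "e > 0"
    then obtain M where M: "\<And>m n. m \<ge> M \<Longrightarrow> n \<ge> M \<Longrightarrow> dist (X m) (X n) < e"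
      using metric_CauchyD[OF X] by blast
    have "dist (ell2_coeff (X m) i) (ell2_coeff (X n) i) \<le> dist (X m) (X n)" for m n
      using sum_ell2_coeff_le[of "{i}" "X m - X n"]
      by (auto simp: dist_norm ell2_coeff_diff intro: power2_le_imp_le)
    then show "\<exists>M. \<forall>m\<ge>M. \<forall>n\<ge>M. dist (ell2_coeff (X m) i) (ell2_coeff (X n) i) < e"
      using M by (meson le_less_trans)
  qed
  then have "\<exists>l. (\<lambda>k. ell2_coeff (X k) i) \<longlonglongrightarrow> l" for i
    using Cauchy_convergent convergent_def by blast
  then obtain f where f: "\<And>i. (\<lambda>k. ell2_coeff (X k) i) \<longlonglongrightarrow> f i" by metis
  have fin: "(\<Sum>i\<in>F. (cmod (ell2_coeff (X m) i - f i))\<^sup>2) \<le> e\<^sup>2"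
    if "finite F" and e: "\<And>n. n \<ge> m \<Longrightarrow> dist (X m) (X n) < e" for F m e
  proof (rule LIMSEQ_le_const2)
    show "(\<lambda>n. \<Sum>i\<in>F. (cmod (ell2_coeff (X m) i - ell2_coeff (X n) i))\<^sup>2)
        \<longlonglongrightarrow> (\<Sum>i\<in>F. (cmod (ell2_coeff (X m) i - f i))\<^sup>2)"
      by (intro tendsto_intros f)
    have "(\<Sum>i\<in>F. (cmod (ell2_coeff (X m) i - ell2_coeff (X n) i))\<^sup>2) \<le> e\<^sup>2" if "n \<ge> m" for n
    proof -
      have "(\<Sum>i\<in>F. (cmod (ell2_coeff (X m) i - ell2_coeff (X n) i))\<^sup>2) \<le> (norm (X m - X n))\<^sup>2"
        using sum_ell2_coeff_le[OF \<open>finite F\<close>, of "X m - X n"] by (simp add: ell2_coeff_diff)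
      also have "\<dots> \<le> e\<^sup>2"
        by (rule power_mono) (use e[OF that] in \<open>auto simp: dist_norm\<close>)
      finally show ?thesis .
    qed
    then show "\<exists>N. \<forall>n\<ge>N. (\<Sum>i\<in>F. (cmod (ell2_coeff (X m) i - ell2_coeff (X n) i))\<^sup>2) \<le> e\<^sup>2" by blast
  qed
  have ss: "square_summable (\<lambda>i. ell2_coeff (X m) i - f i)"
    if e: "\<And>n. n \<ge> m \<Longrightarrow> dist (X m) (X n) < e" for m e
    unfolding square_summable_def
    by (rule nonneg_bdd_above_summable_on) (auto intro!: bdd_aboveI fin[OF _ e])
  obtain M where "\<And>m n. m \<ge> M \<Longrightarrow> n \<ge> M \<Longrightarrow> dist (X m) (X n) < 1"
    using metric_CauchyD[OF X, of 1] by auto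
  then have "square_summable (\<lambda>i. ell2_coeff (X M) i - f i)" using ss[of M 1] by auto
  from square_summable_add[OF square_summable_coeff[of "X M"] square_summable_scale[OF this, of "-1"]]
  have "square_summable f" by simp
  then have f': "ell2_coeff (Abs_ell2 f) = f" by (simp add: Abs_ell2_inverse)
  have "X \<longlonglongrightarrow> Abs_ell2 f"
  proof (rule metric_LIMSEQ_I)
    fix e :: real assume "e > 0"
    then obtain M where M: "\<And>m n. m \<ge> M \<Longrightarrow> n \<ge> M \<Longrightarrow> dist (X m) (X n) < e / 2"
      using metric_CauchyD[OF X, of "e / 2"] by auto
    have "dist (X m) (Abs_ell2 f) < e" if "m \<ge> M" for m
    proof -
      have b: "dist (X m) (X n) < e / 2" if "n \<ge> m" for n
        using M[of m n] \<open>m \<ge> M\<close> that by simp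
      have "(norm (X m - Abs_ell2 f))\<^sup>2 \<le> (e / 2)\<^sup>2"
        unfolding power2_norm_ell2 ell2_coeff_diff f'
        by (rule infsum_le_finite_sums)
          (use ss[OF b] fin[OF _ b] in \<open>auto simp: square_summable_def\<close>)
      then have "norm (X m - Abs_ell2 f) \<le> e / 2" using \<open>e > 0\<close> by (auto intro: power2_le_imp_le)
      then show ?thesis using \<open>e > 0\<close> by (simp add: dist_norm)
    qed
    then show "\<exists>M. \<forall>m\<ge>M. dist (X m) (Abs_ell2 f) < e" by blast
  qed
  then show "convergent X" by (auto simp: convergent_def)
qed


section \<open>The model algebras\<close>

lemma square_summable_inj_comp:
  assumes "square_summable f" "inj h"
  shows "square_summable (\<lambda>i. f (h i))"
proof -
  have "(\<lambda>i. (cmod (f i))\<^sup>2) summable_on range h"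
    by (rule summable_on_subset_banach[OF assms(1)[unfolded square_summable_def]]) simp
  then show ?thesis
    using summable_on_reindex[OF \<open>inj h\<close>, of "\<lambda>i. (cmod (f i))\<^sup>2"]
    by (simp add: square_summable_def o_def)
qed

lemma square_summable_extend:
  assumes "square_summable (\<lambda>i. g (h i))" "inj h" "\<And>j. j \<notin> range h \<Longrightarrow> g j = 0"
  shows "square_summable g"
proof -
  have "(\<lambda>j. (cmod (g j))\<^sup>2) summable_on range h"
    using assms(1) summable_on_reindex[OF \<open>inj h\<close>, of "\<lambda>i. (cmod (g i))\<^sup>2"]
    by (simp add: square_summable_def o_def)
  then show ?thesis
    unfolding square_summable_def
    by (rule summable_on_cong_neutral[THEN iffD1, rotated -1]) (use assms(3) in auto)
qed

lemma square_summable_finite_support: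
  assumes "finite F" "\<And>j. j \<notin> F \<Longrightarrow> g j = 0"
  shows "square_summable g"
  unfolding square_summable_def
  by (rule finite_nonzero_values_imp_summable_on, rule finite_subset[OF _ assms(1)])
    (use assms(2) in auto)

definition ell2_basis :: "'i \<Rightarrow> 'i ell2" where
  "ell2_basis i = Abs_ell2 (\<lambda>j. if j = i then 1 else 0)"

lemma ell2_coeff_basis: "ell2_coeff (ell2_basis i) j = (if j = i then 1 else 0)"
proof -
  have "square_summable (\<lambda>j. if j = i then 1 else 0)"
    by (rule square_summable_finite_support[of "{i}"]) auto
  then show ?thesis by (simp add: ell2_basis_def Abs_ell2_inverse)
qed

text \<open>The Fock space is \<open>'n list ell2\<close>. The left creation operator \<open>\<xi>\<^sub>w \<mapsto> \<xi>\<^sub>i\<^sub>w\<close> is given by its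
  effect on coefficients: the coefficient at \<open>w\<close> is moved to the word \<open>i # w\<close>.\<close>

definition creation :: "'n \<Rightarrow> 'n list ell2 \<Rightarrow> 'n list ell2" where
  "creation i f = Abs_ell2 (\<lambda>w. case w of [] \<Rightarrow> 0 | j # u \<Rightarrow> if j = i then ell2_coeff f u else 0)"

lemma ell2_coeff_creation:
  "ell2_coeff (creation i f) w = (case w of [] \<Rightarrow> 0 | j # u \<Rightarrow> if j = i then ell2_coeff f u else 0)"
proof -
  have "square_summable (\<lambda>w. case w of [] \<Rightarrow> 0 | j # u \<Rightarrow> if j = i then ell2_coeff f u else 0)"
    by (rule square_summable_extend[where h = "Cons i"])
      (auto simp: square_summable_coeff split: list.split)
  then show ?thesis by (simp add: creation_def Abs_ell2_inverse)
qed

lemma creation_basis: "creation i (ell2_basis w) = ell2_basis (i # w)"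
  by (auto simp: ell2_coeff_inject[symmetric] fun_eq_iff ell2_coeff_creation ell2_coeff_basis
      split: list.split)

definition free_semigroup_algebra :: "('n list ell2 \<Rightarrow> 'n list ell2) set" where
  "free_semigroup_algebra = wot_algebra (range creation)"

text \<open>For \<open>\<alpha> = d (n - 1)\<close>, the direct sum of \<open>\<V>'\<close>, \<open>dim \<V>' = d\<close>, and \<open>\<alpha>\<close> copies of the Fock space is
  the closed subspace of those families that are supported on the indices \<open>Inl j\<close>, \<open>j < d\<close>
  (coordinates of \<open>\<V>'\<close>), and \<open>Inr (k, w)\<close>, \<open>k < \<alpha>\<close> (coefficient at \<open>w\<close> in the \<open>k\<close>-th copy).\<close>

type_synonym 'n model_space = "(nat + nat \<times> 'n list) ell2"

definition model_carrier :: "nat \<Rightarrow> 'n :: finite model_space set" where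
  "model_carrier d = {f. (\<forall>j\<ge>d. ell2_coeff f (Inl j) = 0) \<and>
     (\<forall>k\<ge>d * (CARD('n) - 1). \<forall>w. ell2_coeff f (Inr (k, w)) = 0)}"

definition model_proj :: "nat \<Rightarrow> 'n model_space \<Rightarrow> 'n model_space" where
  "model_proj d f = Abs_ell2 (\<lambda>p. case p of Inl j \<Rightarrow> if j < d then ell2_coeff f (Inl j) else 0 | Inr _ \<Rightarrow> 0)"

lemma ell2_coeff_model_proj:
  "ell2_coeff (model_proj d f) p = (case p of Inl j \<Rightarrow> if j < d then ell2_coeff f (Inl j) else 0 | Inr _ \<Rightarrow> 0)"
proof -
  have "square_summable
      (\<lambda>p :: nat + nat \<times> 'a list. case p of Inl j \<Rightarrow> if j < d then ell2_coeff f (Inl j) else 0 | Inr _ \<Rightarrow> 0)"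
    by (rule square_summable_finite_support[of "Inl ` {..<d}"]) (auto split: sum.split)
  then show ?thesis by (simp add: model_proj_def Abs_ell2_inverse)
qed

definition component :: "nat \<Rightarrow> 'n model_space \<Rightarrow> 'n list ell2" where
  "component k f = Abs_ell2 (\<lambda>w. ell2_coeff f (Inr (k, w)))"

lemma ell2_coeff_component: "ell2_coeff (component k f) w = ell2_coeff f (Inr (k, w))"
  using square_summable_inj_comp[OF square_summable_coeff, of "\<lambda>w. Inr (k, w)" f]
  by (simp add: component_def Abs_ell2_inverse inj_def)

definition zero_plus_ampliation ::
    "nat \<Rightarrow> ('n list ell2 \<Rightarrow> 'n list ell2) \<Rightarrow> 'n model_space \<Rightarrow> 'n model_space" where
  "zero_plus_ampliation \<alpha> X f = Abs_ell2 (\<lambda>p. case p of Inl _ \<Rightarrow> 0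
     | Inr (k, w) \<Rightarrow> if k < \<alpha> then ell2_coeff (X (component k f)) w else 0)"

lemma ell2_coeff_zero_plus_ampliation:
  "ell2_coeff (zero_plus_ampliation \<alpha> X f) p =
    (case p of Inl _ \<Rightarrow> 0 | Inr (k, w) \<Rightarrow> if k < \<alpha> then ell2_coeff (X (component k f)) w else 0)"
proof -
  have "square_summable (\<lambda>p :: nat + nat \<times> 'a list. case p of Inl _ \<Rightarrow> 0
    | Inr (k, w) \<Rightarrow> if k < \<alpha> then ell2_coeff (X (component k f)) w else 0)"
  proof (induction \<alpha>)
    case 0
    show ?case by (rule square_summable_finite_support[of "{}"]) (auto split: sum.split)
  next
    case (Suc \<alpha>)
    have "square_summable (\<lambda>p :: nat + nat \<times> 'a list. case p of Inl _ \<Rightarrow> 0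
        | Inr (k, w) \<Rightarrow> if k = \<alpha> then ell2_coeff (X (component k f)) w else 0)"
      by (rule square_summable_extend[where h = "\<lambda>w. Inr (\<alpha>, w)"])
        (auto simp: square_summable_coeff inj_def split: sum.split)
    from square_summable_add[OF Suc this] show ?case
      by (rule arg_cong[where f = square_summable, THEN iffD1, rotated])
        (auto simp: fun_eq_iff less_Suc_eq split: sum.split)
  qed
  then show ?thesis by (simp add: zero_plus_ampliation_def Abs_ell2_inverse)
qed

definition model_algebra :: "nat \<Rightarrow> ('n :: finite model_space \<Rightarrow> 'n model_space) set" where
  "model_algebra d = {\<lambda>f. Y (model_proj d f) + zero_plus_ampliation (d * (CARD('n) - 1)) X f |Y X.
     Y \<in> bounded_ops_on (model_carrier d) \<and> X \<in> free_semigroup_algebra}"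

end

(* If Phi(Z) = Z >= 0, the eigenspace of Z at its largest eigenvalue is invariant under all A_i^* and, if
   the eigenvalue is positive, the defect I - Phi(I) vanishes on it.  Applied to Phi^oo(I) this gives
   (1) <-> (1'), and applied to the limit of Phi^k(I - P), P the projection onto V_0, it gives (2) <-> (2').

   A nonzero S^*-invariant subspace on which sum S_i S_i^* = I meets V, by compactness of the unit ball of V.
   Hence a reducing subspace whose compression to V is all of V, and on whose complement sum S_i S_i^* = I, is
   the whole space.  In case (1) a single wandering vector therefore generates the space, so the dilation is the
   left regular one.  In case (2) V_0 generates the space, and the commutant of S and S^* is trivial because it
   compresses to fixed points of Phi.

   In case (2), moreover, an operator T belongs to the weakly closed algebra if T x lies in the closed cyclic subspace of x
   for all amplifications.  Multiplicity is available inside the Cuntz tuple itself: the words of length m give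
   isometries with orthogonal ranges summing to I.  In the Wold decomposition of the cyclic subspace, the
   Cuntz part is reducing and so invariant under every amplified operator, as the commutant is trivial.  A wandering
   vector has no component in V_0: its component would have a square summable orbit under the compressed tuple, and
   such vectors form an invariant subspace that is zero by minimality.  Hence only the action of T on the
   complement of V_0 matters, and there the tuple is a multiple of the left regular one. *)

theory Submission
  imports Defs
begin

section \<open>Operators and projections on Hilbert spaces\<close>

text \<open>The top eigenspace is invariant because of an equality case. If the form of a fixed
  point Z attains its maximum l on the unit sphere at x, then l is the sum of the values of the form
  at the vectors \<open>Ad i x\<close>, hence at most l times the sum of their squared norms. As
  soon as this is at most l, every \<open>Ad i x\<close> has to attain l too. Finite dimension
  enters through the compactness that provides the maximum.

  The obstacle in case (2) is the corner of the model in which every operator defined on V_0 occurs: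
  each must be a weak limit of polynomials in S, and no formula for such polynomials is at hand. The
  orbit criterion avoids constructing any: approximating T on finitely many vectors is the same as
  approximating its amplification on one vector, and membership in an orbit closure is decided by
  the structure of that closure, where the values of T on V_0 turn out to be unconstrained. The
  number n enters here: for n >= 2 the n^m words of length m eventually outnumber any finite set of
  vectors.\<close>

lemma cinner_self: "cinner x x = of_real ((norm x)\<^sup>2)"
proof -
  have "Im (cinner x x) = 0" using arg_cong[OF cinner_commute[of x x], of Im] by simp
  then show ?thesis by (simp add: complex_eq_iff Re_cinner power2_norm_eq_inner)
qed

lemma norm_scaleC: "norm (c *\<^sub>C (x :: 'a :: complex_inner)) = cmod c * norm x"
proof -
  have "(norm (c *\<^sub>C x))\<^sup>2 = Re (c * cnj c * cinner x x)"
    by (simp only: power2_norm_eq_inner Re_cinner[symmetric] cinner_scaleC_left cinner_scaleC_right mult_ac)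
  also have "\<dots> = (cmod c * norm x)\<^sup>2"
    by (simp add: cinner_self complex_norm_square[symmetric] power_mult_distrib del: of_real_power flip: of_real_mult)
  finally show ?thesis by simp
qed

text \<open>Multiplying x by a unimodular constant makes the complex inner product real and
  nonnegative, which reduces the claim to the real Cauchy-Schwarz inequality.\<close>

lemma cinner_bound: "cmod (cinner x y) \<le> norm x * norm (y :: 'a :: complex_inner)"
proof (cases "cinner x y = 0")
  case False
  define c where "c = cnj (sgn (cinner x y))"
  have c: "cmod c = 1" using False by (simp add: c_def norm_sgn)
  have "cmod (cinner x y) = Re (c * cinner x y)"
    by (simp add: c_def sgn_eq complex_cnj_divide mult.commute complex_norm_square[symmetric]
        power2_eq_square False flip: of_real_mult of_real_divide)
  also have "\<dots> = inner (c *\<^sub>C x) y" by (simp add: Re_cinner[symmetric] cinner_scaleC_left)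
  also have "\<dots> \<le> norm (c *\<^sub>C x) * norm y" by (rule norm_cauchy_schwarz)
  finally show ?thesis by (simp add: norm_scaleC c)
qed simp

lemma scaleC_scaleR: "r *\<^sub>R (x :: 'a :: complex_inner) = of_real r *\<^sub>C x"
  by (simp add: scaleC_of_real)

text \<open>Registered over the reals, since the form is only sesquilinear over the complex numbers.
  This provides sums, limits and continuity; complex scalars are moved by
  \<open>cinner_scaleC_left\<close> and \<open>cinner_scaleC_right\<close>.\<close>

interpretation cinner: bounded_bilinear "cinner :: 'a :: complex_inner \<Rightarrow> 'a \<Rightarrow> complex"
proof
  show "\<exists>K. \<forall>a b :: 'a. cmod (cinner a b) \<le> norm a * norm b * K"
    by (rule exI[of _ 1]) (simp add: cinner_bound)
qed (simp_all add: cinner_add_left cinner_add_right scaleC_scaleR cinner_scaleC_left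
    cinner_scaleC_right scaleR_conv_of_real)

lemmas cinner_simps = cinner.add_left cinner.add_right cinner.diff_left cinner.diff_right
  cinner.minus_left cinner.minus_right cinner_scaleC_left cinner_scaleC_right
  cinner.zero_left cinner.zero_right

lemma cinner_eqI_left: "(\<And>y. cinner x y = cinner z (y :: 'a :: complex_inner)) \<Longrightarrow> x = z"
  by (metis cinner_commute cinner_eqI)

lemma cinner_eq_0_iff [simp]: "cinner x x = 0 \<longleftrightarrow> x = (0 :: 'a :: complex_inner)"
  by (simp add: cinner_self)

lemma cinner_sym_0: "cinner x y = 0 \<longleftrightarrow> cinner y (x :: 'a :: complex_inner) = 0"
  by (metis cinner_commute complex_cnj_zero)

lemma norm_pythagoras:
  assumes "cinner x y = 0"
  shows "(norm (x + y))\<^sup>2 = (norm x)\<^sup>2 + (norm (y :: 'a :: complex_inner))\<^sup>2"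
proof -
  have "inner x y = 0" using assms by (simp flip: Re_cinner)
  then show ?thesis by (simp add: power2_norm_eq_inner inner_simps inner_commute)
qed

lemma bounded_clinearD:
  assumes "bounded_clinear T"
  shows bounded_clinear_bounded_linear: "bounded_linear T"
    and bounded_clinear_add: "T (x + y) = T x + T y"
    and bounded_clinear_diff: "T (x - y) = T x - T y"
    and bounded_clinear_minus: "T (- x) = - T x"
    and bounded_clinear_zero: "T 0 = 0"
    and bounded_clinear_scaleC: "T (c *\<^sub>C x) = c *\<^sub>C T x"
    and bounded_clinear_sum: "T (sum f I) = (\<Sum>i\<in>I. T (f i))"
proof -
  show 1: "bounded_linear T" using assms by (simp add: bounded_clinear_def)
  then interpret bounded_linear T .
  show "T (x + y) = T x + T y" "T (x - y) = T x - T y" "T 0 = 0" "T (- x) = - T x"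
    "T (sum f I) = (\<Sum>i\<in>I. T (f i))"
    by (simp_all add: add diff zero sum neg)
  show "T (c *\<^sub>C x) = c *\<^sub>C T x" using assms by (simp add: bounded_clinear_def)
qed

lemma bounded_clinear_zero_op [simp, intro]: "bounded_clinear (\<lambda>x. 0)"
  by (simp add: bounded_clinear_def)

lemma bounded_clinear_ident [simp, intro]: "bounded_clinear (\<lambda>x. x)" "bounded_clinear id"
  by (simp_all add: bounded_clinear_def id_def)

lemma bounded_clinear_plus [intro]:
  "bounded_clinear T \<Longrightarrow> bounded_clinear R \<Longrightarrow> bounded_clinear (\<lambda>x. T x + R x)"
  by (simp add: bounded_clinear_def bounded_linear_add scaleC_add_right)

lemma bounded_clinear_cmul [intro]:
  assumes "bounded_clinear T" shows "bounded_clinear (\<lambda>x. c *\<^sub>C T x)"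
proof -
  obtain K where "\<And>x. norm (T x) \<le> norm x * K"
    using bounded_linear.bounded[OF bounded_clinear_bounded_linear[OF assms]] by blast
  then have K: "norm (c *\<^sub>C T x) \<le> norm x * (cmod c * K)" for x
    unfolding norm_scaleC mult.left_commute[of "norm x"] by (simp add: mult_left_mono)
  have "bounded_linear (\<lambda>x. c *\<^sub>C T x)"
    by (rule bounded_linear_intro[OF _ _ K])
      (simp_all add: bounded_clinearD[OF assms] scaleC_add_right scaleC_scaleR mult.commute scaleC_scaleC)
  then show ?thesis
    by (simp add: bounded_clinear_def bounded_clinear_scaleC[OF assms] scaleC_scaleC mult.commute)
qed

lemma bounded_clinear_uminus [intro]:
  "bounded_clinear T \<Longrightarrow> bounded_clinear (\<lambda>x. - T x)"
  using bounded_clinear_cmul[of T "-1"] by simp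

lemma bounded_clinear_minus_op [intro]:
  "bounded_clinear T \<Longrightarrow> bounded_clinear R \<Longrightarrow> bounded_clinear (\<lambda>x. T x - R x)"
  using bounded_clinear_plus[of T "\<lambda>x. - R x"] by auto

lemma bounded_clinear_compose:
  "bounded_clinear T \<Longrightarrow> bounded_clinear R \<Longrightarrow> bounded_clinear (\<lambda>x. T (R x))"
  by (simp add: bounded_clinear_def bounded_linear_compose)

lemma bounded_clinear_comp [intro]:
  "bounded_clinear T \<Longrightarrow> bounded_clinear R \<Longrightarrow> bounded_clinear (T \<circ> R)"
  by (simp add: o_def bounded_clinear_compose)

lemma bounded_clinear_setsum [intro]:
  "(\<And>i. i \<in> I \<Longrightarrow> bounded_clinear (T i)) \<Longrightarrow> bounded_clinear (\<lambda>x. \<Sum>i\<in>I. T i x)"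
  by (induction I rule: infinite_finite_induct) auto

lemma bounded_clinear_tendsto:
  "bounded_clinear T \<Longrightarrow> (f \<longlongrightarrow> l) F \<Longrightarrow> ((\<lambda>x. T (f x)) \<longlongrightarrow> T l) F"
  by (rule bounded_linear.tendsto[OF bounded_clinear_bounded_linear])

lemma bounded_clinear_continuous_on: "bounded_clinear T \<Longrightarrow> continuous_on X T"
  by (rule linear_continuous_on[OF bounded_clinear_bounded_linear])

lemma bounded_clinear_bound:
  assumes "bounded_clinear T" obtains K where "K > 0" "\<And>x. norm (T x) \<le> K * norm x"
  using bounded_linear.pos_bounded[OF bounded_clinear_bounded_linear[OF assms]]
  by (auto simp: mult.commute)

lemma cadjoint_unique:
  fixes T :: "'a :: chilbert_space \<Rightarrow> 'b :: complex_inner"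
  assumes "bounded_clinear T" "\<And>x y. cinner (T x) y = cinner x (R y)"
  shows "cadjoint T = R"
proof
  fix y show "cadjoint T y = R y"
    by (rule cinner_eqI) (simp add: cinner_cadjoint[OF assms(1), symmetric] assms(2))
qed

lemma cinner_cadjoint_left:
  fixes T :: "'a :: chilbert_space \<Rightarrow> 'b :: complex_inner"
  assumes "bounded_clinear T"
  shows "cinner (cadjoint T y) x = cinner y (T x)"
  by (metis assms cinner_cadjoint cinner_commute)

lemma cadjoint_cadjoint:
  fixes T :: "'a :: chilbert_space \<Rightarrow> 'b :: chilbert_space"
  assumes "bounded_clinear T"
  shows "cadjoint (cadjoint T) = T"
  by (rule cadjoint_unique) (simp_all add: assms bounded_clinear_cadjoint cinner_cadjoint_left)

lemma cadjoint_id: "cadjoint id = (id :: 'a :: chilbert_space \<Rightarrow> 'a)"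
  by (rule cadjoint_unique) auto

lemma cadjoint_comp:
  fixes T :: "'b :: chilbert_space \<Rightarrow> 'c :: complex_inner" and R :: "'a :: chilbert_space \<Rightarrow> 'b"
  assumes "bounded_clinear T" "bounded_clinear R"
  shows "cadjoint (T \<circ> R) = cadjoint R \<circ> cadjoint T"
  by (rule cadjoint_unique) (auto simp: assms cinner_cadjoint)

lemma cadjoint_plus:
  fixes T :: "'a :: chilbert_space \<Rightarrow> 'c :: complex_inner"
  assumes "bounded_clinear T" "bounded_clinear R"
  shows "cadjoint (\<lambda>x. T x + R x) = (\<lambda>x. cadjoint T x + cadjoint R x)"
  by (rule cadjoint_unique) (auto simp: assms cinner_cadjoint cinner_simps)

lemma cadjoint_scaleC:
  fixes T :: "'a :: chilbert_space \<Rightarrow> 'c :: complex_inner"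
  assumes "bounded_clinear T"
  shows "cadjoint (\<lambda>x. c *\<^sub>C T x) = (\<lambda>x. cnj c *\<^sub>C cadjoint T x)"
  by (rule cadjoint_unique) (auto simp: assms cinner_cadjoint cinner_simps)

lemma isometryD:
  assumes "isometry T"
  shows isometry_bounded_clinear: "bounded_clinear T"
    and isometry_norm: "norm (T x) = norm x"
    and isometry_cinner: "cinner (T x) (T y) = cinner x y"
proof -
  show T: "bounded_clinear T" and N: "norm (T x) = norm x" for x
    using assms by (simp_all add: isometry_def)
  \<comment> \<open>Polarization of the norm. The imaginary part of \<open>cinner\<close> is the
    real part at the rotated vector, so this real identity suffices.\<close>
  have i: "inner (T x) (T y) = inner x y" for x y
  proof -
    have "(norm (T (x + y)))\<^sup>2 = (norm (x + y))\<^sup>2" "(norm (T x))\<^sup>2 = (norm x)\<^sup>2" "(norm (T y))\<^sup>2 = (norm y)\<^sup>2"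
      by (simp_all add: N)
    then show ?thesis
      unfolding power2_norm_eq_inner by (simp add: bounded_clinear_add[OF T] inner_simps inner_commute)
  qed
  show "cinner (T x) (T y) = cinner x y"
    using i[of x y] i[of "\<i> *\<^sub>C x" y] by (simp add: complex_eq_iff Re_cinner Im_cinner bounded_clinear_scaleC[OF T])
qed

lemma isometry_cadjoint:
  fixes T :: "'a :: chilbert_space \<Rightarrow> 'b :: complex_inner"
  assumes "isometry T" shows "cadjoint T (T x) = x"
  by (rule cinner_eqI) (simp add: cinner_cadjoint[symmetric] isometryD[OF assms])

lemma csubspaceD:
  assumes "csubspace M"
  shows csubspace_0: "0 \<in> M"
    and csubspace_add: "x \<in> M \<Longrightarrow> y \<in> M \<Longrightarrow> x + y \<in> M"
    and csubspace_diff: "x \<in> M \<Longrightarrow> y \<in> M \<Longrightarrow> x - y \<in> M"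
    and csubspace_scale: "x \<in> M \<Longrightarrow> c *\<^sub>C x \<in> M"
    and csubspace_scaleR: "x \<in> M \<Longrightarrow> r *\<^sub>R x \<in> M"
    and csubspace_sum: "(\<And>i. i \<in> I \<Longrightarrow> f i \<in> M) \<Longrightarrow> sum f I \<in> M"
  using assms complex_vector.subspace_0 complex_vector.subspace_add complex_vector.subspace_diff
    complex_vector.subspace_scale complex_vector.subspace_sum[of M I f] by (auto simp: scaleC_scaleR)

lemma csubspaceI:
  "0 \<in> M \<Longrightarrow> (\<And>x y. x \<in> M \<Longrightarrow> y \<in> M \<Longrightarrow> x + y \<in> M) \<Longrightarrow> (\<And>c x. x \<in> M \<Longrightarrow> c *\<^sub>C x \<in> M) \<Longrightarrow> csubspace M"
  by (rule complex_vector.subspaceI)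

lemma csubspace_closure:
  assumes "csubspace M" shows "csubspace (closure M)"
proof (rule csubspaceI)
  show "0 \<in> closure M" using assms closure_subset csubspace_0 by blast
  fix x y c assume "x \<in> closure M"
  then obtain f where f: "\<And>n. f n \<in> M" "f \<longlonglongrightarrow> x" by (auto simp: closure_sequential)
  show "c *\<^sub>C x \<in> closure M"
    using f bounded_clinear_tendsto[OF bounded_clinear_cmul[OF bounded_clinear_ident(1)] f(2), of c]
    by (auto simp: closure_sequential intro!: exI[of _ "\<lambda>n. c *\<^sub>C f n"] csubspace_scale assms)
  assume "y \<in> closure M"
  then obtain g where g: "\<And>n. g n \<in> M" "g \<longlonglongrightarrow> y" by (auto simp: closure_sequential)
  show "x + y \<in> closure M"
    using f g by (auto simp: closure_sequential intro!: exI[of _ "\<lambda>n. f n + g n"] csubspace_add assms tendsto_add)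
qed

lemma closed_csubspace_closure_span:
  "closed (closure (cspan X))" "csubspace (closure (cspan X))"
  by (auto intro: csubspace_closure)

lemma closure_cspan_minimal: "X \<subseteq> M \<Longrightarrow> csubspace M \<Longrightarrow> closed M \<Longrightarrow> closure (cspan X) \<subseteq> M"
  by (simp add: closure_minimal complex_vector.span_minimal)

lemma closure_cspan_superset: "X \<subseteq> closure (cspan X)"
  by (meson closure_subset complex_vector.span_superset order_trans)

lemma csubspace_orthocompl: "csubspace (orthocompl M)"
  by (rule csubspaceI) (auto simp: orthocompl_def cinner_simps)

lemma closed_orthocompl: "closed (orthocompl M)"
proof -
  have "orthocompl M = (\<Inter>y\<in>M. {x. cinner x y = 0})" by (auto simp: orthocompl_def)
  moreover have "closed {x. cinner x y = 0}" for y :: 'a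
    by (rule closed_Collect_eq) (auto intro!: continuous_intros linear_continuous_on cinner.bounded_linear_left)
  ultimately show ?thesis by auto
qed

lemma orthocomplD: "x \<in> orthocompl M \<Longrightarrow> y \<in> M \<Longrightarrow> cinner x y = 0"
  by (simp add: orthocompl_def)

lemma orthocomplD': "x \<in> orthocompl M \<Longrightarrow> y \<in> M \<Longrightarrow> cinner y x = 0"
  by (metis cinner_sym_0 orthocomplD)

lemma csubspace_vimage:
  "bounded_clinear T \<Longrightarrow> csubspace M \<Longrightarrow> csubspace {x. T x \<in> M}"
  by (rule csubspaceI) (auto simp: bounded_clinearD csubspaceD)

lemma csubspace_image:
  "bounded_clinear T \<Longrightarrow> csubspace M \<Longrightarrow> csubspace (T ` M)"
proof (rule csubspaceI)
  assume T: "bounded_clinear T" and M: "csubspace M"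
  show "0 \<in> T ` M" using bounded_clinear_zero[OF T] csubspace_0[OF M] by (metis imageI)
  fix x y c assume "x \<in> T ` M" 
  then show "c *\<^sub>C x \<in> T ` M" by (auto simp: bounded_clinear_scaleC[OF T, symmetric] csubspace_scale[OF M])
  assume "y \<in> T ` M"
  with \<open>x \<in> T ` M\<close> show "x + y \<in> T ` M"
    by (auto simp: bounded_clinear_add[OF T, symmetric] csubspace_add[OF M])
qed

lemma closed_vimage_bounded_clinear:
  "bounded_clinear T \<Longrightarrow> closed M \<Longrightarrow> closed {x. T x \<in> M}"
  using closed_vimage[of M T] bounded_clinear_continuous_on[of T UNIV] by (simp add: vimage_def)

section \<open>Orthogonal projections onto closed subspaces\<close>

definition is_proj :: "'a :: complex_inner set \<Rightarrow> 'a \<Rightarrow> 'a \<Rightarrow> bool" where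
  "is_proj M x y \<longleftrightarrow> y \<in> M \<and> x - y \<in> orthocompl M"

definition proj :: "'a :: complex_inner set \<Rightarrow> 'a \<Rightarrow> 'a" where
  "proj M x = (SOME y. is_proj M x y)"

lemma is_proj_unique:
  assumes "csubspace M" "is_proj M x y" "is_proj M x z"
  shows "y = z"
proof -
  have 1: "y - z \<in> M" using assms by (auto simp: is_proj_def csubspace_diff)
  have "y - z = (x - z) - (x - y)" by simp
  then have 2: "y - z \<in> orthocompl M"
    using assms csubspace_diff[OF csubspace_orthocompl] unfolding is_proj_def by metis
  show ?thesis using orthocomplD[OF 2 1] by simp
qed

text \<open>By the parallelogram law a minimizing sequence is Cauchy: the midpoint of two of its
  members lies in M and is no closer to x than the infimum.\<close>

lemma nearest_point_exists:
  fixes M :: "'a :: chilbert_space set"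
  assumes "csubspace M" "closed M"
  shows "\<exists>y\<in>M. \<forall>z\<in>M. norm (x - y) \<le> norm (x - z)"
proof -
  define q where "q y = (norm (x - y))\<^sup>2" for y
  define m where "m = Inf (q ` M)"
  have ne: "q ` M \<noteq> {}" using csubspace_0[OF assms(1)] by auto
  have bdd: "bdd_below (q ` M)" by (intro bdd_belowI[of _ 0]) (auto simp: q_def)
  have m_le: "m \<le> q y" if "y \<in> M" for y unfolding m_def using bdd that by (auto intro: cInf_lower)
  have "\<exists>y. y \<in> M \<and> q y < m + inverse (real (Suc k))" for k
    using cInf_lessD[OF ne, of "m + inverse (real (Suc k))"] unfolding m_def by auto
  then obtain s where s: "\<And>k. s k \<in> M" "\<And>k. q (s k) < m + inverse (real (Suc k))" by metis
  have par: "(norm (y - z))\<^sup>2 \<le> 2 * (q y + q z - 2 * m)" if "y \<in> M" "z \<in> M" for y z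
  proof -
    have "(1/2) *\<^sub>R (y + z) \<in> M" using that assms by (auto intro: csubspaceD)
    then have "q ((1/2) *\<^sub>R (y + z)) \<ge> m" by (rule m_le)
    then show ?thesis
      unfolding q_def power2_norm_eq_inner by (simp add: inner_simps inner_commute field_simps)
  qed
  have "Cauchy s"
  proof (rule metric_CauchyI)
    fix e :: real assume e: "e > 0"
    then obtain N where N: "inverse (real (Suc N)) < e\<^sup>2 / 4"
      using reals_Archimedean[of "e\<^sup>2 / 4"] by auto
    have "dist (s i) (s j) < e" if "i \<ge> N" "j \<ge> N" for i j
    proof -
      define r where "r k = inverse (real (Suc k))" for k
      have "r i \<le> r N" "r j \<le> r N" using that by (auto simp: r_def intro!: le_imp_inverse_le)
      moreover have "q (s i) < m + r i" "q (s j) < m + r j" "r N < e\<^sup>2 / 4"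
        using s N by (simp_all only: r_def)
      ultimately have "(norm (s i - s j))\<^sup>2 < e\<^sup>2"
        using par[of "s i" "s j"] s(1) by fastforce
      then show ?thesis using e by (simp add: dist_norm power2_less_imp_less)
    qed
    then show "\<exists>M. \<forall>i\<ge>M. \<forall>j\<ge>M. dist (s i) (s j) < e" by blast
  qed
  then obtain y where y: "s \<longlonglongrightarrow> y" using Cauchy_convergent convergent_def by blast
  have yM: "y \<in> M" using closed_sequentially[OF assms(2)] s(1) y by blast
  have "(\<lambda>k. q (s k)) \<longlonglongrightarrow> q y" unfolding q_def by (intro tendsto_intros y)
  moreover have "(\<lambda>k. m + inverse (real (Suc k))) \<longlonglongrightarrow> m + 0"
    by (intro tendsto_intros LIMSEQ_inverse_real_of_nat)
  ultimately have "q y \<le> m + 0"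
    by (rule LIMSEQ_le) (use s in \<open>auto intro: less_imp_le\<close>)
  then have "q y \<le> q z" if "z \<in> M" for z using m_le[OF that] by linarith
  then have "norm (x - y) \<le> norm (x - z)" if "z \<in> M" for z
    using that unfolding q_def by (meson norm_ge_zero power2_le_imp_le)
  then show ?thesis using yM by blast
qed

lemma is_proj_proj:
  fixes M :: "'a :: chilbert_space set"
  assumes M: "csubspace M" "closed M"
  shows "is_proj M x (proj M x)"
proof -
  obtain y where y: "y \<in> M" "\<And>z. z \<in> M \<Longrightarrow> norm (x - y) \<le> norm (x - z)"
    using nearest_point_exists[OF M] by blast
  have re: "inner (x - y) z = 0" if z: "z \<in> M" for z
  proof -
    define b where "b = inner (x - y) z"
    \<comment> \<open>Nearly the best step from y in direction z. The optimum would divide by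
      \<open>inner z z\<close>; adding 1 avoids division by zero and still moves closer to x unless
      b is 0.\<close>
    define t where "t = b / (inner z z + 1)"
    have pos: "inner z z + 1 > 0" by (simp add: add_nonneg_pos)
    have "y + t *\<^sub>R z \<in> M" using z y M by (auto intro: csubspaceD)
    from power_mono[OF y(2)[OF this], of 2]
    have "0 \<le> t\<^sup>2 * inner z z - 2 * t * b"
      unfolding b_def power2_norm_eq_inner
      by (simp add: inner_simps inner_commute power2_eq_square algebra_simps)
    moreover have "t * (inner z z + 1) = b" using pos by (simp add: t_def)
    then have "t\<^sup>2 * (inner z z + 1) = t * b" by (simp only: power2_eq_square mult.assoc)
    ultimately have "0 \<le> - (t\<^sup>2 * inner z z) - 2 * t\<^sup>2" by (simp add: algebra_simps)
    moreover have "t\<^sup>2 * inner z z \<ge> 0" by simp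
    ultimately have "t\<^sup>2 \<le> 0" by linarith
    then have "t = 0" by simp
    then show ?thesis using pos by (simp add: t_def b_def)
  qed
  have "cinner (x - y) z = 0" if z: "z \<in> M" for z
    using re[OF z] re[OF csubspace_scale[OF M(1) z, of "\<i>"]]
    by (auto simp: complex_eq_iff Re_cinner[symmetric] cinner_scaleC_right)
  then have "is_proj M x y" using y by (simp add: is_proj_def orthocompl_def)
  then show ?thesis unfolding proj_def by (rule someI)
qed

lemma bounded_clinearI:
  assumes "\<And>x y. T (x + y) = T x + T y" "\<And>c x. T (c *\<^sub>C x) = c *\<^sub>C T x" "\<And>x. norm (T x) \<le> norm x * K"
  shows "bounded_clinear T"
  unfolding bounded_clinear_def
  using bounded_linear_intro[of T K] assms by (auto simp: scaleC_scaleR)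

context
  fixes M :: "'a :: chilbert_space set"
  assumes M: "csubspace M" "closed M"
begin

lemma proj_in: "proj M x \<in> M"
  using is_proj_proj[OF M] by (simp add: is_proj_def)

lemma proj_orth: "x - proj M x \<in> orthocompl M"
  using is_proj_proj[OF M] by (simp add: is_proj_def)

lemma proj_eqI: "y \<in> M \<Longrightarrow> x - y \<in> orthocompl M \<Longrightarrow> proj M x = y"
  using is_proj_unique[OF M(1) is_proj_proj[OF M]] by (simp add: is_proj_def)

lemma proj_ident: "x \<in> M \<Longrightarrow> proj M x = x"
  by (rule proj_eqI) (auto simp: csubspace_0 csubspace_orthocompl)

lemma proj_0: "x \<in> orthocompl M \<Longrightarrow> proj M x = 0"
  by (rule proj_eqI) (auto simp: csubspace_0 M)

lemma proj_idem: "proj M (proj M x) = proj M x"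
  by (simp add: proj_ident proj_in)

lemma cinner_proj: "cinner (proj M x) y = cinner x (proj M y)"
proof -
  have "cinner (proj M x) (y - proj M y) = 0" "cinner (x - proj M x) (proj M y) = 0"
    using orthocomplD[OF proj_orth proj_in] orthocomplD'[OF proj_orth proj_in] by auto
  then show ?thesis by (simp add: cinner_simps)
qed

lemma norm_proj_pythagoras: "(norm x)\<^sup>2 = (norm (proj M x))\<^sup>2 + (norm (x - proj M x))\<^sup>2"
  using norm_pythagoras[of "proj M x" "x - proj M x"] orthocomplD'[OF proj_orth proj_in] by simp

lemma norm_proj_le: "norm (proj M x) \<le> norm x"
  using norm_proj_pythagoras[of x] by (simp add: power2_le_imp_le)

lemma bounded_clinear_proj: "bounded_clinear (proj M)"
proof (rule bounded_clinearI[of _ 1])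
  fix x y c
  have "x + y - (proj M x + proj M y) = (x - proj M x) + (y - proj M y)" by simp
  then show "proj M (x + y) = proj M x + proj M y"
    by (intro proj_eqI)
      (simp_all only: csubspace_add csubspace_orthocompl M proj_in proj_orth)
  have "c *\<^sub>C x - c *\<^sub>C proj M x = c *\<^sub>C (x - proj M x)"
    by (simp add: complex_vector.scale_right_diff_distrib)
  then show "proj M (c *\<^sub>C x) = c *\<^sub>C proj M x"
    by (intro proj_eqI) (auto intro!: csubspace_scale csubspace_orthocompl M proj_in proj_orth)
qed (simp add: norm_proj_le)

lemma orthocompl_orthocompl: "orthocompl (orthocompl M) = M"
proof
  show "orthocompl (orthocompl M) \<subseteq> M"
  proof
    fix x assume x: "x \<in> orthocompl (orthocompl M)"
    have "cinner x (x - proj M x) = 0" "cinner (proj M x) (x - proj M x) = 0"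
      using orthocomplD[OF x proj_orth] orthocomplD'[OF proj_orth proj_in] by auto
    then have "cinner (x - proj M x) (x - proj M x) = 0" by (simp add: cinner_simps)
    then show "x \<in> M" using proj_in[of x] by simp
  qed
qed (auto simp: orthocompl_def intro: cinner_sym_0[THEN iffD1])

lemma eq_UNIV_if_orthocompl: "(\<And>x. x \<in> orthocompl M \<Longrightarrow> x = 0) \<Longrightarrow> M = UNIV"
  using proj_orth proj_in by (metis UNIV_eq_I eq_iff_diff_eq_0)

lemma proj_commute:
  assumes T: "bounded_clinear T" "\<And>x. x \<in> M \<Longrightarrow> T x \<in> M" "\<And>x. x \<in> orthocompl M \<Longrightarrow> T x \<in> orthocompl M"
  shows "proj M (T x) = T (proj M x)"
proof (rule proj_eqI)
  show "T (proj M x) \<in> M" by (simp add: T proj_in)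
  show "T x - T (proj M x) \<in> orthocompl M"
    using T(3)[OF proj_orth[of x]] by (simp add: bounded_clinear_diff[OF T(1)])
qed

end

lemma orthocompl_invariant:
  fixes T :: "'a :: chilbert_space \<Rightarrow> 'a"
  assumes "bounded_clinear T" "\<And>x. x \<in> M \<Longrightarrow> cadjoint T x \<in> M" "x \<in> orthocompl M"
  shows "T x \<in> orthocompl M"
  using assms by (auto simp: orthocompl_def cinner_cadjoint)

lemma orthocompl_invariant':
  fixes T :: "'a :: chilbert_space \<Rightarrow> 'a"
  assumes "bounded_clinear T" "\<And>x. x \<in> M \<Longrightarrow> T x \<in> M" "x \<in> orthocompl M"
  shows "cadjoint T x \<in> orthocompl M"
  using assms by (auto simp: orthocompl_def cinner_cadjoint_left)

section \<open>Finite-dimensional subspaces, words and generated algebras\<close>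

definition orthonormal :: "'a :: complex_inner set \<Rightarrow> bool" where
  "orthonormal E \<longleftrightarrow> (\<forall>x\<in>E. \<forall>y\<in>E. cinner x y = (if x = y then 1 else 0))"

lemma cinner_sum_orthonormal:
  assumes "finite E" "orthonormal E" "y \<in> E"
  shows "cinner (\<Sum>e\<in>E. c e *\<^sub>C e) y = c y"
proof -
  have "cinner (\<Sum>e\<in>E. c e *\<^sub>C e) y = (\<Sum>e\<in>E. if e = y then c e else 0)"
    using assms unfolding cinner.sum_left
    by (intro sum.cong) (auto simp: cinner_simps orthonormal_def)
  then show ?thesis using assms by simp
qed

lemma orthonormal_expansion:
  assumes "finite E" "orthonormal E" "x \<in> cspan E"
  shows "x = (\<Sum>e\<in>E. cinner x e *\<^sub>C e)"
proof -
  obtain c where "x = (\<Sum>e\<in>E. c e *\<^sub>C e)"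
    using assms(3) complex_vector.span_finite[OF assms(1)] by auto
  then show ?thesis by (simp add: cinner_sum_orthonormal[OF assms(1,2)] cong: sum.cong)
qed

lemma orthonormal_parseval:
  assumes "finite E" "orthonormal E" "x \<in> cspan E"
  shows "(norm x)\<^sup>2 = (\<Sum>e\<in>E. (cmod (cinner x e))\<^sup>2)"
proof -
  have "cinner x x = (\<Sum>e\<in>E. cinner x e * cinner e x)"
    by (subst (1) orthonormal_expansion[OF assms]) (simp add: cinner.sum_left cinner_simps)
  also have "\<dots> = of_real (\<Sum>e\<in>E. (cmod (cinner x e))\<^sup>2)"
    unfolding of_real_sum by (intro sum.cong refl) (metis cinner_commute complex_norm_square)
  finally show ?thesis unfolding cinner_self of_real_eq_iff .
qed

lemma orthonormal_independent:
  assumes "finite E" "orthonormal E"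
  shows "complex_vector.independent E"
  unfolding complex_vector.independent_explicit_finite_subsets
proof safe
  fix A u v assume A: "A \<subseteq> E" "finite A" "(\<Sum>v\<in>A. u v *\<^sub>C v) = 0" "v \<in> A"
  have "orthonormal A" using assms(2) A(1) unfolding orthonormal_def by blast
  from cinner_sum_orthonormal[OF A(2) this A(4), of u] show "u v = 0" unfolding A(3) by (simp add: cinner.zero_left)
qed

lemma cdim_cspan_orthonormal:
  "finite E \<Longrightarrow> orthonormal E \<Longrightarrow> cdim (cspan E) = card E"
  by (simp add: complex_vector.dim_eq_card_independent orthonormal_independent)

lemma cspan_orthonormal_diff:
  assumes "finite E" "orthonormal E"
  shows "b - (\<Sum>e\<in>E. cinner b e *\<^sub>C e) \<in> orthocompl (cspan E)"
proof -
  define r where "r = b - (\<Sum>e\<in>E. cinner b e *\<^sub>C e)"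
  have "E \<subseteq> {x. cinner r x = 0}"
    by (auto simp: r_def cinner_simps cinner_sum_orthonormal[OF assms])
  moreover have "csubspace {x. cinner r x = 0}"
    by (rule csubspaceI) (auto simp: cinner_simps)
  ultimately have "cspan E \<subseteq> {x. cinner r x = 0}" by (rule complex_vector.span_minimal)
  then show ?thesis by (auto simp: orthocompl_def r_def)
qed

lemma orthonormal_insert_normalized:
  assumes "orthonormal E" "r \<noteq> 0" "\<And>e. e \<in> E \<Longrightarrow> cinner r e = 0"
  shows "orthonormal (insert (of_real (inverse (norm r)) *\<^sub>C r) E)"
proof -
  have "cinner e r = 0" if "e \<in> E" for e using assms(3)[OF that] cinner_sym_0 by blast
  moreover have "of_real (inverse (norm r)) *\<^sub>C r \<notin> E"
  proof
    assume "of_real (inverse (norm r)) *\<^sub>C r \<in> E"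
    from assms(3)[OF this] show False using assms(2) by (simp add: cinner_simps)
  qed
  moreover have "inverse (complex_of_real t) * (inverse (complex_of_real t) * (of_real t * of_real t)) = 1"
    if "t \<noteq> 0" for t
    using that by (simp add: field_simps)
  ultimately show ?thesis
    using assms unfolding orthonormal_def
    by (auto simp: cinner_simps cinner_self power2_eq_square)
qed

lemma gram_schmidt:
  assumes "finite B"
  shows "\<exists>E. finite E \<and> orthonormal E \<and> cspan E = cspan B"
  using assms
proof (induction rule: finite_induct)
  case empty
  then show ?case by (intro exI[of _ "{}"]) (simp add: orthonormal_def)
next
  case (insert b B)
  then obtain E where E: "finite E" "orthonormal E" "cspan E = cspan B" by blast
  define s where "s = (\<Sum>e\<in>E. cinner b e *\<^sub>C e)"
  define r where "r = b - s"
  have s: "s \<in> cspan E" unfolding s_def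
    by (intro complex_vector.span_sum complex_vector.span_scale complex_vector.span_base)
  have rE: "cinner r e = 0" if "e \<in> E" for e
    using orthocomplD[OF cspan_orthonormal_diff[OF E(1,2)]] that
    by (auto simp: r_def s_def complex_vector.span_base)
  show ?case
  proof (cases "r = 0")
    case True
    then have "b \<in> cspan B" using s E by (simp add: r_def)
    then show ?thesis using E by (metis complex_vector.span_redundant)
  next
    case False
    define u where "u = of_real (inverse (norm r)) *\<^sub>C r"
    have r: "r = of_real (norm r) *\<^sub>C u"
      using False by (simp add: u_def scaleC_scaleC flip: of_real_mult)
    have "cspan (insert u E) = cspan (insert b E)"
    proof (rule antisym; rule complex_vector.span_minimal)
      have sE: "s \<in> cspan (insert x E)" for x
        using s complex_vector.span_mono[of E "insert x E"] by auto
      have "r \<in> cspan (insert b E)" unfolding r_def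
        by (intro complex_vector.span_diff sE complex_vector.span_base) auto
      then show "insert u E \<subseteq> cspan (insert b E)"
        by (auto simp: u_def complex_vector.span_base intro: complex_vector.span_scale)
      have "r \<in> cspan (insert u E)"
        by (subst r) (intro complex_vector.span_scale complex_vector.span_base, auto)
      then have "b \<in> cspan (insert u E)"
        using complex_vector.span_add[OF _ sE, of r u] by (simp add: r_def)
      then show "insert b E \<subseteq> cspan (insert u E)" by (auto simp: complex_vector.span_base)
    qed auto
    also have "\<dots> = cspan (insert b B)"
      using E(3) complex_vector.span_insert[of b E] complex_vector.span_insert[of b B] by simp
    finally show ?thesis
      using E orthonormal_insert_normalized[OF E(2) False rE] by (auto simp: u_def)
  qed
qed

lemma orthonormal_basis_exists:
  assumes "csubspace M" "finite_cdim M"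
  obtains E where "finite E" "orthonormal E" "cspan E = M" "card E = cdim M"
proof -
  obtain B0 where B0: "finite B0" "M \<subseteq> cspan B0" using assms(2) by (auto simp: finite_cdim_def)
  obtain B where B: "B \<subseteq> M" "complex_vector.independent B" "M \<subseteq> cspan B"
    by (rule complex_vector.basis_exists[of M])
  have "finite B" using complex_vector.independent_span_bound[OF B0(1) B(2)] order_trans[OF B(1) B0(2)] by blast
  then obtain E where E: "finite E" "orthonormal E" "cspan E = cspan B" using gram_schmidt by blast
  have "cspan B = M" using complex_vector.span_minimal[OF B(1) assms(1)] B(3) by blast
  then show ?thesis using that[OF E(1,2)] E(3) cdim_cspan_orthonormal[OF E(1,2)] by simp
qed

lemma finite_cdim_subset: "finite_cdim N \<Longrightarrow> M \<subseteq> N \<Longrightarrow> finite_cdim M"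
  by (auto simp: finite_cdim_def)

lemma finite_cdim_cspan: "finite B \<Longrightarrow> finite_cdim (cspan B)"
  by (auto simp: finite_cdim_def)

lemma closed_cspan_orthonormal:
  assumes "finite E" "orthonormal E"
  shows "closed (cspan E)"
proof -
  have "cspan E = {x. x - (\<Sum>e\<in>E. cinner x e *\<^sub>C e) = 0}"
  proof (intro set_eqI iffI CollectI)
    fix x assume "x \<in> {x. x - (\<Sum>e\<in>E. cinner x e *\<^sub>C e) = 0}"
    then have "x = (\<Sum>e\<in>E. cinner x e *\<^sub>C e)" by simp
    moreover have "(\<Sum>e\<in>E. cinner x e *\<^sub>C e) \<in> cspan E"
      by (intro complex_vector.span_sum complex_vector.span_scale complex_vector.span_base)
    ultimately show "x \<in> cspan E" by metis
  qed (use orthonormal_expansion[OF assms] in simp)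
  moreover have "closed {x. x - (\<Sum>e\<in>E. cinner x e *\<^sub>C e) = 0}"
  proof (rule closed_Collect_eq)
    have "bounded_linear (\<lambda>x. cinner x e *\<^sub>C e)" for e
    proof (rule bounded_linear_intro)
      show "norm (cinner x e *\<^sub>C e) \<le> norm x * (norm e * norm e)" for x
        using mult_right_mono[OF cinner_bound[of x e], of "norm e"] by (simp add: norm_scaleC mult.assoc)
    qed (simp_all add: cinner_simps scaleC_add_left scaleC_scaleR scaleC_scaleC)
    then show "continuous_on UNIV (\<lambda>x. x - (\<Sum>e\<in>E. cinner x e *\<^sub>C e))"
      by (intro continuous_intros linear_continuous_on)
  qed auto
  ultimately show ?thesis by simp
qed

lemma closed_finite_cdim:
  assumes "csubspace M" "finite_cdim M" shows "closed M"
proof -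
  obtain E where "finite E" "orthonormal E" "cspan E = M" using orthonormal_basis_exists[OF assms] .
  then show ?thesis using closed_cspan_orthonormal by blast
qed

text \<open>The ambient space may be infinite-dimensional, so compactness is built up by induction:
  each further vector contributes the continuous image of a closed disc, and a sum of two compact
  sets is compact.\<close>

lemma compact_bounded_combinations:
  "finite E \<Longrightarrow> compact {\<Sum>e\<in>E. c e *\<^sub>C (e :: 'a :: complex_inner) |c. \<forall>e\<in>E. cmod (c e) \<le> 1}"
proof (induction rule: finite_induct)
  case (insert a E)
  define K where "K = {\<Sum>e\<in>E. c e *\<^sub>C e |c. \<forall>e\<in>E. cmod (c e) \<le> 1}"
  have "bounded_linear (\<lambda>c. c *\<^sub>C a)"
    by (rule bounded_linear_intro[of _ "norm a"])
      (simp_all add: scaleC_add_left norm_scaleC scaleC_scaleR scaleC_scaleC scaleR_conv_of_real)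
  then have "compact ((\<lambda>c. c *\<^sub>C a) ` cball 0 1)"
    by (intro compact_continuous_image linear_continuous_on) auto
  from compact_sums[OF this insert.IH[folded K_def]]
  have "compact {x + y |x y. x \<in> (\<lambda>c. c *\<^sub>C a) ` cball 0 1 \<and> y \<in> K}" .
  also have "{x + y |x y. x \<in> (\<lambda>c. c *\<^sub>C a) ` cball 0 1 \<and> y \<in> K} =
      {\<Sum>e\<in>insert a E. c e *\<^sub>C e |c. \<forall>e\<in>insert a E. cmod (c e) \<le> 1}" (is "?L = ?R")
  proof
    show "?L \<subseteq> ?R"
    proof
      fix z assume "z \<in> ?L"
      then obtain b c where z: "z = b *\<^sub>C a + (\<Sum>e\<in>E. c e *\<^sub>C e)" "cmod b \<le> 1" "\<forall>e\<in>E. cmod (c e) \<le> 1"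
        by (auto simp: K_def)
      have "(\<Sum>e\<in>E. (c(a := b)) e *\<^sub>C e) = (\<Sum>e\<in>E. c e *\<^sub>C e)"
        using insert.hyps by (intro sum.cong) auto
      then have "z = (\<Sum>e\<in>insert a E. (c(a := b)) e *\<^sub>C e)"
        using insert.hyps by (simp add: z)
      then show "z \<in> ?R" using z(2,3) by (auto intro!: exI[of _ "c(a := b)"])
    qed
    show "?R \<subseteq> ?L"
    proof safe
      fix c assume c: "\<forall>e\<in>insert a E. cmod (c e) \<le> 1"
      have "c a *\<^sub>C a \<in> (\<lambda>c. c *\<^sub>C a) ` cball 0 1" "(\<Sum>e\<in>E. c e *\<^sub>C e) \<in> K"
        using c by (auto simp: K_def)
      then show "\<exists>x y. (\<Sum>e\<in>insert a E. c e *\<^sub>C e) = x + y \<and> x \<in> (\<lambda>c. c *\<^sub>C a) ` cball 0 1 \<and> y \<in> K"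
        using insert.hyps by auto
    qed
  qed
  finally show ?case .
qed simp

lemma compact_unit_sphere:
  fixes M :: "'a :: complex_inner set"
  assumes "csubspace M" "finite_cdim M"
  shows "compact {x \<in> M. norm x = 1}"
proof -
  obtain E where E: "finite E" "orthonormal E" "cspan E = M" using orthonormal_basis_exists[OF assms] .
  define K where "K = {\<Sum>e\<in>E. c e *\<^sub>C e |c. \<forall>e\<in>E. cmod (c e) \<le> 1}"
  have "{x \<in> M. norm x = 1} \<subseteq> K"
  proof safe
    fix x assume x: "x \<in> M" "norm x = 1"
    have "cmod (cinner x e) \<le> 1" if "e \<in> E" for e
    proof -
      have "(norm e)\<^sup>2 = 1" using E(2) that cinner_self[of e]
        by (simp add: orthonormal_def of_real_eq_1_iff[symmetric] del: of_real_power)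
      then have "norm e = 1" using norm_ge_zero[of e] by (auto simp only: power2_eq_1_iff)
      then show ?thesis using cinner_bound[of x e] x by simp
    qed
    then show "x \<in> K" unfolding K_def using orthonormal_expansion[OF E(1,2)] E(3) x(1)
      by (auto intro!: exI[of _ "cinner x"])
  qed
  then have "{x \<in> M. norm x = 1} = K \<inter> (M \<inter> {x. norm x = 1})" by auto
  moreover have "closed (M \<inter> {x. norm x = 1})"
    by (intro closed_Int closed_finite_cdim assms closed_Collect_eq) (auto intro!: continuous_intros)
  ultimately show ?thesis
    using compact_bounded_combinations[OF E(1)] by (simp add: K_def compact_Int_closed)
qed

lemma exists_unit_vector:
  assumes "csubspace M" "M \<noteq> {0}"
  obtains u where "u \<in> M" "norm u = 1"
proof -
  obtain x where "x \<in> M" "x \<noteq> 0" using assms csubspace_0 by blast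
  then show ?thesis using that[of "inverse (norm x) *\<^sub>R x"] assms by (auto intro: csubspaceD)
qed

section \<open>Words and the algebras generated by a tuple\<close>

definition words :: "nat \<Rightarrow> 'n list set" where
  "words m = {w. length w = m}"

lemma finite_words [simp]: "finite (words m :: 'n :: finite list set)"
  using finite_lists_length_eq[of "UNIV :: 'n set" m] by (simp add: words_def)

lemma words_0 [simp]: "words 0 = {[]}"
  by (auto simp: words_def)

lemma words_Suc: "words (Suc m) = (\<lambda>(i, w). i # w) ` (UNIV \<times> words m)"
  by (auto simp: words_def length_Suc_conv image_iff)

lemma sum_words_Suc:
  "(\<Sum>w\<in>words (Suc m). f w) = (\<Sum>i\<in>UNIV. \<Sum>w\<in>words m. f (i # w :: 'n :: finite list))"
proof -
  have "(\<Sum>w\<in>words (Suc m). f w) = (\<Sum>p\<in>UNIV \<times> words m. f (fst p # snd p))"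
    unfolding words_Suc by (subst sum.reindex) (auto simp: inj_on_def case_prod_beta)
  then show ?thesis by (simp add: sum.cartesian_product case_prod_beta)
qed

lemma word_op_Nil: "word_op T [] = id"
  by (simp add: word_op_def)

lemma word_op_Cons: "word_op T (i # w) = T i \<circ> word_op T w"
  by (simp add: word_op_def)

lemma word_op_simps: "word_op T [] x = x" "word_op T (i # w) x = T i (word_op T w x)"
  by (simp_all add: word_op_def)

lemma bounded_clinear_word_op:
  "(\<And>i. bounded_clinear (T i)) \<Longrightarrow> bounded_clinear (word_op T w)"
  by (induction w) (simp_all only: word_op_Nil word_op_Cons bounded_clinear_ident bounded_clinear_comp)

lemma cadjoint_word_op_Nil [simp]: "cadjoint (word_op T []) x = (x :: 'a :: chilbert_space)"
  by (simp only: word_op_Nil cadjoint_id id_apply)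

text \<open>On the adjoint side the first letter acts first. This is why inductions over words below
  generalize the vector, and why sums over words are split at the first letter.\<close>

lemma cadjoint_word_op_Cons:
  fixes T :: "'n \<Rightarrow> 'a :: chilbert_space \<Rightarrow> 'a"
  assumes "\<And>i. bounded_clinear (T i)"
  shows "cadjoint (word_op T (i # w)) x = cadjoint (word_op T w) (cadjoint (T i) x)"
  using cadjoint_comp[OF assms[of i] bounded_clinear_word_op[of T w, OF assms]]
  by (simp only: word_op_Cons comp_apply)

lemma unital_algebra_invariant:
  assumes "T \<in> unital_algebra (range A)" "csubspace N" "\<And>i x. x \<in> N \<Longrightarrow> A i x \<in> N" "x \<in> N"
  shows "T x \<in> N"
  using assms(1,4)
proof (induction arbitrary: x)
  case (gen T) then show ?case using assms(3) by auto
qed (auto simp: csubspaceD[OF assms(2)])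

lemma bounded_clinear_unital_algebra:
  assumes "T \<in> unital_algebra G" "\<And>T. T \<in> G \<Longrightarrow> bounded_clinear T"
  shows "bounded_clinear T"
  using assms by induction auto

lemma csubspace_orbit: "csubspace {T v |T. T \<in> unital_algebra G}"
proof (rule csubspaceI)
  have "(\<lambda>x. 0 *\<^sub>C id x) \<in> unital_algebra G" by (intro unital_algebra.intros)
  then show "0 \<in> {T v |T. T \<in> unital_algebra G}" by force
  show "x + y \<in> {T v |T. T \<in> unital_algebra G}"
    if xy: "x \<in> {T v |T. T \<in> unital_algebra G}" "y \<in> {T v |T. T \<in> unital_algebra G}" for x y
  proof -
    obtain T R where "T \<in> unital_algebra G" "x = T v" "R \<in> unital_algebra G" "y = R v"
      using xy by blast
    then show ?thesis by (intro CollectI exI[of _ "\<lambda>x. T x + R x"]) (simp add: unital_algebra.add)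
  qed
  show "c *\<^sub>C x \<in> {T v |T. T \<in> unital_algebra G}"
    if x: "x \<in> {T v |T. T \<in> unital_algebra G}" for c x
  proof -
    obtain T where "T \<in> unital_algebra G" "x = T v" using x by blast
    then show ?thesis by (intro CollectI exI[of _ "\<lambda>x. c *\<^sub>C T x"]) (simp add: unital_algebra.scale)
  qed
qed

text \<open>Cyclicity as a minimality property of subspaces. In this form it can be confronted with
  orthogonal complements, which exchange invariance under the \<open>A i\<close> and invariance
  under their adjoints.\<close>

lemma cyclic_vector_iff:
  fixes A :: "'n \<Rightarrow> 'v :: complex_inner \<Rightarrow> 'v"
  assumes A: "\<And>i. bounded_clinear (A i)"
  shows "cyclic_vector (unital_algebra (range A)) v \<longleftrightarrow>
    (\<forall>N. csubspace N \<and> v \<in> N \<and> (\<forall>i. \<forall>x\<in>N. A i x \<in> N) \<longrightarrow> N = UNIV)" (is "_ \<longleftrightarrow> ?R")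
proof
  assume c: "cyclic_vector (unital_algebra (range A)) v"
  show ?R
  proof (intro allI impI set_eqI)
    fix N x assume N: "csubspace N \<and> v \<in> N \<and> (\<forall>i. \<forall>x\<in>N. A i x \<in> N)"
    obtain T where "T \<in> unital_algebra (range A)" "x = T v"
      using c unfolding cyclic_vector_def by blast
    then show "x \<in> N \<longleftrightarrow> x \<in> UNIV" using N unital_algebra_invariant[of T A N v] by blast
  qed
next
  assume R: ?R
  let ?N = "{T v |T. T \<in> unital_algebra (range A)}"
  have "csubspace ?N" by (rule csubspace_orbit)
  moreover have "v \<in> ?N" using unital_algebra.one[of "range A"] by (auto intro!: exI[of _ id])
  moreover have "A i x \<in> ?N" if x: "x \<in> ?N" for i x
  proof -
    obtain T where T: "T \<in> unital_algebra (range A)" "x = T v" using x by blast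
    have "A i \<circ> T \<in> unital_algebra (range A)" using unital_algebra.mult[OF unital_algebra.gen T(1)] by blast
    then show ?thesis using T(2) by (metis (mono_tags, lifting) comp_apply mem_Collect_eq)
  qed
  ultimately show "cyclic_vector (unital_algebra (range A)) v"
    using R unfolding cyclic_vector_def by blast
qed

lemma cyclic_subspace_iff:
  fixes A :: "'n \<Rightarrow> 'v :: complex_inner \<Rightarrow> 'v"
  assumes A: "\<And>i. bounded_clinear (A i)"
  shows "cyclic_subspace (unital_algebra (range A)) M \<longleftrightarrow>
    (\<forall>N. csubspace N \<and> M \<subseteq> N \<and> (\<forall>i. \<forall>x\<in>N. A i x \<in> N) \<longrightarrow> N = UNIV)" (is "_ \<longleftrightarrow> ?R")
proof
  let ?X = "{T x |T x. T \<in> unital_algebra (range A) \<and> x \<in> M}"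
  {
    assume c: "cyclic_subspace (unital_algebra (range A)) M"
    show ?R
    proof (intro allI impI)
      fix N assume N: "csubspace N \<and> M \<subseteq> N \<and> (\<forall>i. \<forall>x\<in>N. A i x \<in> N)"
      have "T x \<in> N" if "T \<in> unital_algebra (range A)" "x \<in> M" for T x
        using N that unital_algebra_invariant[of T A N x] by blast
      then have "?X \<subseteq> N" by blast
      then have "cspan ?X \<subseteq> N" using N complex_vector.span_minimal by blast
      then show "N = UNIV" using c unfolding cyclic_subspace_def by blast
    qed
  next
    assume R: ?R
    have "M \<subseteq> ?X" using unital_algebra.one[of "range A"] by (auto intro!: exI[of _ id])
    then have "M \<subseteq> cspan ?X" using complex_vector.span_superset by blast
    moreover have "A i x \<in> cspan ?X" if "x \<in> cspan ?X" for i x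
    proof -
      have "?X \<subseteq> {x. A i x \<in> cspan ?X}"
      proof safe
        fix T y assume T: "T \<in> unital_algebra (range A)" "y \<in> M"
        have "A i \<circ> T \<in> unital_algebra (range A)" using unital_algebra.mult[OF unital_algebra.gen T(1)] by blast
        then have "(A i \<circ> T) y \<in> cspan ?X" using T(2) by (intro complex_vector.span_base) blast
        then show "A i (T y) \<in> cspan ?X" by simp
      qed
      then have "cspan ?X \<subseteq> {x. A i x \<in> cspan ?X}"
        by (rule complex_vector.span_minimal) (simp add: csubspace_vimage A)
      then show ?thesis using that by blast
    qed
    ultimately show "cyclic_subspace (unital_algebra (range A)) M"
      using R unfolding cyclic_subspace_def by (meson complex_vector.subspace_span)
  }
qed

lemma invariant_cadjoint_iff:
  fixes A :: "'n \<Rightarrow> 'v :: chilbert_space \<Rightarrow> 'v"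
  assumes A: "\<And>i. bounded_clinear (A i)" and N: "csubspace N"
  shows "invariant (cadjoint ` unital_algebra (range A)) N \<longleftrightarrow> (\<forall>i. \<forall>x\<in>N. cadjoint (A i) x \<in> N)"
proof
  assume "invariant (cadjoint ` unital_algebra (range A)) N"
  then show "\<forall>i. \<forall>x\<in>N. cadjoint (A i) x \<in> N"
    using unital_algebra.gen[of _ "range A"] unfolding invariant_def by blast
next
  assume R: "\<forall>i. \<forall>x\<in>N. cadjoint (A i) x \<in> N"
  have "bounded_clinear T \<and> (\<forall>x\<in>N. cadjoint T x \<in> N)" if "T \<in> unital_algebra (range A)" for T
    using that
  proof induction
    case (gen T) then show ?case using A R by auto
  next
    case one show ?case by (metis cadjoint_id id_apply bounded_clinear_ident(2))
  next
    case (add T R) then show ?case by (auto simp: cadjoint_plus csubspaceD[OF N])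
  next
    case (scale T c) then show ?case by (auto simp: cadjoint_scaleC csubspaceD[OF N])
  next
    case (mult T R) then show ?case by (metis cadjoint_comp bounded_clinear_comp comp_apply)
  qed
  then show "invariant (cadjoint ` unital_algebra (range A)) N"
    by (auto simp: invariant_def)
qed

lemma minimal_invariant_cadjoint_iff:
  fixes A :: "'n \<Rightarrow> 'v :: chilbert_space \<Rightarrow> 'v"
  assumes A: "\<And>i. bounded_clinear (A i)"
  shows "minimal_invariant (cadjoint ` unital_algebra (range A)) M \<longleftrightarrow>
     csubspace M \<and> M \<noteq> {0} \<and> (\<forall>i. \<forall>x\<in>M. cadjoint (A i) x \<in> M) \<and>
     (\<forall>N. csubspace N \<and> N \<noteq> {0} \<and> (\<forall>i. \<forall>x\<in>N. cadjoint (A i) x \<in> N) \<and> N \<subseteq> M \<longrightarrow> N = M)"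
  unfolding minimal_invariant_def by (meson invariant_cadjoint_iff[of A, OF A])

lemma cdim_strict_mono:
  assumes "finite_cdim M" "csubspace N" "csubspace M" "N \<subseteq> M" "N \<noteq> M"
  shows "cdim N < cdim M"
proof -
  obtain E where E: "finite E" "orthonormal E" "cspan E = N" "card E = cdim N"
    using orthonormal_basis_exists[OF assms(2) finite_cdim_subset[OF assms(1,4)]] .
  obtain F where F: "finite F" "orthonormal F" "cspan F = M" "card F = cdim M"
    using orthonormal_basis_exists[OF assms(3,1)] .
  obtain x where x: "x \<in> M" "x \<notin> N" using assms by blast
  have "complex_vector.independent (insert x E)"
    using orthonormal_independent[OF E(1,2)] x E(3) by (simp add: complex_vector.independent_insertI)
  moreover have "insert x E \<subseteq> cspan F" using x F(3) E(3) assms(4) complex_vector.span_base by blast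
  ultimately have "card (insert x E) \<le> card F"
    using complex_vector.independent_span_bound[OF F(1)] by blast
  moreover have "x \<notin> E" using x E(3) complex_vector.span_base by blast
  ultimately show ?thesis using E F by simp
qed

text \<open>Among the nonzero subspaces invariant under the adjoints, one of least dimension is
  minimal, because dimension is strictly monotone.\<close>

lemma minimal_invariant_exists:
  fixes A :: "'n \<Rightarrow> 'v :: chilbert_space \<Rightarrow> 'v"
  assumes A: "\<And>i. bounded_clinear (A i)"
    and fin: "finite_cdim (UNIV :: 'v set)" and nz: "(UNIV :: 'v set) \<noteq> {0}"
  shows "\<exists>M. minimal_invariant (cadjoint ` unital_algebra (range A)) M"
proof -
  define P where "P N \<longleftrightarrow> csubspace N \<and> N \<noteq> {0} \<and> (\<forall>i. \<forall>x\<in>N. cadjoint (A i) x \<in> N)" for N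
  have "P UNIV" using nz by (simp add: P_def)
  from ex_has_least_nat[of P UNIV cdim, OF this]
  obtain M where M: "P M" "\<And>N. P N \<Longrightarrow> cdim M \<le> cdim N" by auto
  have "N = M" if N: "P N" "N \<subseteq> M" for N
  proof (rule ccontr)
    assume "N \<noteq> M"
    then have "cdim N < cdim M"
      using cdim_strict_mono[of M N] M(1) N finite_cdim_subset[OF fin, of M] by (simp add: P_def)
    then show False using M(2)[OF N(1)] by simp
  qed
  then have "minimal_invariant (cadjoint ` unital_algebra (range A)) M"
    unfolding minimal_invariant_cadjoint_iff[of A, OF A] using M(1) by (simp add: P_def)
  then show ?thesis ..
qed

section \<open>Quadratic forms of hermitian operators\<close>

definition hermitian :: "('a :: complex_inner \<Rightarrow> 'a) \<Rightarrow> bool" where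
  "hermitian T \<longleftrightarrow> (\<forall>x y. cinner (T x) y = cinner x (T y))"

lemma hermitianD: "hermitian T \<Longrightarrow> cinner (T x) y = cinner x (T y)"
  by (simp add: hermitian_def)

lemma Re_cinner_self: "Re (cinner x x) = (norm x)\<^sup>2"
  by (simp add: cinner_self)

text \<open>For 0 \<le> T \<le> I this says that the square of T is at most T. No square root is
  used: positivity is tested at \<open>x - T x\<close> and the upper bound at \<open>T x\<close>.
  The inequality turns statements about quadratic forms into statements about norms.\<close>

lemma norm_le_form:
  assumes T: "bounded_clinear T" "hermitian T"
    and pos: "\<And>x. 0 \<le> Re (cinner (T x) x)" and le: "\<And>x. Re (cinner (T x) x) \<le> (norm x)\<^sup>2"
  shows "(norm (T x))\<^sup>2 \<le> Re (cinner (T x) x)"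
proof -
  have "cinner (T (T x)) x = cinner (T x) (T x)" by (rule hermitianD[OF T(2)])
  then have "Re (cinner (T (x - T x)) (x - T x)) =
      Re (cinner (T x) x) - 2 * (norm (T x))\<^sup>2 + Re (cinner (T (T x)) (T x))"
    by (simp add: bounded_clinear_diff[OF T(1)] cinner_simps Re_cinner_self)
  then show ?thesis using pos[of "x - T x"] le[of "T x"] by linarith
qed

text \<open>First-order condition: a quadratic polynomial in t that vanishes at 0 and is nonnegative
  has no linear term.\<close>

lemma form_zero_imp:
  fixes b c :: real
  assumes "\<And>t. 0 \<le> 2 * t * b + t\<^sup>2 * c" shows "b = 0"
proof -
  have c: "c \<ge> 0" using assms[of 1] assms[of "-1"] by simp
  \<comment> \<open>The minimizer would be - b / c; the shift by 1 also covers c = 0.\<close>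
  define t where "t = - b / (c + 1)"
  have b: "b = - (t * (c + 1))" using c by (simp add: t_def)
  have "0 \<le> - (t\<^sup>2 * (c + 2))"
    using assms[of t] by (simp add: b power2_eq_square algebra_simps)
  then have "t\<^sup>2 * (c + 2) \<le> 0" by simp
  then have "t = 0" using c by (simp add: mult_le_0_iff)
  then show ?thesis using b by simp
qed

text \<open>At a maximizer x of the form, perturbing x inside M by a real multiple of y leaves no
  linear term. Doing this for y and for its multiple by the imaginary unit yields both parts of the
  eigenvector equation, tested against M only.\<close>

lemma extremal_form:
  assumes M: "csubspace M" and T: "bounded_clinear T" "hermitian T"
    and max: "\<And>x. x \<in> M \<Longrightarrow> Re (cinner (T x) x) \<le> l * (norm x)\<^sup>2"
    and x: "x \<in> M" "Re (cinner (T x) x) = l * (norm x)\<^sup>2" and y: "y \<in> M"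
  shows "cinner (T x) y = of_real l * cinner x y"
proof -
  have re: "Re (cinner (T x) y - of_real l * cinner x y) = 0" if y: "y \<in> M" for y
  proof (rule form_zero_imp)
    fix t :: real
    have "x - of_real t *\<^sub>C y \<in> M" using x y by (intro csubspaceD[OF M])
    from max[OF this] have "Re (cinner (T (x - of_real t *\<^sub>C y)) (x - of_real t *\<^sub>C y))
        \<le> l * (norm (x - of_real t *\<^sub>C y))\<^sup>2" .
    moreover have "Re (cinner (T (x - of_real t *\<^sub>C y)) (x - of_real t *\<^sub>C y)) =
        Re (cinner (T x) x) - 2 * t * Re (cinner (T x) y) + t\<^sup>2 * Re (cinner (T y) y)"
      using cinner_commute[of y "T x"]
      by (simp add: bounded_clinearD[OF T(1)] cinner_simps hermitianD[OF T(2)] power2_eq_square algebra_simps)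
    moreover have "(norm (x - of_real t *\<^sub>C y))\<^sup>2 = (norm x)\<^sup>2 - 2 * t * Re (cinner x y) + t\<^sup>2 * (norm y)\<^sup>2"
      unfolding Re_cinner_self[symmetric] using cinner_commute[of y x]
      by (simp add: cinner_simps power2_eq_square algebra_simps)
    ultimately show "0 \<le> 2 * t * Re (cinner (T x) y - of_real l * cinner x y) +
        t\<^sup>2 * (l * (norm y)\<^sup>2 - Re (cinner (T y) y))"
      using x(2) by (simp add: algebra_simps)
  qed
  show ?thesis
    using re[OF y] re[OF csubspace_scale[OF M y, of \<i>]]
    by (simp add: complex_eq_iff cinner_simps)
qed

section \<open>The completely positive map of a row contraction\<close>

locale row_contraction =
  fixes A :: "'n :: finite \<Rightarrow> 'v :: chilbert_space \<Rightarrow> 'v"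
  assumes contr: "contractive A"
begin

abbreviation Ad :: "'n \<Rightarrow> 'v \<Rightarrow> 'v" where "Ad i \<equiv> cadjoint (A i)"

abbreviation AWd :: "'n list \<Rightarrow> 'v \<Rightarrow> 'v" where "AWd w \<equiv> cadjoint (word_op A w)"

abbreviation algA :: "('v \<Rightarrow> 'v) set" where "algA \<equiv> unital_algebra (range A)"

lemma bounded_clinear_A: "bounded_clinear (A i)"
  using contr by (simp add: contractive_def)

lemma bounded_clinear_Ad: "bounded_clinear (Ad i)"
  by (rule bounded_clinear_cadjoint[OF bounded_clinear_A])

lemma cinner_A: "cinner (A i x) y = cinner x (Ad i y)"
  by (rule cinner_cadjoint[OF bounded_clinear_A])

lemma cinner_cp_map:
  "cinner (cp_map A X x) y = (\<Sum>i\<in>UNIV. cinner (X (Ad i x)) (Ad i y))"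
  by (simp add: cp_map_def cinner.sum_left cinner_A)

lemma cinner_cp_map_funpow:
  "cinner ((cp_map A ^^ k) X x) y =
    (\<Sum>w\<in>words k. cinner (X (AWd w x)) (AWd w y))"
proof (induction k arbitrary: x y)
  case (Suc k)
  show ?case
    by (simp add: cinner_cp_map Suc sum_words_Suc cadjoint_word_op_Cons[of A, OF bounded_clinear_A])
qed simp

lemma bounded_clinear_cp_map: "bounded_clinear X \<Longrightarrow> bounded_clinear (cp_map A X)"
  unfolding cp_map_def
  by (intro bounded_clinear_setsum bounded_clinear_compose[OF bounded_clinear_A]
      bounded_clinear_compose[OF _ bounded_clinear_Ad])

lemma bounded_clinear_cp_map_funpow: "bounded_clinear X \<Longrightarrow> bounded_clinear ((cp_map A ^^ k) X)"
  by (induction k) (simp_all add: bounded_clinear_cp_map)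

lemma hermitian_cp_map: "hermitian X \<Longrightarrow> hermitian (cp_map A X)"
  unfolding hermitian_def
proof (intro allI)
  fix x y assume X: "\<forall>x y. cinner (X x) y = cinner x (X y)"
  have "cinner x (cp_map A X y) = (\<Sum>i\<in>UNIV. cinner (Ad i x) (X (Ad i y)))"
    by (subst cinner_commute) (simp add: cinner_cp_map cinner_commute[of _ "cadjoint _ x"])
  then show "cinner (cp_map A X x) y = cinner x (cp_map A X y)"
    by (simp add: cinner_cp_map X)
qed

lemma Re_cinner_defect:
  "Re (cinner (x - (\<Sum>i\<in>UNIV. A i (Ad i x))) x) =
    (norm x)\<^sup>2 - (\<Sum>i\<in>UNIV. (norm (Ad i x))\<^sup>2)"
  by (simp add: cinner_simps cinner.sum_left cinner_A Re_cinner_self)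

lemma sum_norm_Ad_le: "(\<Sum>i\<in>UNIV. (norm (Ad i x))\<^sup>2) \<le> (norm x)\<^sup>2"
proof -
  have "cinner (x - (\<Sum>i\<in>UNIV. A i (Ad i x))) x \<in> \<real>\<^sub>\<ge>\<^sub>0"
    using contr by (simp add: contractive_def op_le_def)
  then have "0 \<le> Re (cinner (x - (\<Sum>i\<in>UNIV. A i (Ad i x))) x)"
    by (simp add: complex_nonneg_Reals_iff)
  then show ?thesis unfolding Re_cinner_defect by simp
qed

text \<open>Monotone convergence of operators. Positivity of \<open>cp_map A\<close> propagates the
  first decrease to all iterates, so the forms converge. The last conclusion survives the limit and
  shows that Z annihilates every vector at which its form vanishes.\<close>

lemma cp_map_funpow_limit:
  assumes Y: "bounded_clinear Y" "hermitian Y"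
    and pos: "\<And>x. 0 \<le> Re (cinner (Y x) x)" and le: "\<And>x. Re (cinner (Y x) x) \<le> (norm x)\<^sup>2"
    and decr: "\<And>x. Re (cinner (cp_map A Y x) x) \<le> Re (cinner (Y x) x)"
  obtains Z where "bounded_clinear Z" "hermitian Z" "\<And>x. (\<lambda>k. (cp_map A ^^ k) Y x) \<longlonglongrightarrow> Z x"
    "cp_map A Z = Z" "\<And>x. (norm (Z x))\<^sup>2 \<le> Re (cinner (Z x) x)"
proof -
  define F where "F k = (cp_map A ^^ k) Y" for k
  have bF: "bounded_clinear (F k)" for k unfolding F_def by (rule bounded_clinear_cp_map_funpow[OF Y(1)])
  have hF: "hermitian (F k)" for k
    unfolding F_def by (induction k) (simp_all add: Y hermitian_cp_map)
  have FS: "F (Suc k) = cp_map A (F k)" for k by (simp add: F_def)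
  have F0: "F 0 = Y" by (simp add: F_def)
  have FSx: "Re (cinner (F (Suc k) x) x) =
      (\<Sum>i\<in>UNIV. Re (cinner (F k (Ad i x)) (Ad i x)))" for k x
    by (simp add: FS cinner_cp_map)
  have posF: "0 \<le> Re (cinner (F k x) x)" for k x
    by (induction k arbitrary: x) (simp_all add: F0 pos FSx sum_nonneg)
  have decF: "Re (cinner (F (Suc k) x) x) \<le> Re (cinner (F k x) x)" for k x
  proof (induction k arbitrary: x)
    case 0 then show ?case using decr by (simp add: FS F0)
  next
    case (Suc k)
    have "Re (cinner (F (Suc (Suc k)) x) x) =
        (\<Sum>i\<in>UNIV. Re (cinner (F (Suc k) (Ad i x)) (Ad i x)))" by (rule FSx)
    also have "\<dots> \<le> (\<Sum>i\<in>UNIV. Re (cinner (F k (Ad i x)) (Ad i x)))"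
      by (intro sum_mono Suc)
    also have "\<dots> = Re (cinner (F (Suc k) x) x)" by (rule FSx[symmetric])
    finally show ?case .
  qed
  have anti: "Re (cinner (F m x) x) \<le> Re (cinner (F k x) x)" if "k \<le> m" for k m x
    using that by (induction rule: dec_induct) (auto intro: order_trans[OF decF])
  have leF: "Re (cinner (F k x) x) \<le> (norm x)\<^sup>2" for k x
    using anti[of 0 k x] le[of x] by (simp add: F0)
  have nF: "(norm (F k x))\<^sup>2 \<le> Re (cinner (F k x) x)" for k x
    by (rule norm_le_form[OF bF hF posF leF])
  \<comment> \<open>The difference of two iterates lies between 0 and I, so
    \<open>norm_le_form\<close> bounds its norm by a difference of convergent forms. This upgrades
    convergence of forms to strong convergence.\<close>
  have diff: "(norm (F k x - F m x))\<^sup>2 \<le> Re (cinner (F k x) x) - Re (cinner (F m x) x)"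
    if km: "k \<le> m" for k m x
  proof -
    have "(norm ((\<lambda>x. F k x - F m x) x))\<^sup>2 \<le> Re (cinner ((\<lambda>x. F k x - F m x) x) x)"
    proof (rule norm_le_form)
      show "hermitian (\<lambda>x. F k x - F m x)"
        using hF[of k] hF[of m] by (simp add: hermitian_def cinner_simps)
      show "0 \<le> Re (cinner (F k x - F m x) x)" for x
        using anti[OF km, of x] by (simp add: cinner_simps)
      show "Re (cinner (F k x - F m x) x) \<le> (norm x)\<^sup>2" for x
        using leF[of k x] posF[of m x] by (simp add: cinner_simps)
    qed (intro bounded_clinear_minus_op bF)
    then show ?thesis by (simp add: cinner_simps)
  qed
  have "Cauchy (\<lambda>k. F k x)" for x
  proof -
    have "decseq (\<lambda>k. Re (cinner (F k x) x))" by (simp add: decseq_def anti)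
    then have "convergent (\<lambda>k. Re (cinner (F k x) x))"
      using decseq_convergent[of "\<lambda>k. Re (cinner (F k x) x)" 0] posF unfolding convergent_def by metis
    then have C: "Cauchy (\<lambda>k. Re (cinner (F k x) x))" by (rule convergent_Cauchy)
    show ?thesis
    proof (rule metric_CauchyI)
      fix e :: real assume e: "e > 0"
      obtain N where N: "\<And>k m. k \<ge> N \<Longrightarrow> m \<ge> N \<Longrightarrow>
          dist (Re (cinner (F k x) x)) (Re (cinner (F m x) x)) < e\<^sup>2"
        using metric_CauchyD[OF C, of "e\<^sup>2"] e by auto
      have *: "dist (F k x) (F m x) < e" if "k \<ge> N" "m \<ge> N" "k \<le> m" for k m
      proof -
        have "(dist (F k x) (F m x))\<^sup>2 < e\<^sup>2"
          using diff[OF that(3), of x] N[OF that(1,2)] by (simp add: dist_norm)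
        then show ?thesis using e by (simp add: power2_less_imp_less)
      qed
      have "dist (F k x) (F m x) < e" if "k \<ge> N" "m \<ge> N" for k m
        using *[of k m] *[of m k] that by (metis dist_commute nle_le)
      then show "\<exists>M. \<forall>m\<ge>M. \<forall>n\<ge>M. dist (F m x) (F n x) < e" by blast
    qed
  qed
  then have "\<exists>z. (\<lambda>k. F k x) \<longlonglongrightarrow> z" for x
    using Cauchy_convergent convergent_def by blast
  then obtain Z where Z: "\<And>x. (\<lambda>k. F k x) \<longlonglongrightarrow> Z x" by metis
  have bZ: "bounded_clinear Z"
  proof (rule bounded_clinearI)
    fix x y c
    show "Z (x + y) = Z x + Z y"
      using LIMSEQ_unique[OF Z[of "x + y"]] tendsto_add[OF Z[of x] Z[of y]]
      by (simp add: bounded_clinear_add[OF bF])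
    show "Z (c *\<^sub>C x) = c *\<^sub>C Z x"
      using LIMSEQ_unique[OF Z[of "c *\<^sub>C x"]]
        bounded_clinear_tendsto[OF bounded_clinear_cmul[OF bounded_clinear_ident(1)] Z[of x], of c]
      by (simp add: bounded_clinear_scaleC[OF bF])
    have "norm (F k x) \<le> norm x" for k
      by (rule power2_le_imp_le[OF order_trans[OF nF leF]]) simp
    then show "norm (Z x) \<le> norm x * 1"
      using LIMSEQ_le_const2[OF tendsto_norm[OF Z[of x]], of "norm x"] by auto
  qed
  have Zc: "(\<lambda>k. cinner (F k x) y) \<longlonglongrightarrow> cinner (Z x) y" for x y
    by (intro cinner.tendsto Z tendsto_const)
  have hZ: "hermitian Z"
    unfolding hermitian_def
  proof (intro allI)
    fix x y
    have "(\<lambda>k. cinner x (F k y)) \<longlonglongrightarrow> cinner x (Z y)" by (intro cinner.tendsto Z tendsto_const)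
    then have "(\<lambda>k. cinner (F k x) y) \<longlonglongrightarrow> cinner x (Z y)" by (simp add: hermitianD[OF hF])
    then show "cinner (Z x) y = cinner x (Z y)" by (rule LIMSEQ_unique[OF Zc])
  qed
  have fZ: "cp_map A Z = Z"
  proof
    fix x
    have "(\<lambda>k. cp_map A (F k) x) \<longlonglongrightarrow> cp_map A Z x"
      unfolding cp_map_def by (intro tendsto_sum bounded_clinear_tendsto[OF bounded_clinear_A] Z)
    moreover have "(\<lambda>k. cp_map A (F k) x) \<longlonglongrightarrow> Z x"
      using LIMSEQ_Suc[OF Z[of x]] by (simp only: FS)
    ultimately show "cp_map A Z x = Z x" by (rule LIMSEQ_unique)
  qed
  have "(norm (Z x))\<^sup>2 \<le> Re (cinner (Z x) x)" for x
    by (rule LIMSEQ_le[OF tendsto_power[OF tendsto_norm[OF Z]] tendsto_Re[OF Zc]]) (use nF in auto)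
  then show ?thesis using that[of Z] bZ hZ Z fZ by (simp add: F_def)
qed

text \<open>For x in the eigenspace, l |x|^2 is the sum of the forms at the \<open>Ad i x\<close>,
  which is at most l times the sum of their squared norms, and \<open>alt\<close> bounds that by l
  |x|^2. Hence equality holds for every i. The alternative in \<open>alt\<close> serves two
  situations: for a nonnegative form l is nonnegative and contractivity suffices, while in the
  unital case the sign of l is irrelevant.\<close>

lemma max_eigenspace:
  assumes M: "csubspace M" "finite_cdim M" "M \<noteq> {0}"
    and inv: "\<And>i x. x \<in> M \<Longrightarrow> Ad i x \<in> M"
    and X: "bounded_clinear X" "hermitian X" "cp_map A X = X"
    and alt: "(\<forall>x\<in>M. 0 \<le> Re (cinner (X x) x)) \<or>
      (\<forall>x. (\<Sum>i\<in>UNIV. (norm (Ad i x))\<^sup>2) = (norm x)\<^sup>2)"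
  obtains l E where "csubspace E" "E \<noteq> {0}" "E \<subseteq> M" "\<And>i x. x \<in> E \<Longrightarrow> Ad i x \<in> E"
    "\<And>x y. x \<in> E \<Longrightarrow> y \<in> M \<Longrightarrow> cinner (X x) y = of_real l * cinner x y"
    "\<And>x. x \<in> M \<Longrightarrow> Re (cinner (X x) x) \<le> l * (norm x)\<^sup>2"
    "\<And>x. x \<in> E \<Longrightarrow> l * (\<Sum>i\<in>UNIV. (norm (Ad i x))\<^sup>2) = l * (norm x)\<^sup>2"
proof -
  have "{x \<in> M. norm x = 1} \<noteq> {}" using exists_unit_vector[OF M(1,3)] by blast
  moreover have "continuous_on {x \<in> M. norm x = 1} (\<lambda>x. Re (cinner (X x) x))"
    by (intro continuous_intros cinner.continuous_on bounded_clinear_continuous_on[OF X(1)])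
  ultimately obtain u where u: "u \<in> M" "norm u = 1"
    "\<And>x. x \<in> M \<Longrightarrow> norm x = 1 \<Longrightarrow> Re (cinner (X x) x) \<le> Re (cinner (X u) u)"
    using continuous_attains_sup[OF compact_unit_sphere[OF M(1,2)]] by blast
  define l where "l = Re (cinner (X u) u)"
  have max: "Re (cinner (X x) x) \<le> l * (norm x)\<^sup>2" if x: "x \<in> M" for x
  proof (cases "x = 0")
    case False
    define y where "y = of_real (inverse (norm x)) *\<^sub>C x"
    have y: "y \<in> M" "norm y = 1" using x False
      by (auto simp: y_def norm_scaleC norm_inverse intro: csubspaceD[OF M(1)])
    have x': "x = of_real (norm x) *\<^sub>C y"
      using False by (simp add: y_def scaleC_scaleC)
    have "cinner (X x) x = of_real ((norm x)\<^sup>2) * cinner (X y) y"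
      by (subst (1 2) x') (simp add: bounded_clinear_scaleC[OF X(1)] cinner_simps power2_eq_square)
    then have "Re (cinner (X x) x) = (norm x)\<^sup>2 * Re (cinner (X y) y)"
      by (simp del: of_real_power)
    then show ?thesis using u(3)[OF y] mult_left_mono[of _ _ "(norm x)\<^sup>2"]
      by (simp add: l_def mult.commute)
  qed (simp add: bounded_clinear_zero[OF X(1)] cinner_simps)
  \<comment> \<open>X need not map M into itself, so this is the eigenspace of the compression of X
    to M.\<close>
  define E where "E = {x \<in> M. \<forall>y\<in>M. cinner (X x) y = of_real l * cinner x y}"
  have E_I: "x \<in> E" if "x \<in> M" "Re (cinner (X x) x) = l * (norm x)\<^sup>2" for x
    using extremal_form[OF M(1) X(1,2) max that] that by (simp add: E_def)
  have E_D: "Re (cinner (X x) x) = l * (norm x)\<^sup>2" if "x \<in> E" for x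
    using that by (simp add: E_def cinner_self flip: of_real_mult)
  have cE: "csubspace E"
    by (rule csubspaceI) (auto simp: E_def csubspaceD[OF M(1)] bounded_clinearD[OF X(1)] cinner_simps algebra_simps)
  have "u \<in> E" by (rule E_I) (simp_all add: u l_def)
  then have nE: "E \<noteq> {0}" using u(2) by auto
  have l_le: "l * (\<Sum>i\<in>UNIV. (norm (Ad i x))\<^sup>2) \<le> l * (norm x)\<^sup>2" for x
    using alt
  proof
    assume "\<forall>x\<in>M. 0 \<le> Re (cinner (X x) x)"
    then have "l \<ge> 0" using u(1) by (simp add: l_def)
    then show ?thesis using sum_norm_Ad_le by (simp add: mult_left_mono)
  qed simp
  have key: "(\<Sum>i\<in>UNIV. Re (cinner (X (Ad i x)) (Ad i x))) = l * (norm x)\<^sup>2"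
    if "x \<in> E" for x
    using E_D[OF that] cinner_cp_map[of X x x] by (simp add: X(3))
  have le_i: "Re (cinner (X (Ad i x)) (Ad i x)) \<le> l * (norm (Ad i x))\<^sup>2"
    if "x \<in> E" for i x
    using that by (intro max inv) (simp add: E_def)
  have eq: "l * (\<Sum>i\<in>UNIV. (norm (Ad i x))\<^sup>2) = l * (norm x)\<^sup>2" if x: "x \<in> E" for x
  proof (rule antisym[OF l_le])
    show "l * (norm x)\<^sup>2 \<le> l * (\<Sum>i\<in>UNIV. (norm (Ad i x))\<^sup>2)"
      unfolding key[OF x, symmetric] sum_distrib_left by (intro sum_mono le_i x)
  qed
  have "Ad i x \<in> E" if x: "x \<in> E" for i x
  proof (rule E_I)
    show "Ad i x \<in> M" using x by (intro inv) (simp add: E_def)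
    have "(\<Sum>i\<in>UNIV. l * (norm (Ad i x))\<^sup>2 -
        Re (cinner (X (Ad i x)) (Ad i x))) = 0"
      using key[OF x] eq[OF x] by (simp add: sum_subtractf sum_distrib_left)
    then show "Re (cinner (X (Ad i x)) (Ad i x)) = l * (norm (Ad i x))\<^sup>2"
      using sum_nonneg_eq_0_iff[of UNIV "\<lambda>i. l * (norm (Ad i x))\<^sup>2 -
        Re (cinner (X (Ad i x)) (Ad i x))"] le_i[OF x] by simp
  qed
  moreover have "E \<subseteq> M" "\<And>x y. x \<in> E \<Longrightarrow> y \<in> M \<Longrightarrow> cinner (X x) y = of_real l * cinner x y"
    by (auto simp: E_def)
  ultimately show ?thesis using that[of E l] cE nE max eq by simp
qed

lemma defect_hermitian:
  "bounded_clinear (\<lambda>x. x - (\<Sum>i\<in>UNIV. A i (Ad i x)))"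
  "hermitian (\<lambda>x. x - (\<Sum>i\<in>UNIV. A i (Ad i x)))"
proof -
  show "bounded_clinear (\<lambda>x. x - (\<Sum>i\<in>UNIV. A i (Ad i x)))"
    by (intro bounded_clinear_minus_op bounded_clinear_ident bounded_clinear_setsum
        bounded_clinear_compose[OF bounded_clinear_A bounded_clinear_Ad])
  have "hermitian (cp_map A id)" by (rule hermitian_cp_map) (simp add: hermitian_def)
  then show "hermitian (\<lambda>x. x - (\<Sum>i\<in>UNIV. A i (Ad i x)))"
    by (simp add: hermitian_def cp_map_def cinner_simps)
qed

text \<open>The defect lies between 0 and I, so the vanishing of its form at x already annihilates
  x.\<close>

lemma defect_eq_0:
  assumes "(\<Sum>i\<in>UNIV. (norm (Ad i x))\<^sup>2) = (norm x)\<^sup>2"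
  shows "x - (\<Sum>i\<in>UNIV. A i (Ad i x)) = 0"
  using norm_le_form[OF defect_hermitian, of x] assms sum_norm_Ad_le sum_nonneg[of UNIV "\<lambda>i. (norm (Ad i _))\<^sup>2"]
  unfolding Re_cinner_defect by simp

lemma cp_limit_exists:
  obtains Z where "bounded_clinear Z" "hermitian Z" "\<And>x. (\<lambda>k. (cp_map A ^^ k) id x) \<longlonglongrightarrow> Z x"
    "cp_map A Z = Z" "\<And>x. (norm (Z x))\<^sup>2 \<le> Re (cinner (Z x) x)" "cp_limit A = Z"
proof -
  have 1: "Re (cinner (cp_map A id x) x) \<le> Re (cinner (id x) x)" for x
    using sum_norm_Ad_le[of x] by (simp add: cinner_cp_map Re_cinner_self)
  obtain Z where Z: "bounded_clinear Z" "hermitian Z" "\<And>x. (\<lambda>k. (cp_map A ^^ k) id x) \<longlonglongrightarrow> Z x"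
    "cp_map A Z = Z" "\<And>x. (norm (Z x))\<^sup>2 \<le> Re (cinner (Z x) x)"
    using cp_map_funpow_limit[OF bounded_clinear_ident(2) _ _ _ 1]
    by (auto simp: hermitian_def Re_cinner_self)
  moreover have "cp_limit A = Z" unfolding cp_limit_def using Z(3) by (auto intro: limI)
  ultimately show ?thesis using that by blast
qed

text \<open>If an invariant N contains v, the defect form vanishes on the complement of N, so all
  iterates of \<open>cp_map A\<close> at the identity keep the form |u|^2 there; a zero limit leaves
  only u = 0. Conversely, if the limit had a positive top eigenvalue, the defect would vanish on the
  top eigenspace E, so v would lie in the invariant complement of E, against cyclicity.\<close>

lemma cp_limit_zero_iff_cyclic:
  assumes fin: "finite_cdim (UNIV :: 'v set)"
    and v: "range (\<lambda>x. x - (\<Sum>i\<in>UNIV. A i (Ad i x))) = cspan {v}"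
  shows "cyclic_vector (algA) v \<longleftrightarrow> cp_limit A = (\<lambda>x. 0)"
proof -
  define D where "D x = x - (\<Sum>i\<in>UNIV. A i (Ad i x))" for x
  have hD: "hermitian D" unfolding D_def by (rule defect_hermitian)
  have rD: "range D = cspan {v}" using v by (simp add: D_def[abs_def])
  obtain Z where Z: "bounded_clinear Z" "hermitian Z" "\<And>x. (\<lambda>k. (cp_map A ^^ k) id x) \<longlonglongrightarrow> Z x"
    "cp_map A Z = Z" "\<And>x. (norm (Z x))\<^sup>2 \<le> Re (cinner (Z x) x)" "cp_limit A = Z"
    by (rule cp_limit_exists) blast
  have cl: "closed N" if "csubspace N" for N :: "'v set"
    by (rule closed_finite_cdim[OF that finite_cdim_subset[OF fin]]) simp
  show ?thesis
    unfolding cyclic_vector_iff[of A, OF bounded_clinear_A] Z(6)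
  proof
    assume Z0: "Z = (\<lambda>x. 0)"
    show "\<forall>N. csubspace N \<and> v \<in> N \<and> (\<forall>i. \<forall>x\<in>N. A i x \<in> N) \<longrightarrow> N = UNIV"
    proof (intro allI impI)
      fix N assume N: "csubspace N \<and> v \<in> N \<and> (\<forall>i. \<forall>x\<in>N. A i x \<in> N)"
      have iso: "(\<Sum>i\<in>UNIV. (norm (Ad i u))\<^sup>2) = (norm u)\<^sup>2" if u: "u \<in> orthocompl N" for u
      proof -
        have "D u \<in> cspan {v}" using rD by blast
        also have "cspan {v} \<subseteq> N" using N by (intro complex_vector.span_minimal) auto
        finally have "Re (cinner (D u) u) = 0" using orthocomplD'[OF u] by simp
        then show ?thesis unfolding D_def Re_cinner_defect by simp
      qed
      define F where "F k = (cp_map A ^^ k) id" for k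
      have F: "F 0 u = u" "cinner (F (Suc k) u) u = (\<Sum>i\<in>UNIV. cinner (F k (Ad i u)) (Ad i u))"
        for k u by (simp_all add: F_def cinner_cp_map)
      have F1: "cinner (F k u) u = of_real ((norm u)\<^sup>2)" if "u \<in> orthocompl N" for k u
        using that
      proof (induction k arbitrary: u)
        case (Suc k)
        have "Ad i u \<in> orthocompl N" for i
          by (rule orthocompl_invariant'[OF bounded_clinear_A _ Suc.prems]) (use N in blast)
        then have "cinner (F (Suc k) u) u = of_real (\<Sum>i\<in>UNIV. (norm (Ad i u))\<^sup>2)"
          unfolding F(2) by (simp add: Suc.IH)
        then show ?case using iso[OF Suc.prems] by simp
      qed (simp add: F cinner_self)
      have "of_real ((norm u)\<^sup>2) = cinner (Z u) u" if u: "u \<in> orthocompl N" for u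
      proof (rule LIMSEQ_unique)
        show "(\<lambda>k. cinner (F k u) u) \<longlonglongrightarrow> cinner (Z u) u"
          unfolding F_def by (intro cinner.tendsto Z tendsto_const)
      qed (simp add: F1[OF u])
      then have nu: "of_real ((norm u)\<^sup>2) = (0 :: complex)" if "u \<in> orthocompl N" for u
        using that unfolding Z0 cinner.zero_left .
      show "N = UNIV"
      proof (rule eq_UNIV_if_orthocompl)
        show "u = 0" if "u \<in> orthocompl N" for u using nu[OF that] by simp
      qed (use N cl in auto)
    qed
  next
    assume c: "\<forall>N. csubspace N \<and> v \<in> N \<and> (\<forall>i. \<forall>x\<in>N. A i x \<in> N) \<longrightarrow> N = UNIV"
    have "Z x = 0" for x
    proof (cases "(UNIV :: 'v set) = {0}")
      case False
      obtain l E where E: "csubspace E" "E \<noteq> {0}" "\<And>i x. x \<in> E \<Longrightarrow> Ad i x \<in> E"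
        "\<And>x. Re (cinner (Z x) x) \<le> l * (norm x)\<^sup>2"
        "\<And>x. x \<in> E \<Longrightarrow> l * (\<Sum>i\<in>UNIV. (norm (Ad i x))\<^sup>2) = l * (norm x)\<^sup>2"
      proof (rule max_eigenspace[OF complex_vector.subspace_UNIV fin False _ Z(1,2,4)])
        show "(\<forall>x\<in>UNIV. 0 \<le> Re (cinner (Z x) x)) \<or>
            (\<forall>x. (\<Sum>i\<in>UNIV. (norm (Ad i x))\<^sup>2) = (norm x)\<^sup>2)"
          using order_trans[OF zero_le_power2 Z(5)] by blast
      qed auto
      have "l = 0"
      proof (rule ccontr)
        assume l: "l \<noteq> 0"
        have D0: "D x = 0" if "x \<in> E" for x
          unfolding D_def using E(5)[OF that] l by (intro defect_eq_0) simp
        obtain z where z: "v = D z" using rD complex_vector.span_base[of v "{v}"] by blast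
        have "cinner v x = 0" if "x \<in> E" for x
          unfolding z hermitianD[OF hD] D0[OF that] by (simp add: cinner.zero_right)
        then have "v \<in> orthocompl E" by (simp add: orthocompl_def)
        moreover have "A i x \<in> orthocompl E" if "x \<in> orthocompl E" for i x
          by (rule orthocompl_invariant[OF bounded_clinear_A E(3) that])
        ultimately have O: "orthocompl E = UNIV" using c csubspace_orthocompl by blast
        obtain x where "x \<in> E" "x \<noteq> 0" using E(1,2) csubspace_0 by blast
        then show False using orthocomplD[of x E x] O by simp
      qed
      then have "(norm (Z x))\<^sup>2 \<le> 0" using order_trans[OF Z(5) E(4), of x] by (simp only: mult_zero_left)
      then show ?thesis by simp
    qed auto
    then show "Z = (\<lambda>x. 0)" by blast
  qed
qed

end

lemma minimal_invariant_cadjointD: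
  fixes A :: "'n \<Rightarrow> 'v :: chilbert_space \<Rightarrow> 'v"
  assumes A: "\<And>i. bounded_clinear (A i)"
    and m: "minimal_invariant (cadjoint ` unital_algebra (range A)) M"
  shows "csubspace M" "M \<noteq> {0}" "\<And>i x. x \<in> M \<Longrightarrow> cadjoint (A i) x \<in> M"
    "\<And>N. csubspace N \<Longrightarrow> N \<noteq> {0} \<Longrightarrow> (\<And>i x. x \<in> N \<Longrightarrow> cadjoint (A i) x \<in> N) \<Longrightarrow> N \<subseteq> M \<Longrightarrow> N = M"
  using m unfolding minimal_invariant_cadjoint_iff[of A, OF A] by simp_all

lemma cdim_eq_1_iff:
  assumes "csubspace M" "finite_cdim M"
  shows "cdim M = 1 \<longleftrightarrow> (\<exists>v. M = cspan {v} \<and> v \<noteq> 0)"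
proof
  assume 1: "cdim M = 1"
  obtain E where E: "finite E" "orthonormal E" "cspan E = M" "card E = cdim M"
    using orthonormal_basis_exists[OF assms] .
  then obtain v where "E = {v}" using 1 by (metis card_1_singletonE)
  then show "\<exists>v. M = cspan {v} \<and> v \<noteq> 0"
    using E(2,3) by (auto simp: orthonormal_def cinner.zero_left intro!: exI[of _ v])
next
  assume "\<exists>v. M = cspan {v} \<and> v \<noteq> 0"
  then obtain v where v: "M = cspan {v}" "v \<noteq> 0" by blast
  have "complex_vector.independent {v}"
    using v(2) complex_vector.independent_insert[of v "{}"] by simp
  then have "cdim {v} = card {v}" by (rule complex_vector.dim_eq_card_independent)
  then show "cdim M = 1" by (simp add: v(1))
qed

section \<open>Fixed points of the completely positive map in finite dimension\<close>

locale finite_row_contraction = row_contraction A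
  for A :: "'n :: finite \<Rightarrow> 'v :: chilbert_space \<Rightarrow> 'v" +
  assumes fin: "finite_cdim (UNIV :: 'v set)"
begin

lemma rank_one_cyclic_iff:
  "(\<exists>v. range (\<lambda>x. x - (\<Sum>i\<in>UNIV. A i (Ad i x))) = cspan {v} \<and> v \<noteq> 0 \<and>
         cyclic_vector (algA) v) \<longleftrightarrow>
      cdim (range (\<lambda>x. x - cp_map A id x)) = 1 \<and> cp_limit A = (\<lambda>x. 0)"
proof -
  have 1: "(\<lambda>x. x - cp_map A id x) = (\<lambda>x. x - (\<Sum>i\<in>UNIV. A i (Ad i x)))"
    by (simp add: cp_map_def)
  have "csubspace (range (\<lambda>x. x - (\<Sum>i\<in>UNIV. A i (Ad i x))))"
    by (intro csubspace_image defect_hermitian complex_vector.subspace_UNIV)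
  note cdim_eq_1_iff[OF this finite_cdim_subset[OF fin subset_UNIV]]
  then show ?thesis unfolding 1 using cp_limit_zero_iff_cyclic[OF fin] by blast
qed

lemma sum_words_norm_le: "(\<Sum>w\<in>words k. (norm (AWd w x))\<^sup>2) \<le> (norm x)\<^sup>2"
proof (induction k arbitrary: x)
  case (Suc k)
  have "(\<Sum>w\<in>words (Suc k). (norm (AWd w x))\<^sup>2) \<le> (\<Sum>i\<in>UNIV. (norm (Ad i x))\<^sup>2)"
    unfolding sum_words_Suc cadjoint_word_op_Cons[of A, OF bounded_clinear_A]
    by (intro sum_mono Suc)
  also have "\<dots> \<le> (norm x)\<^sup>2" by (rule sum_norm_Ad_le)
  finally show ?case .
qed simp

context
  fixes V :: "'v set"
  assumes V: "csubspace V" and inv: "\<And>i x. x \<in> V \<Longrightarrow> Ad i x \<in> V"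
begin

lemma closed_V: "closed V"
  by (rule closed_finite_cdim[OF V finite_cdim_subset[OF fin subset_UNIV]])

lemma Re_cinner_coproj: "Re (cinner (x - proj V x) x) = (norm (x - proj V x))\<^sup>2"
proof -
  have "cinner (x - proj V x) (proj V x) = 0"
    by (rule orthocomplD[OF proj_orth[OF V closed_V] proj_in[OF V closed_V]])
  then show ?thesis unfolding Re_cinner_self[symmetric] by (simp add: cinner_simps)
qed

text \<open>Write Q for the projection onto the complement of V. Since V is invariant under the
  adjoints, \<open>Q (Ad i x) = Q (Ad i (Q x))\<close>, and contractivity then shows that Q
  decreases under \<open>cp_map A\<close>.\<close>

lemma coproj_limit:
  obtains Z where "bounded_clinear Z" "hermitian Z"
    "\<And>x. (\<lambda>k. (cp_map A ^^ k) (\<lambda>x. x - proj V x) x) \<longlonglongrightarrow> Z x"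
    "cp_map A Z = Z" "\<And>x. (norm (Z x))\<^sup>2 \<le> Re (cinner (Z x) x)"
proof (rule cp_map_funpow_limit)
  let ?Q = "\<lambda>x. x - proj V x"
  show "bounded_clinear ?Q" by (intro bounded_clinear_minus_op bounded_clinear_ident bounded_clinear_proj V closed_V)
  show "hermitian ?Q" by (simp add: hermitian_def cinner_simps cinner_proj[OF V closed_V])
  show "0 \<le> Re (cinner (?Q x) x)" for x by (simp add: Re_cinner_coproj)
  have Q_le: "norm (?Q x) \<le> norm x" for x
    by (rule power2_le_imp_le) (use norm_proj_pythagoras[OF V closed_V, of x] in auto)
  show "Re (cinner (?Q x) x) \<le> (norm x)\<^sup>2" for x
    unfolding Re_cinner_coproj by (rule power_mono[OF Q_le norm_ge_zero])
  show "Re (cinner (cp_map A ?Q x) x) \<le> Re (cinner (?Q x) x)" for x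
  proof -
    have *: "?Q (Ad i x) = ?Q (Ad i (?Q x))" for i
    proof -
      have "Ad i (proj V x) \<in> V" by (intro inv proj_in V closed_V)
      then have "proj V (Ad i (proj V x)) = Ad i (proj V x)"
        by (rule proj_ident[OF V closed_V])
      then show ?thesis
        by (simp add: bounded_clinear_diff[OF bounded_clinear_Ad]
            bounded_clinear_diff[OF bounded_clinear_proj[OF V closed_V]])
    qed
    have "Re (cinner (cp_map A ?Q x) x) = (\<Sum>i\<in>UNIV. (norm (?Q (Ad i x)))\<^sup>2)"
      by (simp add: cinner_cp_map Re_cinner_coproj)
    also have "\<dots> \<le> (\<Sum>i\<in>UNIV. (norm (Ad i (?Q x)))\<^sup>2)"
      unfolding * by (intro sum_mono power_mono Q_le) auto
    also have "\<dots> \<le> (norm (?Q x))\<^sup>2" by (rule sum_norm_Ad_le)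
    finally show ?thesis by (simp add: Re_cinner_coproj)
  qed
qed (rule that)

lemma coproj_funpow_form_0:
  "x \<in> V \<Longrightarrow> cinner ((cp_map A ^^ k) (\<lambda>x. x - proj V x) x) x = 0"
proof (induction k arbitrary: x)
  case 0 then show ?case by (simp add: proj_ident[OF V closed_V] cinner.zero_left)
next
  case (Suc k) then show ?case by (simp add: cinner_cp_map inv)
qed

lemma coproj_limit_zero_on:
  assumes Z: "\<And>x. (\<lambda>k. (cp_map A ^^ k) (\<lambda>x. x - proj V x) x) \<longlonglongrightarrow> Z x"
    "\<And>x. (norm (Z x))\<^sup>2 \<le> Re (cinner (Z x) x)" and x: "x \<in> V"
  shows "Z x = 0"
proof -
  have "(\<lambda>k. cinner ((cp_map A ^^ k) (\<lambda>x. x - proj V x) x) x) \<longlonglongrightarrow> cinner (Z x) x"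
    by (intro cinner.tendsto Z tendsto_const)
  then have "cinner (Z x) x = 0"
    unfolding coproj_funpow_form_0[OF x] by (simp add: LIMSEQ_const_iff)
  then show ?thesis using Z(2)[of x] by simp
qed

text \<open>If \<open>V\<close> is cyclic then \<open>\<Phi>\<^sup>k (I - P\<^sub>V)\<close> tends to \<open>0\<close>: otherwise the top eigenspace of the limit would
  be orthogonal to \<open>V\<close> and invariant under the adjoints.\<close>

lemma coproj_limit_zero_if_cyclic:
  assumes cyc: "cyclic_subspace (algA) V"
  shows "(\<lambda>k. (cp_map A ^^ k) (\<lambda>x. x - proj V x) x) \<longlonglongrightarrow> 0"
proof -
  obtain Z where Z: "bounded_clinear Z" "hermitian Z"
    "\<And>x. (\<lambda>k. (cp_map A ^^ k) (\<lambda>x. x - proj V x) x) \<longlonglongrightarrow> Z x"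
    "cp_map A Z = Z" "\<And>x. (norm (Z x))\<^sup>2 \<le> Re (cinner (Z x) x)"
    by (rule coproj_limit) blast
  have "Z x = 0" for x
  proof (cases "(UNIV :: 'v set) = {0}")
    case False
    obtain l E where E: "csubspace E" "E \<noteq> {0}" "\<And>i x. x \<in> E \<Longrightarrow> Ad i x \<in> E"
      "\<And>x y. x \<in> E \<Longrightarrow> y \<in> UNIV \<Longrightarrow> cinner (Z x) y = of_real l * cinner x y"
      "\<And>x. x \<in> UNIV \<Longrightarrow> Re (cinner (Z x) x) \<le> l * (norm x)\<^sup>2"
    proof (rule max_eigenspace[OF complex_vector.subspace_UNIV fin False _ Z(1,2,4)])
      show "(\<forall>x\<in>UNIV. 0 \<le> Re (cinner (Z x) x)) \<or>
          (\<forall>x. (\<Sum>i\<in>UNIV. (norm (Ad i x))\<^sup>2) = (norm x)\<^sup>2)"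
        using order_trans[OF zero_le_power2 Z(5)] by blast
    qed auto
    have "l = 0"
    proof (rule ccontr)
      assume l: "l \<noteq> 0"
      have "cinner v x = 0" if "x \<in> E" "v \<in> V" for x v
      proof -
        have "of_real l * cinner x v = cinner x (Z v)"
          using E(4)[OF that(1), of v] by (simp add: hermitianD[OF Z(2)])
        also have "Z v = 0" by (rule coproj_limit_zero_on[OF Z(3,5) that(2)])
        finally show ?thesis using l cinner_sym_0[of v x] by (simp add: cinner.zero_right)
      qed
      then have "V \<subseteq> orthocompl E" by (auto simp: orthocompl_def)
      moreover have "A i x \<in> orthocompl E" if "x \<in> orthocompl E" for i x
        by (rule orthocompl_invariant[OF bounded_clinear_A E(3) that])
      ultimately have O: "orthocompl E = UNIV"
        using cyc csubspace_orthocompl unfolding cyclic_subspace_iff[of A, OF bounded_clinear_A]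
        by blast
      obtain x where "x \<in> E" "x \<noteq> 0" using E(1,2) csubspace_0 by blast
      then show False using orthocomplD[of x E x] O by simp
    qed
    then have "(norm (Z x))\<^sup>2 \<le> 0"
      using order_trans[OF Z(5) E(5)[OF UNIV_I], of x] by (simp only: mult_zero_left)
    then show ?thesis by simp
  qed auto
  then show ?thesis using Z(3)[of x] by simp
qed

context
  assumes unital: "(\<lambda>x. \<Sum>i\<in>UNIV. A i (Ad i x)) = id"
begin

lemma sum_norm_Ad: "(\<Sum>i\<in>UNIV. (norm (Ad i x))\<^sup>2) = (norm x)\<^sup>2"
  using Re_cinner_defect[of x] fun_cong[OF unital, of x] by (simp add: cinner.zero_left)

text \<open>The limit of the iterates of I - P, P the projection onto V, is a fixed point, hence a
  scalar, and it vanishes on the nonzero space V, so it is 0. On the complement of an invariant N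
  containing V, unitality keeps the form of every iterate at |u|^2, which forces that complement to
  be 0.\<close>

lemma cyclic_if_fixed_points_scalar:
  assumes nz: "V \<noteq> {0}"
    and scalar: "\<And>X. bounded_clinear X \<Longrightarrow> cp_map A X = X \<Longrightarrow> \<exists>c. \<forall>x. X x = c *\<^sub>C x"
  shows "cyclic_subspace (algA) V"
  unfolding cyclic_subspace_iff[of A, OF bounded_clinear_A]
proof (intro allI impI)
  fix N assume N: "csubspace N \<and> V \<subseteq> N \<and> (\<forall>i. \<forall>x\<in>N. A i x \<in> N)"
  obtain Z where Z: "bounded_clinear Z" "hermitian Z"
    "\<And>x. (\<lambda>k. (cp_map A ^^ k) (\<lambda>x. x - proj V x) x) \<longlonglongrightarrow> Z x"
    "cp_map A Z = Z" "\<And>x. (norm (Z x))\<^sup>2 \<le> Re (cinner (Z x) x)"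
    by (rule coproj_limit) blast
  obtain c where c: "\<And>x. Z x = c *\<^sub>C x" using scalar[OF Z(1,4)] by blast
  obtain x where x: "x \<in> V" "x \<noteq> 0" using nz csubspace_0[OF V] by blast
  have "cinner (Z x) x = 0" using coproj_limit_zero_on[OF Z(3,5) x(1)] by (simp add: cinner.zero_left)
  then have c0: "c = 0" using x(2) by (simp add: c cinner_simps)
  have form: "cinner ((cp_map A ^^ k) (\<lambda>x. x - proj V x) u) u = of_real ((norm u)\<^sup>2)"
    if "u \<in> orthocompl N" for u k
    using that
  proof (induction k arbitrary: u)
    case 0
    have "u \<in> orthocompl V" using 0 N by (auto simp: orthocompl_def)
    then show ?case by (simp add: proj_0[OF V closed_V] cinner_self)
  next
    case (Suc k)
    have "Ad i u \<in> orthocompl N" for i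
      by (rule orthocompl_invariant'[OF bounded_clinear_A _ Suc.prems]) (use N in blast)
    then have "cinner ((cp_map A ^^ Suc k) (\<lambda>x. x - proj V x) u) u =
        of_real (\<Sum>i\<in>UNIV. (norm (Ad i u))\<^sup>2)"
      by (simp add: cinner_cp_map Suc.IH)
    then show ?case by (simp add: sum_norm_Ad)
  qed
  show "N = UNIV"
  proof (rule eq_UNIV_if_orthocompl)
    fix u assume u: "u \<in> orthocompl N"
    have "(\<lambda>k. cinner ((cp_map A ^^ k) (\<lambda>x. x - proj V x) u) u) \<longlonglongrightarrow> cinner (Z u) u"
      by (intro cinner.tendsto Z tendsto_const)
    then have "of_real ((norm u)\<^sup>2) = cinner (Z u) u"
      unfolding form[OF u] LIMSEQ_const_iff .
    then show "u = 0" by (simp add: c c0 cinner_simps del: of_real_power)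
  qed (use N closed_finite_cdim[OF _ finite_cdim_subset[OF fin subset_UNIV]] in auto)
qed

text \<open>The top eigenspace of the compression is nonzero and invariant under the adjoints, so by
  minimality it is all of V.\<close>

lemma hermitian_fixed_point_scalar_on:
  assumes min: "\<And>N. csubspace N \<Longrightarrow> N \<noteq> {0} \<Longrightarrow> (\<And>i x. x \<in> N \<Longrightarrow> Ad i x \<in> N) \<Longrightarrow> N \<subseteq> V \<Longrightarrow> N = V"
    and nz: "V \<noteq> {0}" and X: "bounded_clinear X" "hermitian X" "cp_map A X = X"
  shows "\<exists>l. \<forall>x\<in>V. \<forall>y\<in>V. cinner (X x) y = l * cinner x y"
proof -
  obtain l E where E: "csubspace E" "E \<noteq> {0}" "E \<subseteq> V" "\<And>i x. x \<in> E \<Longrightarrow> Ad i x \<in> E"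
    "\<And>x y. x \<in> E \<Longrightarrow> y \<in> V \<Longrightarrow> cinner (X x) y = of_real l * cinner x y"
    "\<And>x. x \<in> V \<Longrightarrow> Re (cinner (X x) x) \<le> l * (norm x)\<^sup>2"
    "\<And>x. x \<in> E \<Longrightarrow> l * (\<Sum>i\<in>UNIV. (norm (Ad i x))\<^sup>2) = l * (norm x)\<^sup>2"
  proof (rule max_eigenspace[OF V finite_cdim_subset[OF fin subset_UNIV] nz inv X])
    show "(\<forall>x\<in>V. 0 \<le> Re (cinner (X x) x)) \<or>
        (\<forall>x. (\<Sum>i\<in>UNIV. (norm (Ad i x))\<^sup>2) = (norm x)\<^sup>2)"
      using sum_norm_Ad by blast
  qed (assumption | rule that)+
  have "E = V" using min[OF E(1,2,4,3)] .
  then show ?thesis using E(5) by auto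
qed

lemma fixed_point_scalar_on:
  assumes min: "\<And>N. csubspace N \<Longrightarrow> N \<noteq> {0} \<Longrightarrow> (\<And>i x. x \<in> N \<Longrightarrow> Ad i x \<in> N) \<Longrightarrow> N \<subseteq> V \<Longrightarrow> N = V"
    and nz: "V \<noteq> {0}" and X: "bounded_clinear X" "cp_map A X = X"
  shows "\<exists>c. \<forall>x\<in>V. \<forall>y\<in>V. cinner (X x) y = c * cinner x y"
proof -
  have X': "bounded_clinear (cadjoint X)" by (rule bounded_clinear_cadjoint[OF X(1)])
  have fix1: "cinner (X x) y = (\<Sum>i\<in>UNIV. cinner (X (Ad i x)) (Ad i y))" for x y
    using cinner_cp_map[of X x y] by (simp add: X(2))
  have fix2: "cinner (cadjoint X x) y = (\<Sum>i\<in>UNIV. cinner (cadjoint X (Ad i x)) (Ad i y))" for x y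
    using arg_cong[OF fix1[of y x], of cnj]
    unfolding cinner_cadjoint_left[OF X(1)] cnj_sum cinner_commute[symmetric] .
  \<comment> \<open>Twice the real part and, up to sign, twice the imaginary part of X, so that X is
    half of H - i K. Both are fixed points because the adjoint of a fixed point is one.\<close>
  define H where "H = (\<lambda>x. X x + cadjoint X x)"
  define K where "K = (\<lambda>x. \<i> *\<^sub>C (X x - cadjoint X x))"
  have adj: "cinner (X x) y = cinner x (cadjoint X y)" "cinner (cadjoint X x) y = cinner x (X y)" for x y
    by (simp_all add: cinner_cadjoint[OF X(1)] cinner_cadjoint_left[OF X(1)])
  have "\<exists>h. \<forall>x\<in>V. \<forall>y\<in>V. cinner (H x) y = h * cinner x y"
  proof (rule hermitian_fixed_point_scalar_on[OF min nz])
    show "bounded_clinear H" unfolding H_def by (intro bounded_clinear_plus X X')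
    show "hermitian H" by (simp add: hermitian_def H_def cinner_simps adj)
    show "cp_map A H = H"
    proof (rule ext, rule cinner_eqI_left)
      fix x y
      show "cinner (cp_map A H x) y = cinner (H x) y"
        using fix1[of x y] fix2[of x y] by (simp add: cinner_cp_map H_def cinner_simps sum.distrib)
    qed
  qed
  then obtain h where h: "\<And>x y. x \<in> V \<Longrightarrow> y \<in> V \<Longrightarrow> cinner (H x) y = h * cinner x y" by blast
  have "\<exists>k. \<forall>x\<in>V. \<forall>y\<in>V. cinner (K x) y = k * cinner x y"
  proof (rule hermitian_fixed_point_scalar_on[OF min nz])
    show "bounded_clinear K" unfolding K_def by (intro bounded_clinear_minus_op bounded_clinear_cmul X X')
    show "hermitian K" by (simp add: hermitian_def K_def cinner_simps adj algebra_simps)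
    show "cp_map A K = K"
    proof (rule ext, rule cinner_eqI_left)
      fix x y
      show "cinner (cp_map A K x) y = cinner (K x) y"
        using fix1[of x y] fix2[of x y]
        by (simp add: cinner_cp_map K_def cinner_simps sum_subtractf sum_distrib_left[symmetric])
    qed
  qed
  then obtain k where k: "\<And>x y. x \<in> V \<Longrightarrow> y \<in> V \<Longrightarrow> cinner (K x) y = k * cinner x y" by blast
  have "X x = (1/2) *\<^sub>C (H x - \<i> *\<^sub>C K x)" for x
    by (rule cinner_eqI_left) (simp add: H_def K_def cinner_simps algebra_simps)
  then have XHK: "cinner (X x) y = (1/2) * (cinner (H x) y - \<i> * cinner (K x) y)" for x y
    by (metis cinner.diff_left cinner_scaleC_left)
  have "cinner (X x) y = (h - \<i> * k) / 2 * cinner x y" if "x \<in> V" "y \<in> V" for x y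
    unfolding XHK h[OF that] k[OF that] by (simp add: algebra_simps diff_divide_distrib)
  then show ?thesis by blast
qed

text \<open>A vanishing compression to V means that \<open>cinner (X a) b\<close> is controlled by
  the components of a and b off V. Writing X as its own k-th iterate spreads x and y over the words
  of length k; there the total mass off V tends to 0, and Cauchy-Schwarz over the words finishes the
  estimate.\<close>

lemma fixed_point_zero:
  assumes cyc: "cyclic_subspace (algA) V"
    and X: "bounded_clinear X" "cp_map A X = X"
    and zero: "\<And>x y. x \<in> V \<Longrightarrow> y \<in> V \<Longrightarrow> cinner (X x) y = 0"
  shows "X x = 0"
proof -
  obtain K where K: "K > 0" "\<And>x. norm (X x) \<le> K * norm x" by (rule bounded_clinear_bound[OF X(1)]) blast
  define Q where "Q x = x - proj V x" for x
  \<comment> \<open>The square root of the form at x of the k-th iterate of the projection Q onto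
    the complement of V.\<close>
  define d where "d k x = sqrt (\<Sum>w\<in>words k. (norm (Q (AWd w x)))\<^sup>2)" for k x
  have d0: "(\<lambda>k. d k x) \<longlonglongrightarrow> 0" for x
  proof -
    have "(\<lambda>k. Re (cinner ((cp_map A ^^ k) Q x) x)) \<longlonglongrightarrow> Re (cinner 0 x)"
      unfolding Q_def by (intro tendsto_Re cinner.tendsto coproj_limit_zero_if_cyclic[OF cyc] tendsto_const)
    moreover have "Re (cinner ((cp_map A ^^ k) Q x) x) = (\<Sum>w\<in>words k. (norm (Q (AWd w x)))\<^sup>2)" for k
      by (simp add: cinner_cp_map_funpow Q_def Re_cinner_coproj)
    ultimately have "(\<lambda>k. \<Sum>w\<in>words k. (norm (Q (AWd w x)))\<^sup>2) \<longlonglongrightarrow> 0"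
      by (simp add: cinner.zero_left)
    from tendsto_real_sqrt[OF this] show ?thesis by (simp add: d_def)
  qed
  have one: "cmod (cinner (X a) b) \<le> K * (norm a * norm (Q b) + norm (Q a) * norm b)" for a b
  proof -
    have V': "proj V x \<in> V" for x by (rule proj_in[OF V closed_V])
    have "cinner (X a) b = cinner (X (proj V a)) (proj V b) + cinner (X a) (Q b) + cinner (X (Q a)) (proj V b)"
      by (simp add: Q_def cinner_simps bounded_clinearD[OF X(1)])
    then have "cinner (X a) b = cinner (X a) (Q b) + cinner (X (Q a)) (proj V b)"
      by (simp add: zero V')
    then have "cmod (cinner (X a) b) \<le> cmod (cinner (X a) (Q b)) + cmod (cinner (X (Q a)) (proj V b))"
      by (simp add: norm_triangle_ineq)
    also have "cmod (cinner (X a) (Q b)) \<le> (K * norm a) * norm (Q b)"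
      by (rule order_trans[OF cinner_bound]) (intro mult_right_mono K norm_ge_zero)
    also have "cmod (cinner (X (Q a)) (proj V b)) \<le> (K * norm (Q a)) * norm b"
      by (rule order_trans[OF cinner_bound])
        (intro mult_mono K norm_ge_zero norm_proj_le V closed_V mult_nonneg_nonneg less_imp_le[OF K(1)])
    finally show ?thesis by (simp add: algebra_simps)
  qed
  have CS: "(\<Sum>w\<in>words k. norm (AWd w x) * norm (Q (AWd w y))) \<le> norm x * d k y"
    for k x y
  proof -
    have "(\<Sum>w\<in>words k. norm (AWd w x) * norm (Q (AWd w y))) \<le>
        L2_set (\<lambda>w. norm (AWd w x)) (words k) * L2_set (\<lambda>w. norm (Q (AWd w y))) (words k)"
      using L2_set_mult_ineq[of "\<lambda>w. norm (AWd w x)" "\<lambda>w. norm (Q (AWd w y))" "words k"]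
      by simp
    also have "\<dots> \<le> norm x * d k y"
      unfolding L2_set_def d_def
      by (intro mult_right_mono real_le_lsqrt sum_words_norm_le real_sqrt_ge_zero sum_nonneg) auto
    finally show ?thesis .
  qed
  have est: "cmod (cinner (X x) y) \<le> K * (norm x * d k y + norm y * d k x)" for x y k
  proof -
    have "(cp_map A ^^ k) X = X" by (induction k) (simp_all add: X(2))
    then have eq: "cinner (X x) y = (\<Sum>w\<in>words k. cinner (X (AWd w x)) (AWd w y))"
      using cinner_cp_map_funpow[of k X x y] by (simp only:)
    have "cmod (cinner (X x) y) \<le> (\<Sum>w\<in>words k. K * (norm (AWd w x) * norm (Q (AWd w y)) +
        norm (AWd w y) * norm (Q (AWd w x))))"
      unfolding eq
    proof (rule sum_norm_le)
      fix w
      show "cmod (cinner (X (AWd w x)) (AWd w y)) \<le>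
          K * (norm (AWd w x) * norm (Q (AWd w y)) +
            norm (AWd w y) * norm (Q (AWd w x)))"
        using one[of "AWd w x" "AWd w y"] by (simp only: mult.commute)
    qed
    also have "\<dots> = K * ((\<Sum>w\<in>words k. norm (AWd w x) * norm (Q (AWd w y))) +
        (\<Sum>w\<in>words k. norm (AWd w y) * norm (Q (AWd w x))))"
      by (subst sum.distrib[symmetric], subst sum_distrib_left, rule refl)
    also have "\<dots> \<le> K * (norm x * d k y + norm y * d k x)"
      by (intro mult_left_mono add_mono CS less_imp_le[OF K(1)])
    finally show ?thesis .
  qed
  have "cinner (X x) y = 0" for y
  proof -
    have "(\<lambda>k. K * (norm x * d k y + norm y * d k x)) \<longlonglongrightarrow> K * (norm x * 0 + norm y * 0)"
      by (intro tendsto_intros d0)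
    then have "cmod (cinner (X x) y) \<le> K * (norm x * 0 + norm y * 0)"
      by (rule LIMSEQ_le_const) (intro exI[of _ 0] allI impI est)
    then show ?thesis by simp
  qed
  from this[of "X x"] show ?thesis by simp
qed

end

end

lemma fixed_points_scalar_iff:
  assumes nz: "(UNIV :: 'v set) \<noteq> {0}"
  shows "((\<lambda>x. \<Sum>i\<in>UNIV. A i (Ad i x)) = id \<and>
        (\<exists>V\<^sub>0. minimal_invariant (cadjoint ` algA) V\<^sub>0 \<and>
           cyclic_subspace (algA) V\<^sub>0)) \<longleftrightarrow>
      {X. bounded_clinear X \<and> cp_map A X = X} = {\<lambda>x. c *\<^sub>C x |c. True}" (is "?L \<longleftrightarrow> ?F = ?S")
proof
  assume ?L
  then obtain V where unital: "(\<lambda>x. \<Sum>i\<in>UNIV. A i (Ad i x)) = id"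
    and m: "minimal_invariant (cadjoint ` algA) V"
    and cyc: "cyclic_subspace (algA) V"
    by blast
  note V = minimal_invariant_cadjointD[of A, OF bounded_clinear_A m]
  have scalar: "cp_map A (\<lambda>x. c *\<^sub>C x) = (\<lambda>x. c *\<^sub>C x)" for c
    using fun_cong[OF unital]
    by (simp add: cp_map_def bounded_clinear_scaleC[OF bounded_clinear_A] complex_vector.scale_sum_right[symmetric])
  show "?F = ?S"
  proof
    show "?S \<subseteq> ?F" using scalar by auto
    show "?F \<subseteq> ?S"
    proof
      fix X assume "X \<in> ?F"
      then have X: "bounded_clinear X" "cp_map A X = X" by auto
      obtain c where c: "\<And>x y. x \<in> V \<Longrightarrow> y \<in> V \<Longrightarrow> cinner (X x) y = c * cinner x y"
        using fixed_point_scalar_on[OF V(1,3) unital V(4) V(2) X] by blast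
      define X' where "X' = (\<lambda>x. X x - c *\<^sub>C x)"
      have "X' x = 0" for x
      proof (rule fixed_point_zero[where X = X', OF V(1,3) unital cyc])
        show "bounded_clinear X'" unfolding X'_def
          by (intro bounded_clinear_minus_op X bounded_clinear_cmul bounded_clinear_ident)
        show "cp_map A X' = X'"
        proof
          fix x
          have "cp_map A X' x = cp_map A X x - cp_map A (\<lambda>x. c *\<^sub>C x) x"
            by (simp add: cp_map_def X'_def bounded_clinear_diff[OF bounded_clinear_A] sum_subtractf)
          then show "cp_map A X' x = X' x" by (simp add: scalar X(2) X'_def)
        qed
        show "cinner (X' x) y = 0" if "x \<in> V" "y \<in> V" for x y
          using c[OF that] by (simp add: X'_def cinner_simps)
      qed
      then have "X = (\<lambda>x. c *\<^sub>C x)" by (auto simp: X'_def)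
      then show "X \<in> ?S" by blast
    qed
  qed
next
  assume FS: "?F = ?S"
  have "(\<lambda>x. x) = (\<lambda>x :: 'v. 1 *\<^sub>C x)" by simp
  then have "(\<lambda>x. x) \<in> ?F" unfolding FS by blast
  then have "cp_map A (\<lambda>x. x) = (\<lambda>x. x)" by simp
  then have unital: "(\<lambda>x. \<Sum>i\<in>UNIV. A i (Ad i x)) = id" by (simp add: cp_map_def id_def)
  \<comment> \<open>Any minimal subspace will do: once the fixed points are scalar, every nonzero
    subspace invariant under the adjoints is cyclic.\<close>
  obtain V where m: "minimal_invariant (cadjoint ` algA) V"
    using minimal_invariant_exists[of A, OF bounded_clinear_A fin nz] by blast
  note V = minimal_invariant_cadjointD[of A, OF bounded_clinear_A m]
  have "cyclic_subspace (algA) V"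
  proof (rule cyclic_if_fixed_points_scalar[OF V(1,3) unital V(2)])
    fix X assume "bounded_clinear X" "cp_map A X = X"
    then have "X \<in> ?S" using FS by blast
    then show "\<exists>c. \<forall>x. X x = c *\<^sub>C x" by auto
  qed
  then show ?L using unital m by blast
qed

end

section \<open>Weak operator closed algebras\<close>

text \<open>The topology is pulled back from a product indexed by pairs of vectors, whose basic open
  sets restrict finitely many coordinates. Membership in the closure is therefore approximability of
  finitely many matrix coefficients.\<close>

lemma in_wot_algebra_iff:
  fixes G :: "('a :: complex_inner \<Rightarrow> 'a) set"
  assumes G: "\<And>T. T \<in> G \<Longrightarrow> bounded_clinear T"
  shows "T \<in> wot_algebra G \<longleftrightarrow> bounded_clinear T \<and>
    (\<forall>F e. finite F \<and> e > 0 \<longrightarrow>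
      (\<exists>R\<in>unital_algebra G. \<forall>(x, y)\<in>F. cmod (cinner (R x) y - cinner (T x) y) < e))"
    (is "_ \<longleftrightarrow> _ \<and> ?R")
proof -
  define f where "f = (\<lambda>(T :: 'a \<Rightarrow> 'a) (x, y). cinner (T x) y)"
  have wot: "(wot :: ('a \<Rightarrow> 'a) topology) = pullback_topology {T. bounded_clinear T} f euclidean"
    by (simp add: wot_def f_def)
  have top: "topspace (wot :: ('a \<Rightarrow> 'a) topology) = {T. bounded_clinear T}"
    by (auto simp: wot topspace_pullback_topology)
  have ua: "bounded_clinear R" if "R \<in> unital_algebra G" for R
    using bounded_clinear_unital_algebra[OF that G] .
  have op: "openin (wot :: ('a \<Rightarrow> 'a) topology) U \<longleftrightarrow> (\<exists>W. open W \<and> U = f -` W \<inter> {T. bounded_clinear T})" for U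
    by (simp add: wot openin_pullback_topology)
  show ?thesis
    unfolding wot_algebra_def in_closure_of top
  proof (rule conj_cong, simp, rule iffI)
    assume T: "bounded_clinear T"
      and cl: "\<forall>U. T \<in> U \<and> openin wot U \<longrightarrow> (\<exists>y. y \<in> unital_algebra G \<and> y \<in> U)"
    show ?R
    proof (intro allI impI)
      fix F :: "('a \<times> 'a) set" and e :: real assume F: "finite F \<and> e > 0"
      define W where "W = (\<Inter>p\<in>F. {g :: 'a \<times> 'a \<Rightarrow> complex. dist (g p) (f T p) < e})"
      have "open W" unfolding W_def using F
        by (intro open_INT ballI open_Collect_less continuous_intros continuous_on_product_coordinates) auto
      then have "openin wot (f -` W \<inter> {T. bounded_clinear T})" unfolding op by blast
      moreover have "T \<in> f -` W \<inter> {T. bounded_clinear T}" using T F by (simp add: W_def)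
      ultimately have "\<exists>y. y \<in> unital_algebra G \<and> y \<in> f -` W \<inter> {T. bounded_clinear T}"
        by (intro cl[rule_format] conjI)
      then obtain R where "R \<in> unital_algebra G" "R \<in> f -` W" by blast
      then show "\<exists>R\<in>unital_algebra G. \<forall>(x, y)\<in>F. cmod (cinner (R x) y - cinner (T x) y) < e"
        by (auto simp: W_def f_def dist_norm intro!: bexI[of _ R])
    qed
  next
    assume T: "bounded_clinear T" and R: ?R
    show "\<forall>U. T \<in> U \<and> openin wot U \<longrightarrow> (\<exists>y. y \<in> unital_algebra G \<and> y \<in> U)"
    proof (intro allI impI)
      fix U assume U: "T \<in> U \<and> openin wot U"
      then obtain W where W: "open W" "U = f -` W \<inter> {T. bounded_clinear T}" unfolding op by blast
      have oW: "openin (product_topology (\<lambda>i. euclidean) UNIV) W" using W(1)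
        by (simp add: euclidean_product_topology)
      have TW: "f T \<in> W" using U W by auto
      obtain X where X: "f T \<in> (\<Pi>\<^sub>E i\<in>UNIV. X i)" "\<And>i. openin euclidean (X i)"
        "finite {i. X i \<noteq> topspace euclidean}" "(\<Pi>\<^sub>E i\<in>UNIV. X i) \<subseteq> W"
        using product_topology_open_contains_basis[OF oW TW] by blast
      define F where "F = {i. X i \<noteq> topspace euclidean}"
      have "\<exists>e>0. ball (f T p) e \<subseteq> X p" for p
      proof -
        have "f T p \<in> X p" "open (X p)" using X(1) X(2)[of p] by auto
        then show ?thesis by (simp add: open_contains_ball)
      qed
      then obtain r where r: "\<And>p. r p > 0" "\<And>p. ball (f T p) (r p) \<subseteq> X p" by metis
      \<comment> \<open>The 1 keeps the minimum meaningful when no coordinate is restricted.\<close>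
      define e where "e = Min (insert 1 (r ` F))"
      have fF: "finite F" using X(3) by (simp add: F_def)
      have e: "e > 0" "\<And>p. p \<in> F \<Longrightarrow> e \<le> r p" using fF r(1) by (auto simp: e_def)
      obtain Q where Q: "Q \<in> unital_algebra G" "\<And>x y. (x, y) \<in> F \<Longrightarrow> cmod (cinner (Q x) y - cinner (T x) y) < e"
        using R[rule_format, OF conjI[OF fF e(1)]] by auto
      have "f Q p \<in> X p" for p
      proof (cases "p \<in> F")
        case True
        obtain x y where p: "p = (x, y)" by force
        have "dist (f T p) (f Q p) < r p"
          using Q(2)[of x y] e(2)[OF True] True by (simp add: p f_def dist_norm norm_minus_commute)
        then show ?thesis using r(2)[of p] by auto
      qed (simp add: F_def)
      then have "f Q \<in> W" using X(4) by auto
      then show "\<exists>y. y \<in> unital_algebra G \<and> y \<in> U" using Q(1) ua W(2) by auto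
    qed
  qed
qed

lemma wot_algebraD:
  assumes "\<And>i. bounded_clinear (S i)" "T \<in> wot_algebra (range S)"
  shows "bounded_clinear T"
    and "finite F \<Longrightarrow> e > 0 \<Longrightarrow> \<exists>R\<in>unital_algebra (range S). \<forall>(x, y)\<in>F. cmod (cinner (R x) y - cinner (T x) y) < e"
  using assms(2) in_wot_algebra_iff[of "range S" T] assms(1) by auto

lemma unital_algebra_subset_wot_algebra:
  assumes "\<And>i. bounded_clinear (S i)" "T \<in> unital_algebra (range S)"
  shows "T \<in> wot_algebra (range S)"
proof -
  have S: "\<And>T. T \<in> range S \<Longrightarrow> bounded_clinear T" using assms(1) by blast
  have "bounded_clinear T" using bounded_clinear_unital_algebra[OF assms(2) S] .
  then show ?thesis
    using assms(2) by (intro iffD2[OF in_wot_algebra_iff[OF S]]) (auto intro!: bexI[of _ T])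
qed

text \<open>A closed subspace is cut out by the vanishing of matrix coefficients against its
  complement, so invariance passes to weak limits.\<close>

lemma wot_algebra_invariant:
  fixes S :: "'n \<Rightarrow> 'a :: chilbert_space \<Rightarrow> 'a"
  assumes S: "\<And>i. bounded_clinear (S i)" and T: "T \<in> wot_algebra (range S)"
    and M: "csubspace M" "closed M" "\<And>i x. x \<in> M \<Longrightarrow> S i x \<in> M" and x: "x \<in> M"
  shows "T x \<in> M"
proof -
  have "cinner (T x) y = 0" if y: "y \<in> orthocompl M" for y
  proof (rule ccontr)
    assume "cinner (T x) y \<noteq> 0"
    then obtain R where R: "R \<in> unital_algebra (range S)" "cmod (cinner (R x) y - cinner (T x) y) < cmod (cinner (T x) y)"
      using wot_algebraD(2)[OF S T, of "{(x, y)}" "cmod (cinner (T x) y)"] by auto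
    have "R x \<in> M" by (rule unital_algebra_invariant[OF R(1) M(1,3) x])
    then show False using R(2) orthocomplD'[OF y] by simp
  qed
  then have "T x \<in> orthocompl (orthocompl M)" by (simp add: orthocompl_def)
  then show ?thesis by (simp add: orthocompl_orthocompl[OF M(1,2)])
qed

text \<open>Invariance of the complement under \<open>S i\<close> is invariance of M under the
  adjoint, so reducing subspaces can be tested on the generators and their adjoints.\<close>

lemma irreducible_wot_algebra_iff:
  fixes S :: "'n \<Rightarrow> 'a :: chilbert_space \<Rightarrow> 'a"
  assumes S: "\<And>i. bounded_clinear (S i)"
  shows "irreducible_algebra (wot_algebra (range S)) \<longleftrightarrow>
    (\<forall>M. csubspace M \<and> closed M \<and> (\<forall>i. \<forall>x\<in>M. S i x \<in> M \<and> cadjoint (S i) x \<in> M) \<longrightarrow> M = {0} \<or> M = UNIV)"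
proof -
  have "reducing (wot_algebra (range S)) M \<longleftrightarrow>
      csubspace M \<and> (\<forall>i. \<forall>x\<in>M. S i x \<in> M \<and> cadjoint (S i) x \<in> M)" if cl: "closed M" for M
  proof
    assume R: "reducing (wot_algebra (range S)) M"
    then have M: "csubspace M" by (simp add: reducing_def)
    have g: "S i \<in> wot_algebra (range S)" for i
      by (intro unital_algebra_subset_wot_algebra S unital_algebra.gen) simp
    have 1: "S i x \<in> M" if "x \<in> M" for i x
      using R g[of i] that unfolding reducing_def invariant_def by blast
    have 2: "S i x \<in> orthocompl M" if "x \<in> orthocompl M" for i x
      using R g[of i] that unfolding reducing_def invariant_def by blast
    have "cadjoint (S i) x \<in> M" if "x \<in> M" for i x
      using orthocompl_invariant'[OF S 2] that unfolding orthocompl_orthocompl[OF M cl] by blast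
    then show "csubspace M \<and> (\<forall>i. \<forall>x\<in>M. S i x \<in> M \<and> cadjoint (S i) x \<in> M)" using M 1 by blast
  next
    assume M: "csubspace M \<and> (\<forall>i. \<forall>x\<in>M. S i x \<in> M \<and> cadjoint (S i) x \<in> M)"
    have "S i x \<in> orthocompl M" if "x \<in> orthocompl M" for i x
      by (rule orthocompl_invariant[OF S _ that]) (use M in blast)
    then have "T x \<in> orthocompl M" if "T \<in> wot_algebra (range S)" "x \<in> orthocompl M" for T x
      using wot_algebra_invariant[OF S that(1) csubspace_orthocompl closed_orthocompl _ that(2)] by blast
    moreover have "T x \<in> M" if "T \<in> wot_algebra (range S)" "x \<in> M" for T x
      using wot_algebra_invariant[OF S that(1) _ cl _ that(2)] M by blast
    ultimately show "reducing (wot_algebra (range S)) M"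
      using M unfolding reducing_def invariant_def by (auto simp: image_subset_iff)
  qed
  then show ?thesis unfolding irreducible_algebra_def by (metis (no_types, lifting))
qed

section \<open>Isometries with orthogonal ranges and minimal dilations\<close>

locale row_isometry =
  fixes S :: "'n :: finite \<Rightarrow> 'h :: chilbert_space \<Rightarrow> 'h"
  assumes isometry_S: "isometry (S i)"
    and orthogonal_S: "i \<noteq> j \<Longrightarrow> cinner (S i x) (S j y) = 0"
begin

abbreviation Sd :: "'n \<Rightarrow> 'h \<Rightarrow> 'h" where "Sd i \<equiv> cadjoint (S i)"

abbreviation W :: "'n list \<Rightarrow> 'h \<Rightarrow> 'h" where "W w \<equiv> word_op S w"

abbreviation Wd :: "'n list \<Rightarrow> 'h \<Rightarrow> 'h" where "Wd w \<equiv> cadjoint (word_op S w)"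

abbreviation algS :: "('h \<Rightarrow> 'h) set" where "algS \<equiv> unital_algebra (range S)"

abbreviation wotS :: "('h \<Rightarrow> 'h) set" where "wotS \<equiv> wot_algebra (range S)"

lemma bounded_clinear_S: "bounded_clinear (S i)"
  by (rule isometry_bounded_clinear[OF isometry_S])

lemma bounded_clinear_Sd: "bounded_clinear (Sd i)"
  by (rule bounded_clinear_cadjoint[OF bounded_clinear_S])

lemma cinner_S: "cinner (S i x) y = cinner x (Sd i y)"
  by (rule cinner_cadjoint[OF bounded_clinear_S])

lemma cinner_Sd: "cinner (Sd i x) y = cinner x (S i y)"
  by (rule cinner_cadjoint_left[OF bounded_clinear_S])

lemma Sd_S: "Sd j (S i x) = (if i = j then x else 0)"
proof (cases "i = j")
  case False
  then have "cinner (Sd j (S i x)) y = cinner 0 y" for y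
    by (simp add: cinner_Sd orthogonal_S cinner.zero_left)
  then have "Sd j (S i x) = 0" by (rule cinner_eqI_left)
  then show ?thesis using False by simp
qed (simp add: isometry_cadjoint[OF isometry_S])

text \<open>The projection onto the wandering space, which is the common kernel of the
  \<open>Sd i\<close>. It is 0 exactly when the ranges of the \<open>S i\<close> span the whole
  space, the Cuntz case.\<close>

definition defect :: "'h \<Rightarrow> 'h" where
  "defect x = x - (\<Sum>i\<in>UNIV. S i (Sd i x))"

lemma bounded_clinear_defect: "bounded_clinear defect"
  unfolding defect_def[abs_def]
  by (intro bounded_clinear_minus_op bounded_clinear_ident bounded_clinear_setsum
      bounded_clinear_compose[OF bounded_clinear_S bounded_clinear_Sd])

lemma Sd_defect: "Sd i (defect x) = 0"
  by (simp add: defect_def bounded_clinearD[OF bounded_clinear_Sd] Sd_S)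

lemma defect_S: "defect (S i x) = 0"
proof -
  have "(\<Sum>j\<in>UNIV. S j (if i = j then x else 0)) = (\<Sum>j\<in>UNIV. if i = j then S i x else 0)"
    by (intro sum.cong) (auto simp: bounded_clinear_zero[OF bounded_clinear_S])
  then show ?thesis by (simp add: defect_def Sd_S)
qed

lemma defect_defect: "defect (defect x) = defect x"
  by (subst defect_def) (simp add: Sd_defect bounded_clinear_zero[OF bounded_clinear_S])

lemma cinner_defect: "cinner (defect x) y = cinner x (defect y)"
  by (simp add: defect_def cinner_simps cinner.sum_left cinner.sum_right cinner_S cinner_Sd[symmetric])

lemma norm_defect: "(norm (defect x))\<^sup>2 = Re (cinner (defect x) x)"
  by (simp add: Re_cinner_self[symmetric] cinner_defect defect_defect)

lemma norm_defect_sum: "(norm (defect x))\<^sup>2 + (\<Sum>i\<in>UNIV. (norm (Sd i x))\<^sup>2) = (norm x)\<^sup>2"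
  unfolding norm_defect by (simp add: defect_def cinner_simps cinner.sum_left cinner_S Re_cinner_self)

lemma bounded_clinear_word_S: "bounded_clinear (W w)"
  by (rule bounded_clinear_word_op[OF bounded_clinear_S])

lemma isometry_word: "isometry (W w)"
  unfolding isometry_def
proof (intro conjI allI bounded_clinear_word_S)
  show "norm (W w x) = norm x" for x
    by (induction w) (simp_all add: word_op_simps isometry_norm[OF isometry_S])
qed

lemma Wd_Cons: "Wd (i # w) x = Wd w (Sd i x)"
  by (rule cadjoint_word_op_Cons[OF bounded_clinear_S])

lemma bounded_clinear_Wd: "bounded_clinear (Wd w)"
  by (rule bounded_clinear_cadjoint[OF bounded_clinear_word_S])

lemma Wd_W: "length u = length w \<Longrightarrow> Wd u (W w x) = (if u = w then x else 0)"
proof (induction u w rule: list_induct2)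
  case (Cons i u j w)
  then show ?case
    by (cases "i = j"; cases "u = w")
      (simp_all add: Wd_Cons word_op_simps(2)[of _ _ _ x] Sd_S bounded_clinear_zero[OF bounded_clinear_Wd])
qed (simp add: word_op_simps(1)[of S x])

lemma sum_words_Wd_le: "(\<Sum>w\<in>words m. (norm (Wd w x))\<^sup>2) \<le> (norm x)\<^sup>2"
proof (induction m arbitrary: x)
  case (Suc m)
  have "(\<Sum>w\<in>words (Suc m). (norm (Wd w x))\<^sup>2) \<le> (\<Sum>i\<in>UNIV. (norm (Sd i x))\<^sup>2)"
    unfolding sum_words_Suc Wd_Cons by (intro sum_mono Suc)
  also have "\<dots> \<le> (norm x)\<^sup>2" using norm_defect_sum[of x] zero_le_power2[of "norm (defect x)"] by linarith
  finally show ?case .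
qed simp

text \<open>The adjoint orbit stays in R, where no mass is lost to the wandering space at any
  step.\<close>

lemma sum_words_Wd_eq:
  assumes R: "\<And>i x. x \<in> R \<Longrightarrow> Sd i x \<in> R" "\<And>x. x \<in> R \<Longrightarrow> defect x = 0" and x: "x \<in> R"
  shows "(\<Sum>w\<in>words m. (norm (Wd w x))\<^sup>2) = (norm x)\<^sup>2"
  using x
proof (induction m arbitrary: x)
  case (Suc m)
  have "(\<Sum>w\<in>words (Suc m). (norm (Wd w x))\<^sup>2) = (\<Sum>i\<in>UNIV. (norm (Sd i x))\<^sup>2)"
    unfolding sum_words_Suc Wd_Cons by (intro sum.cong Suc R refl Suc.prems)
  also have "\<dots> = (norm x)\<^sup>2" using norm_defect_sum[of x] R(2)[OF Suc.prems] by simp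
  finally show ?case .
qed simp

definition gen :: "'h set \<Rightarrow> 'h set" where
  "gen X = closure (cspan {W w x |w x. x \<in> X})"

lemma gen_closed: "csubspace (gen X)" "closed (gen X)"
  unfolding gen_def by (rule closed_csubspace_closure_span)+

lemma word_in_gen: "x \<in> X \<Longrightarrow> W w x \<in> gen X"
  unfolding gen_def by (rule subsetD[OF closure_cspan_superset]) blast

lemma gen_superset: "X \<subseteq> gen X"
  using word_in_gen[of _ X "[]"] by (auto simp: word_op_simps)

lemma gen_subset:
  assumes M: "csubspace M" "closed M" "\<And>i x. x \<in> M \<Longrightarrow> S i x \<in> M" "X \<subseteq> M"
  shows "gen X \<subseteq> M"
proof -
  have "W w x \<in> M" if "x \<in> X" for w x
    by (induction w) (use M(3,4) that in \<open>auto simp: word_op_simps\<close>)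
  then show ?thesis unfolding gen_def using M(1,2) by (intro closure_cspan_minimal) auto
qed

lemma gen_vimage:
  assumes T: "bounded_clinear T" and M: "csubspace M" "closed M"
    and X: "\<And>w x. x \<in> X \<Longrightarrow> T (W w x) \<in> M" and x: "x \<in> gen X"
  shows "T x \<in> M"
proof -
  have "gen X \<subseteq> {x. T x \<in> M}"
    unfolding gen_def using X
    by (intro closure_cspan_minimal csubspace_vimage closed_vimage_bounded_clinear T M) auto
  then show ?thesis using x by blast
qed

lemma S_gen: "x \<in> gen X \<Longrightarrow> S i x \<in> gen X"
proof (rule gen_vimage[OF bounded_clinear_S gen_closed])
  show "S i (W w x) \<in> gen X" if "x \<in> X" for w x
    using word_in_gen[OF that, of "i # w"] by (simp add: word_op_simps)
qed

text \<open>\<open>insert 0\<close> admits both sets X used later: a single wandering vector, which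
  the \<open>Sd i\<close> annihilate, and a subspace that they leave invariant. In either case
  \<open>gen X\<close> is reducing.\<close>

lemma Sd_gen:
  assumes X: "\<And>i x. x \<in> X \<Longrightarrow> Sd i x \<in> insert 0 X" and x: "x \<in> gen X"
  shows "Sd i x \<in> gen X"
proof (rule gen_vimage[OF bounded_clinear_Sd gen_closed _ x])
  fix w x assume x: "x \<in> X"
  show "Sd i (W w x) \<in> gen X"
  proof (cases w)
    case Nil
    then show ?thesis using X[OF x, of i] gen_superset[of X] csubspace_0[OF gen_closed(1)] by (auto simp: word_op_simps)
  next
    case (Cons j u)
    then show ?thesis using word_in_gen[OF x, of u] csubspace_0[OF gen_closed(1)] by (simp add: word_op_simps Sd_S)
  qed
qed

end

section \<open>Minimal isometric dilations\<close>

locale dilation = row_isometry S + finite_row_contraction A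
  for S :: "'n :: finite \<Rightarrow> 'h :: chilbert_space \<Rightarrow> 'h"
    and A :: "'n \<Rightarrow> 'v :: chilbert_space \<Rightarrow> 'v" +
  fixes J :: "'v \<Rightarrow> 'h"
  assumes isometry_J: "isometry J"
    and Sd_J: "cadjoint (S i) (J v) = J (cadjoint (A i) v)"
    and gen_J: "gen (range J) = UNIV"

lemma dilationI:
  assumes "minimal_isometric_dilation A J S" "contractive A" "finite_cdim (UNIV :: 'v :: chilbert_space set)"
  shows "dilation S (A :: 'n :: finite \<Rightarrow> 'v \<Rightarrow> 'v) (J :: 'v \<Rightarrow> 'h :: chilbert_space)"
proof -
  interpret row_isometry S
    using assms(1) by unfold_locales (auto simp: minimal_isometric_dilation_def)
  have "{word_op S w (J v) |w v. True} = {word_op S w x |w x. x \<in> range J}" by auto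
  then have "gen (range J) = UNIV" using assms(1) by (simp add: minimal_isometric_dilation_def gen_def)
  then show ?thesis using assms by unfold_locales (auto simp: minimal_isometric_dilation_def)
qed

context dilation
begin

abbreviation Jd :: "'h \<Rightarrow> 'v" where "Jd \<equiv> cadjoint J"

lemma bounded_clinear_J: "bounded_clinear J"
  by (rule isometry_bounded_clinear[OF isometry_J])

lemma bounded_clinear_Jd: "bounded_clinear Jd"
  by (rule bounded_clinear_cadjoint[OF bounded_clinear_J])

lemma cinner_J: "cinner (J v) x = cinner v (Jd x)"
  by (rule cinner_cadjoint[OF bounded_clinear_J])

lemma cinner_Jd: "cinner (Jd x) v = cinner x (J v)"
  by (rule cinner_cadjoint_left[OF bounded_clinear_J])

lemma Jd_J [simp]: "Jd (J v) = v"
  by (rule isometry_cadjoint[OF isometry_J])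

text \<open>Since \<open>range J\<close> is invariant under the \<open>Sd i\<close>, compression to
  it is multiplicative. This identity carries invariant subspaces and cyclicity between the two
  spaces.\<close>

lemma Jd_S: "Jd (S i x) = A i (Jd x)"
  by (rule cinner_eqI_left) (simp add: cinner_Jd cinner_S Sd_J cinner_A)

lemma gen_J_induct:
  assumes "csubspace M" "closed M" "\<And>i x. x \<in> M \<Longrightarrow> S i x \<in> M" "\<And>v. J v \<in> M"
  shows "x \<in> M"
proof -
  have "gen (range J) \<subseteq> M" by (rule gen_subset[OF assms(1-3)]) (use assms(4) in auto)
  then show ?thesis using gen_J by blast
qed

lemma Jd_defect_J: "Jd (defect (J v)) = v - (\<Sum>i\<in>UNIV. A i (Ad i v))"
  by (simp add: defect_def bounded_clinearD[OF bounded_clinear_Jd] Sd_J Jd_S)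

lemma closed_finite: "csubspace N \<Longrightarrow> closed (N :: 'v set)"
  by (rule closed_finite_cdim[OF _ finite_cdim_subset[OF fin subset_UNIV]])

text \<open>The kernel of the defect is closed and contains the ranges of the \<open>S i\<close>. It
  contains \<open>range J\<close> because the defect is a projection whose form there is the form of
  the defect of A.\<close>

lemma defect_eq_0_if_unital:
  assumes "(\<lambda>x. \<Sum>i\<in>UNIV. A i (Ad i x)) = id"
  shows "defect x = 0"
proof -
  have "x \<in> {x. defect x \<in> {0}}"
  proof (rule gen_J_induct)
    show "csubspace {x. defect x \<in> {0}}"
      by (rule csubspace_vimage[OF bounded_clinear_defect complex_vector.subspace_single_0])
    show "closed {x. defect x \<in> {0}}"
      by (rule closed_vimage_bounded_clinear[OF bounded_clinear_defect]) simp
    fix v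
    have "cinner (defect (J v)) (J v) = cinner (Jd (defect (J v))) v" by (simp add: cinner_Jd)
    also have "Jd (defect (J v)) = 0" using fun_cong[OF assms, of v] by (simp add: Jd_defect_J)
    finally show "J v \<in> {x. defect x \<in> {0}}"
      using norm_defect[of "J v"] by (simp add: cinner.zero_left)
  qed (simp add: defect_S)
  then show ?thesis by simp
qed

text \<open>Removing a word at least as long as u from \<open>W u (J v)\<close> either meets a
  mismatch and gives 0, or uses up u and leaves adjoints acting on \<open>range J\<close>, which
  they preserve.\<close>

lemma Wd_eventually_in_J:
  assumes "y \<in> cspan {W w x |w x. x \<in> range J}"
  shows "\<exists>m0. \<forall>m\<ge>m0. \<forall>w\<in>words m. Wd w y \<in> range J"
proof -
  have J: "csubspace (range J)" by (rule csubspace_image[OF bounded_clinear_J complex_vector.subspace_UNIV])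
  have WJ: "Wd w (J v) \<in> range J" for w v
    by (induction w arbitrary: v) (simp_all add: Wd_Cons Sd_J)
  have WWJ: "Wd w (W u (J v)) \<in> range J" if "length u \<le> length w" for u w v
    using that
  proof (induction u arbitrary: w)
    case Nil then show ?case by (simp add: WJ word_op_simps)
  next
    case (Cons i u)
    then obtain j w' where "w = j # w'" by (cases w) auto
    with Cons show ?case
      using csubspace_0[OF J] by (simp add: Wd_Cons word_op_simps(2)[of _ _ _ "J v"] Sd_S bounded_clinear_zero[OF bounded_clinear_Wd])
  qed
  show ?thesis using assms
  proof (induction rule: complex_vector.span_induct_alt)
    case base
    then show ?case using csubspace_0[OF J] by (simp add: bounded_clinear_zero[OF bounded_clinear_Wd])
  next
    case (step c x y)
    obtain u v where x: "x = W u (J v)" using step.hyps by blast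
    obtain m0 where m0: "\<And>m w. m \<ge> m0 \<Longrightarrow> w \<in> words m \<Longrightarrow> Wd w y \<in> range J"
      using step.IH by blast
    have "Wd w (c *\<^sub>C x + y) \<in> range J" if "m \<ge> max m0 (length u)" "w \<in> words m" for m w
      using that m0[of m w] WWJ[of u w v]
      by (auto simp: bounded_clinearD[OF bounded_clinear_Wd] x words_def intro!: csubspace_add[OF J] csubspace_scale[OF J])
    then show ?case by blast
  qed
qed

text \<open>If the defect vanishes on \<open>R\<close>, the mass of a vector of \<open>R\<close> is spread over its components along words of
  length \<open>m\<close>, which for large \<open>m\<close> are close to the finite-dimensional space \<open>range J\<close>.\<close>

lemma coinvariant_meets_J:
  assumes R: "csubspace R" "closed R" "\<And>i x. x \<in> R \<Longrightarrow> Sd i x \<in> R"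
    "\<And>x. x \<in> R \<Longrightarrow> defect x = 0" and nz: "R \<noteq> {0}"
  shows "\<exists>v. v \<noteq> 0 \<and> J v \<in> R"
proof (rule ccontr)
  assume no: "\<nexists>v. v \<noteq> 0 \<and> J v \<in> R"
  \<comment> \<open>The distance from \<open>J v\<close> to R. It is positive on the unit sphere by
    the assumption to be refuted, and compactness of the sphere turns this into a bound proportional
    to \<open>norm v\<close>.\<close>
  define f where "f v = norm (J v - proj R (J v))" for v
  obtain x where x: "x \<in> R" "norm x = 1" using exists_unit_vector[OF R(1) nz] .
  have "\<exists>d>0. \<forall>v. d * norm v \<le> f v"
  proof (cases "(UNIV :: 'v set) = {0}")
    case True
    then have "norm v = 0" for v :: 'v by (metis UNIV_I norm_zero singletonD)
    then show ?thesis by (intro exI[of _ 1]) (simp add: f_def del: norm_eq_zero)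
  next
    case False
    have cont: "continuous_on {v \<in> UNIV. norm v = 1} f"
      unfolding f_def
      by (intro continuous_intros bounded_clinear_continuous_on[OF bounded_clinear_J]
          bounded_clinear_continuous_on[OF bounded_clinear_compose[OF bounded_clinear_proj[OF R(1,2)] bounded_clinear_J]])
    have ne: "{v \<in> UNIV :: 'v set. norm v = 1} \<noteq> {}"
      using exists_unit_vector[OF complex_vector.subspace_UNIV False] by blast
    obtain u where u: "norm u = 1" "\<And>v. norm v = 1 \<Longrightarrow> f u \<le> f v"
      using continuous_attains_inf[OF compact_unit_sphere[OF complex_vector.subspace_UNIV fin] ne cont] by auto
    have "f u \<noteq> 0"
    proof
      assume "f u = 0"
      then have "J u = proj R (J u)" by (simp add: f_def)
      then have "J u \<in> R" using proj_in[OF R(1,2)] by metis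
      moreover have "u \<noteq> 0" using u(1) by auto
      ultimately show False using no by blast
    qed
    then have fu: "f u > 0" by (simp add: f_def)
    have "f u * norm v \<le> f v" for v
    proof (cases "v = 0")
      case False
      define c where "c = complex_of_real (inverse (norm v))"
      have "f (c *\<^sub>C v) = inverse (norm v) * f v"
        unfolding f_def bounded_clinear_scaleC[OF bounded_clinear_J] bounded_clinear_scaleC[OF bounded_clinear_proj[OF R(1,2)]]
          complex_vector.scale_right_diff_distrib[symmetric] norm_scaleC by (simp add: c_def norm_inverse)
      moreover have "f u \<le> f (c *\<^sub>C v)" using False by (intro u) (simp add: c_def norm_scaleC norm_inverse)
      ultimately show ?thesis using False mult_left_mono[of "f u" "f (c *\<^sub>C v)" "norm v"]
        by (simp add: field_simps)
    qed (simp add: f_def)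
    then show ?thesis using fu by blast
  qed
  then obtain d where d: "d > 0" "\<And>v. d * norm v \<le> f v" by blast
  have fr: "f v \<le> norm (J v - r)" if "r \<in> R" for v r
  proof -
    have "J v - proj R (J v) = (J v - r) - proj R (J v - r)"
      by (simp add: bounded_clinear_diff[OF bounded_clinear_proj[OF R(1,2)]] proj_ident[OF R(1,2) that])
    moreover have "norm ((J v - r) - proj R (J v - r)) \<le> norm (J v - r)"
      by (rule power2_le_imp_le) (use norm_proj_pythagoras[OF R(1,2), of "J v - r"] in auto)
    ultimately show ?thesis by (simp only: f_def)
  qed
  have Rw: "Wd w z \<in> R" if "z \<in> R" for w z
    using that by (induction w arbitrary: z) (simp_all add: Wd_Cons R(3))
  \<comment> \<open>Let y be a finite combination of words applied to \<open>range J\<close> within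
    e of x. For long w the block \<open>Wd w y\<close> lies in \<open>range J\<close> and
    \<open>Wd w x\<close> in R, so the distance bound controls first \<open>Wd w y\<close> and then
    \<open>Wd w x\<close> by their difference. Summing over w leaves only the error e.\<close>
  have bound: "1 \<le> (2 / d\<^sup>2 + 2) * e\<^sup>2" if e: "e > 0" for e
  proof -
    have "x \<in> closure (cspan {W w x |w x. x \<in> range J})" using gen_J by (simp add: gen_def)
    then obtain y where y: "y \<in> cspan {W w x |w x. x \<in> range J}" "dist y x < e"
      using e by (meson closure_approachable)
    obtain m where m: "\<And>w. w \<in> words m \<Longrightarrow> Wd w y \<in> range J"
      using Wd_eventually_in_J[OF y(1)] by blast
    have pt: "(norm (Wd w x))\<^sup>2 \<le> (2 / d\<^sup>2 + 2) * (norm (Wd w (y - x)))\<^sup>2"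
      if w: "w \<in> words m" for w
    proof -
      let ?a = "Wd w x" and ?b = "Wd w y"
      obtain v where v: "?b = J v" using m[OF w] by blast
      have "d * norm ?b \<le> norm (?b - ?a)"
        using order_trans[OF d(2)[of v] fr[OF Rw[OF x(1)], of v w]] by (simp add: v isometry_norm[OF isometry_J])
      then have "norm ?b \<le> norm (?b - ?a) / d" using d(1) by (simp add: field_simps)
      then have 1: "(norm ?b)\<^sup>2 \<le> (norm (?b - ?a))\<^sup>2 / d\<^sup>2"
        using power_mono[of "norm ?b" "norm (?b - ?a) / d" 2] by (simp add: power_divide)
      have "norm ?a \<le> norm ?b + norm (?b - ?a)"
        using norm_triangle_ineq4[of ?b "?b - ?a"] by simp
      then have "(norm ?a)\<^sup>2 \<le> (norm ?b + norm (?b - ?a))\<^sup>2" by (rule power_mono) simp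
      also have "\<dots> \<le> 2 * (norm ?b)\<^sup>2 + 2 * (norm (?b - ?a))\<^sup>2"
        using zero_le_power2[of "norm ?b - norm (?b - ?a)"] unfolding power2_sum power2_diff by linarith
      also have "\<dots> \<le> (2 / d\<^sup>2 + 2) * (norm (?b - ?a))\<^sup>2" using 1 by (simp add: algebra_simps)
      finally show ?thesis by (simp add: bounded_clinear_diff[OF bounded_clinear_Wd])
    qed
    have "1 = (\<Sum>w\<in>words m. (norm (Wd w x))\<^sup>2)"
      using sum_words_Wd_eq[OF R(3,4) x(1), of m] x(2) by simp
    also have "\<dots> \<le> (2 / d\<^sup>2 + 2) * (\<Sum>w\<in>words m. (norm (Wd w (y - x)))\<^sup>2)"
      unfolding sum_distrib_left by (intro sum_mono pt)
    also have "\<dots> \<le> (2 / d\<^sup>2 + 2) * (norm (y - x))\<^sup>2"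
      by (intro mult_left_mono sum_words_Wd_le) simp
    also have "\<dots> \<le> (2 / d\<^sup>2 + 2) * e\<^sup>2"
      using y(2) by (intro mult_left_mono power_mono) (auto simp: dist_norm)
    finally show ?thesis .
  qed
  define c where "c = 2 / d\<^sup>2 + 2"
  have c: "c > 0" by (simp add: c_def add_nonneg_pos)
  \<comment> \<open>For this value of e the bound reads 1 \<le> 1/2.\<close>
  have "sqrt (1 / (2 * c)) > 0" "(sqrt (1 / (2 * c)))\<^sup>2 = 1 / (2 * c)" using c by simp_all
  then have "1 \<le> c * (1 / (2 * c))" using bound[of "sqrt (1 / (2 * c))"] by (simp only: c_def)
  then show False using c by simp
qed

text \<open>Otherwise the complement of K contains some \<open>J u\<close> with u nonzero. But u is
  \<open>Jd k\<close> for some k in K, so |u|^2 is the inner product of k with \<open>J u\<close>,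
  which is 0.\<close>

lemma reducing_eq_UNIV:
  assumes K: "csubspace K" "closed K" "\<And>i x. x \<in> K \<Longrightarrow> S i x \<in> K"
    and d: "\<And>x. x \<in> orthocompl K \<Longrightarrow> defect x = 0" and J: "\<And>v. \<exists>k\<in>K. Jd k = v"
  shows "K = UNIV"
proof (rule ccontr)
  assume "K \<noteq> UNIV"
  then have "orthocompl K \<noteq> {0}" using eq_UNIV_if_orthocompl[OF K(1,2)] by blast
  moreover have inv: "Sd i x \<in> orthocompl K" if "x \<in> orthocompl K" for i x
    by (rule orthocompl_invariant'[OF bounded_clinear_S K(3) that])
  ultimately have "\<exists>u. u \<noteq> 0 \<and> J u \<in> orthocompl K"
    by (intro coinvariant_meets_J csubspace_orthocompl closed_orthocompl inv d)
  then obtain u where u: "u \<noteq> 0" "J u \<in> orthocompl K" by blast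
  obtain k where k: "k \<in> K" "Jd k = u" using J by blast
  have "cinner u u = cinner k (J u)" using k(2) cinner_Jd[of k u] by simp
  then show False using orthocomplD'[OF u(2) k(1)] u(1) by simp
qed

text \<open>The difference D of T and the scalar commutes with the \<open>S i\<close> and their
  adjoints. The vectors \<open>D (J v)\<close> are orthogonal to every word applied to
  \<open>range J\<close>: the adjoint of a letter passes through D back into \<open>range J\<close>,
  and the compression of D is 0. So D vanishes on \<open>range J\<close> and, commuting with the
  \<open>S i\<close>, everywhere.\<close>

lemma commutant_scalar:
  assumes T: "bounded_clinear T" "\<And>i x. T (S i x) = S i (T x)" "\<And>i x. T (Sd i x) = Sd i (T x)"
    and c: "\<And>v. Jd (T (J v)) = c *\<^sub>C v"
  shows "T x = c *\<^sub>C x"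
proof -
  define D where "D x = T x - c *\<^sub>C x" for x
  have D: "bounded_clinear D" unfolding D_def
    by (intro bounded_clinear_minus_op T bounded_clinear_cmul bounded_clinear_ident)
  have SD: "D (S i x) = S i (D x)" "D (Sd i x) = Sd i (D x)" for i x
    by (simp_all add: D_def T bounded_clinearD[OF bounded_clinear_S] bounded_clinearD[OF bounded_clinear_Sd])
  have DJ: "D (J v) = 0" for v
  proof -
    have "y \<in> orthocompl (range (\<lambda>v. D (J v)))" for y
    proof (rule gen_J_induct[OF csubspace_orthocompl closed_orthocompl])
      fix i x assume "x \<in> orthocompl (range (\<lambda>v. D (J v)))"
      then show "S i x \<in> orthocompl (range (\<lambda>v. D (J v)))"
        by (auto simp: orthocompl_def cinner_S SD(2)[symmetric] Sd_J)
    next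
      fix u
      have "Jd (D (J v)) = 0" for v by (simp add: D_def bounded_clinearD[OF bounded_clinear_Jd] c)
      then show "J u \<in> orthocompl (range (\<lambda>v. D (J v)))"
        by (auto simp: orthocompl_def cinner_J cinner.zero_right)
    qed
    from orthocomplD[OF this[of "D (J v)"], of "D (J v)"] show ?thesis by simp
  qed
  have "x \<in> {x. D x \<in> {0}}"
  proof (rule gen_J_induct)
    show "csubspace {x. D x \<in> {0}}" by (rule csubspace_vimage[OF D complex_vector.subspace_single_0])
    show "closed {x. D x \<in> {0}}" by (rule closed_vimage_bounded_clinear[OF D]) simp
    show "S i x \<in> {x. D x \<in> {0}}" if "x \<in> {x. D x \<in> {0}}" for i x
      using that by (simp add: SD(1) bounded_clinear_zero[OF bounded_clinear_S])
    show "J v \<in> {x. D x \<in> {0}}" for v by (simp add: DJ)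
  qed
  then have "D x = 0" by simp
  then show ?thesis by (simp add: D_def)
qed

text \<open>The compression X of T is a fixed point: \<open>A i (X (Ad i v))\<close> is the
  compression of T applied to \<open>S i (Sd i (J v))\<close>, and these vectors sum to
  \<open>J v\<close> because the defect vanishes.\<close>

lemma commutant_scalar_if_fixed_points_scalar:
  assumes unital: "(\<lambda>x. \<Sum>i\<in>UNIV. A i (Ad i x)) = id"
    and scalar: "{X. bounded_clinear X \<and> cp_map A X = X} = {\<lambda>x. c *\<^sub>C x |c. True}"
    and T: "bounded_clinear T" "\<And>i x. T (S i x) = S i (T x)" "\<And>i x. T (Sd i x) = Sd i (T x)"
  shows "\<exists>c. \<forall>x. T x = c *\<^sub>C x"
proof -
  define X where "X v = Jd (T (J v))" for v
  have bX: "bounded_clinear X" unfolding X_def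
    by (intro bounded_clinear_compose[OF bounded_clinear_Jd] bounded_clinear_compose[OF T(1)] bounded_clinear_J)
  have "cp_map A X v = X v" for v
  proof -
    have "A i (X (Ad i v)) = Jd (T (S i (Sd i (J v))))" for i
      by (simp add: X_def Jd_S[symmetric] Sd_J T(2))
    then have "cp_map A X v = Jd (T (\<Sum>i\<in>UNIV. S i (Sd i (J v))))"
      by (simp add: cp_map_def bounded_clinearD[OF bounded_clinear_Jd] bounded_clinearD[OF T(1)])
    also have "(\<Sum>i\<in>UNIV. S i (Sd i (J v))) = J v"
      using defect_eq_0_if_unital[OF unital, of "J v"] by (simp add: defect_def)
    finally show ?thesis by (rule trans[OF _ X_def[symmetric]])
  qed
  then have "cp_map A X = X" by blast
  then have "X \<in> {X. bounded_clinear X \<and> cp_map A X = X}" using bX by blast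
  then obtain c where c: "X = (\<lambda>x. c *\<^sub>C x)" unfolding scalar by blast
  have "T x = c *\<^sub>C x" for x
  proof (rule commutant_scalar[OF T])
    show "Jd (T (J v)) = c *\<^sub>C v" for v using fun_cong[OF c, of v] by (simp only: X_def)
  qed
  then have "\<forall>x. T x = c *\<^sub>C x" by (rule allI)
  then show ?thesis by (rule exI)
qed

end

section \<open>Reducing subspaces and irreducibility\<close>

lemma closed_cspan_singleton: "closed (cspan {w :: 'a :: complex_inner})"
  by (intro closed_finite_cdim finite_cdim_cspan) auto

context row_isometry
begin

lemma reducing_gen:
  assumes "\<And>i x. x \<in> X \<Longrightarrow> Sd i x \<in> insert 0 X"
  shows "csubspace (gen X) \<and> closed (gen X) \<and> (\<forall>i. \<forall>x\<in>gen X. S i x \<in> gen X \<and> Sd i x \<in> gen X)"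
  using gen_closed S_gen Sd_gen[of X, OF assms] by blast

lemma irreducible_gen_eq_UNIV:
  assumes irr: "irreducible_algebra (wotS)"
    and X: "\<And>i x. x \<in> X \<Longrightarrow> Sd i x \<in> insert 0 X" and w: "w \<in> X" "w \<noteq> 0"
  shows "gen X = UNIV"
proof -
  have "gen X = {0} \<or> gen X = UNIV"
    using irr reducing_gen[of X, OF X] unfolding irreducible_wot_algebra_iff[of S, OF bounded_clinear_S] by blast
  then show ?thesis using gen_superset[of X] w by blast
qed

lemma proj_reducing_commute:
  assumes M: "csubspace M" "closed M" "\<And>i x. x \<in> M \<Longrightarrow> S i x \<in> M" "\<And>i x. x \<in> M \<Longrightarrow> Sd i x \<in> M"
  shows "proj M (S i x) = S i (proj M x)" "proj M (Sd i x) = Sd i (proj M x)"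
    "proj M (defect x) = defect (proj M x)"
proof -
  show 1: "proj M (S i x) = S i (proj M x)" for i x
    by (rule proj_commute[OF M(1,2) bounded_clinear_S M(3)])
      (assumption, rule orthocompl_invariant[OF bounded_clinear_S M(4)], assumption+)
  show 2: "proj M (Sd i x) = Sd i (proj M x)" for i x
    by (rule proj_commute[OF M(1,2) bounded_clinear_Sd M(4)])
      (assumption, rule orthocompl_invariant'[OF bounded_clinear_S M(3)], assumption+)
  show "proj M (defect x) = defect (proj M x)"
    by (simp add: defect_def bounded_clinearD[OF bounded_clinear_proj[OF M(1,2)]] 1 2)
qed

lemma proj_scalar_trivial:
  fixes M :: "'h set"
  assumes M: "csubspace M" "closed M" and c: "\<And>x. proj M x = c *\<^sub>C x"
  shows "M = {0} \<or> M = UNIV"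
proof (cases "c = 0")
  case True
  then have "x = 0" if "x \<in> M" for x using c[of x] proj_ident[OF M that] by simp
  then show ?thesis using csubspace_0[OF M(1)] by blast
next
  case False
  have "x \<in> M" for x
  proof -
    have "x = inverse c *\<^sub>C proj M x" using False by (simp add: c scaleC_scaleC)
    then show ?thesis using csubspace_scale[OF M(1) proj_in[OF M]] by metis
  qed
  then show ?thesis by blast
qed

text \<open>A projection onto a reducing subspace commutes with the defect, so it maps w into the
  one-dimensional wandering space. It is then a scalar at w, hence on everything w
  generates.\<close>

lemma irreducible_if_cyclic_wandering_vector:
  assumes w: "defect w = w" "\<And>y. defect y \<in> cspan {w}" "gen {w} = UNIV"
  shows "irreducible_algebra (wotS)"
  unfolding irreducible_wot_algebra_iff[of S, OF bounded_clinear_S]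
proof (intro allI impI)
  fix M assume "csubspace M \<and> closed M \<and> (\<forall>i. \<forall>x\<in>M. S i x \<in> M \<and> Sd i x \<in> M)"
  then have M: "csubspace M" "closed M" "\<And>i x. x \<in> M \<Longrightarrow> S i x \<in> M" "\<And>i x. x \<in> M \<Longrightarrow> Sd i x \<in> M"
    by blast+
  note P = proj_reducing_commute[OF M]
  have "proj M w = defect (proj M w)" using P(3)[of w] by (simp add: w(1))
  then obtain c where c: "proj M w = c *\<^sub>C w"
    using w(2)[of "proj M w"] by (auto simp: complex_vector.span_singleton)
  have "proj M x = c *\<^sub>C x" for x
  proof -
    have D: "bounded_clinear (\<lambda>x. proj M x - c *\<^sub>C x)"
      by (intro bounded_clinear_minus_op bounded_clinear_proj M bounded_clinear_cmul bounded_clinear_ident)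
    have "gen {w} \<subseteq> {x. proj M x - c *\<^sub>C x \<in> {0}}"
    proof (rule gen_subset)
      show "csubspace {x. proj M x - c *\<^sub>C x \<in> {0}}"
        by (rule csubspace_vimage[OF D complex_vector.subspace_single_0])
      show "closed {x. proj M x - c *\<^sub>C x \<in> {0}}"
        by (rule closed_vimage_bounded_clinear[OF D]) simp
      show "S i x \<in> {x. proj M x - c *\<^sub>C x \<in> {0}}" if "x \<in> {x. proj M x - c *\<^sub>C x \<in> {0}}" for i x
        using that by (simp add: P(1) bounded_clinear_scaleC[OF bounded_clinear_S])
      show "{w} \<subseteq> {x. proj M x - c *\<^sub>C x \<in> {0}}" by (simp add: c)
    qed
    then show ?thesis using w(3) by auto
  qed
  then show "M = {0} \<or> M = UNIV" by (rule proj_scalar_trivial[OF M(1,2)])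
qed

lemma irreducible_if_commutant_scalar:
  assumes "\<And>T. bounded_clinear T \<Longrightarrow> (\<And>i x. T (S i x) = S i (T x)) \<Longrightarrow>
    (\<And>i x. T (Sd i x) = Sd i (T x)) \<Longrightarrow> \<exists>c. \<forall>x. T x = c *\<^sub>C x"
  shows "irreducible_algebra (wotS)"
  unfolding irreducible_wot_algebra_iff[of S, OF bounded_clinear_S]
proof (intro allI impI)
  fix M assume "csubspace M \<and> closed M \<and> (\<forall>i. \<forall>x\<in>M. S i x \<in> M \<and> Sd i x \<in> M)"
  then have M: "csubspace M" "closed M" "\<And>i x. x \<in> M \<Longrightarrow> S i x \<in> M" "\<And>i x. x \<in> M \<Longrightarrow> Sd i x \<in> M"
    by blast+
  obtain c where "\<And>x. proj M x = c *\<^sub>C x"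
    using assms[OF bounded_clinear_proj[OF M(1,2)] proj_reducing_commute(1,2)[OF M]] by blast
  then show "M = {0} \<or> M = UNIV" by (rule proj_scalar_trivial[OF M(1,2)])
qed

end

context dilation
begin

text \<open>The preimage of N under \<open>Jd\<close> is closed and invariant under the
  \<open>S i\<close>, so generation of the large space passes down to cyclicity in the small
  one.\<close>

lemma Jd_gen_subset:
  assumes N: "csubspace N" "\<And>i x. x \<in> N \<Longrightarrow> A i x \<in> N" and X: "\<And>x. x \<in> X \<Longrightarrow> Jd x \<in> N"
    and g: "gen X = UNIV"
  shows "N = UNIV"
proof -
  have "gen X \<subseteq> {x. Jd x \<in> N}"
  proof (rule gen_subset)
    show "csubspace {x. Jd x \<in> N}" by (rule csubspace_vimage[OF bounded_clinear_Jd N(1)])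
    show "closed {x. Jd x \<in> N}" by (rule closed_vimage_bounded_clinear[OF bounded_clinear_Jd closed_finite[OF N(1)]])
  qed (auto simp: Jd_S N(2) X)
  then have "Jd (J v) \<in> N" for v using g by blast
  then show ?thesis by auto
qed

text \<open>The converse passage: cyclicity makes the compression of \<open>gen X\<close> all of the
  small space, and \<open>reducing_eq_UNIV\<close> applies.\<close>

lemma gen_eq_UNIV_if_cyclic:
  assumes X: "\<And>i x. x \<in> X \<Longrightarrow> Sd i x \<in> insert 0 X"
    and d: "\<And>x. x \<in> orthocompl (gen X) \<Longrightarrow> defect x = 0"
    and cyc: "\<And>N. csubspace N \<Longrightarrow> (\<And>x. x \<in> X \<Longrightarrow> Jd x \<in> N) \<Longrightarrow> (\<And>i x. x \<in> N \<Longrightarrow> A i x \<in> N) \<Longrightarrow> N = UNIV"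
  shows "gen X = UNIV"
proof (rule reducing_eq_UNIV[OF gen_closed S_gen d])
  have "Jd ` gen X = UNIV"
  proof (rule cyc)
    show "csubspace (Jd ` gen X)" by (rule csubspace_image[OF bounded_clinear_Jd gen_closed(1)])
    show "Jd x \<in> Jd ` gen X" if "x \<in> X" for x using gen_superset that by blast
    show "A i x \<in> Jd ` gen X" if "x \<in> Jd ` gen X" for i x
      using that S_gen[of _ X i] by (auto simp: Jd_S[symmetric])
  qed
  then show "\<exists>k\<in>gen X. Jd k = v" for v by (metis UNIV_I imageE)
qed

lemma cyclic_wandering_vector:
  assumes v: "range (\<lambda>x. x - (\<Sum>i\<in>UNIV. A i (Ad i x))) = cspan {v}" "v \<noteq> 0"
    and cyc: "cyclic_vector (algA) v"
  obtains w where "w \<noteq> 0" "defect w = w" "\<And>y. defect y \<in> cspan {w}" "gen {w} = UNIV"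
proof -
  define D where "D x = x - (\<Sum>i\<in>UNIV. A i (Ad i x))" for x
  have rD: "range D = cspan {v}" using v(1) by (simp only: D_def[abs_def])
  have JD: "Jd (defect (J x)) = D x" for x by (simp add: Jd_defect_J D_def)
  obtain x0 where x0: "v = D x0" using rD complex_vector.span_base[of v "{v}"] by blast
  define w where "w = defect (J x0)"
  have Jw: "Jd w = v" by (simp add: w_def JD x0)
  have w0: "w \<noteq> 0" using v(2) Jw bounded_clinear_zero[OF bounded_clinear_Jd] by metis
  have dw: "defect w = w" by (simp add: w_def defect_defect)
  have one: "defect y \<in> cspan {w}" for y
  proof -
    have "y \<in> {y. defect y \<in> cspan {w}}"
    proof (rule gen_J_induct)
      show "csubspace {y. defect y \<in> cspan {w}}"
        by (rule csubspace_vimage[OF bounded_clinear_defect complex_vector.subspace_span])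
      show "closed {y. defect y \<in> cspan {w}}"
        by (rule closed_vimage_bounded_clinear[OF bounded_clinear_defect closed_cspan_singleton])
      show "S i x \<in> {y. defect y \<in> cspan {w}}" for i x by (simp add: defect_S complex_vector.span_zero)
      fix u
      obtain c where c: "D u = c *\<^sub>C v" using rD by (metis complex_vector.span_singleton rangeE rangeI)
      \<comment> \<open>Chosen so that its compressed defect is 0. Since z lies in
        \<open>range J\<close>, the form of the defect vanishes at z, and a projection with
        vanishing form annihilates the vector.\<close>
      define z where "z = J u - c *\<^sub>C J x0"
      have z: "z = J (u - c *\<^sub>C x0)" by (simp add: z_def bounded_clinearD[OF bounded_clinear_J])
      have "Jd (defect z) = D u - c *\<^sub>C D x0"
        by (simp add: z_def bounded_clinearD[OF bounded_clinear_defect] bounded_clinearD[OF bounded_clinear_Jd] JD)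
      then have "Jd (defect z) = 0" using c x0 by simp
      then have "cinner (defect z) z = 0" using cinner_Jd[of "defect z" "u - c *\<^sub>C x0"]
        by (simp add: z cinner.zero_left)
      then have "defect z = 0" using norm_defect[of z] by simp
      then have "defect (J u) = c *\<^sub>C w" by (simp add: z_def w_def bounded_clinearD[OF bounded_clinear_defect])
      then show "J u \<in> {y. defect y \<in> cspan {w}}"
        by (simp add: complex_vector.span_scale complex_vector.span_base)
    qed
    then show ?thesis by simp
  qed
  have Sdw: "Sd i w = 0" for i using Sd_defect[of i w] by (simp add: dw)
  have "gen {w} = UNIV"
  proof (rule gen_eq_UNIV_if_cyclic)
    fix x assume x: "x \<in> orthocompl (gen {w})"
    obtain c where c: "defect x = c *\<^sub>C w" using one[of x] by (auto simp: complex_vector.span_singleton)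
    have "cinner (defect x) w = cinner x w" by (simp add: cinner_defect dw)
    also have "\<dots> = 0" by (rule orthocomplD[OF x]) (use gen_superset in blast)
    finally show "defect x = 0" using w0 by (simp add: c cinner_simps)
  next
    fix N assume "csubspace N" "\<And>x. x \<in> {w} \<Longrightarrow> Jd x \<in> N" "\<And>i x. x \<in> N \<Longrightarrow> A i x \<in> N"
    then show "N = UNIV"
      using cyc Jw unfolding cyclic_vector_iff[of A, OF bounded_clinear_A] by auto
  qed (simp add: Sdw)
  then show ?thesis using that w0 dw one by blast
qed

text \<open>Irreducibility makes a nonzero wandering vector, or the image of a nonzero subspace
  invariant under the adjoints, generate the whole space. Compressing back to the small space turns
  this into cyclicity.\<close>

lemma irreducible_imp:
  assumes irr: "irreducible_algebra (wotS)" and nz: "(UNIV :: 'v set) \<noteq> {0}"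
  shows "(\<exists>v. range (\<lambda>x. x - (\<Sum>i\<in>UNIV. A i (Ad i x))) = cspan {v} \<and> v \<noteq> 0 \<and>
              cyclic_vector (algA) v) \<or>
           ((\<lambda>x. \<Sum>i\<in>UNIV. A i (Ad i x)) = id \<and>
              (\<exists>V\<^sub>0. minimal_invariant (cadjoint ` algA) V\<^sub>0 \<and>
                 cyclic_subspace (algA) V\<^sub>0))"
proof (cases "\<exists>x. x - (\<Sum>i\<in>UNIV. A i (Ad i x)) \<noteq> 0")
  case True
  define D where "D x = x - (\<Sum>i\<in>UNIV. A i (Ad i x))" for x
  have JD: "Jd (defect (J x)) = D x" for x by (simp add: Jd_defect_J D_def)
  obtain x0 where x0: "D x0 \<noteq> 0" using True by (auto simp: D_def)
  define w where "w = defect (J x0)"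
  define v where "v = D x0"
  have Jw: "Jd w = v" by (simp add: w_def v_def JD)
  have w0: "w \<noteq> 0" using x0 Jw bounded_clinear_zero[OF bounded_clinear_Jd] v_def by metis
  have dw: "defect w = w" by (simp add: w_def defect_defect)
  have Sdw: "Sd i w = 0" for i using Sd_defect[of i w] by (simp add: dw)
  have g: "gen {w} = UNIV" by (rule irreducible_gen_eq_UNIV[OF irr _ _ w0]) (auto simp: Sdw)
  have one: "defect y \<in> cspan {w}" for y
  proof -
    have "gen {w} \<subseteq> {y. defect y \<in> cspan {w}}"
    proof (rule gen_subset)
      show "csubspace {y. defect y \<in> cspan {w}}"
        by (rule csubspace_vimage[OF bounded_clinear_defect complex_vector.subspace_span])
      show "closed {y. defect y \<in> cspan {w}}"
        by (rule closed_vimage_bounded_clinear[OF bounded_clinear_defect closed_cspan_singleton])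
    qed (simp_all add: defect_S complex_vector.span_zero dw complex_vector.span_base)
    then show ?thesis using g by blast
  qed
  have "range D = cspan {v}"
  proof
    show "range D \<subseteq> cspan {v}"
    proof
      fix z assume "z \<in> range D"
      then obtain x where "z = Jd (defect (J x))" by (auto simp: JD)
      moreover obtain c where "defect (J x) = c *\<^sub>C w"
        using one[of "J x"] by (auto simp: complex_vector.span_singleton)
      ultimately have "z = c *\<^sub>C v" by (simp add: bounded_clinear_scaleC[OF bounded_clinear_Jd] Jw)
      then show "z \<in> cspan {v}" by (simp add: complex_vector.span_scale complex_vector.span_base)
    qed
    have "bounded_clinear D" unfolding D_def[abs_def] by (rule defect_hermitian(1))
    then have "csubspace (range D)" by (rule csubspace_image[OF _ complex_vector.subspace_UNIV])
    then show "cspan {v} \<subseteq> range D" by (intro complex_vector.span_minimal) (auto simp: v_def)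
  qed
  moreover have "cyclic_vector (algA) v"
    unfolding cyclic_vector_iff[of A, OF bounded_clinear_A]
  proof (intro allI impI)
    fix N assume "csubspace N \<and> v \<in> N \<and> (\<forall>i. \<forall>x\<in>N. A i x \<in> N)"
    then show "N = UNIV" by (intro Jd_gen_subset[OF _ _ _ g]) (auto simp: Jw)
  qed
  ultimately show ?thesis using x0 unfolding D_def[abs_def] v_def by blast
next
  case False
  then have unital: "(\<lambda>x. \<Sum>i\<in>UNIV. A i (Ad i x)) = id" by (auto simp: fun_eq_iff)
  obtain V where m: "minimal_invariant (cadjoint ` algA) V"
    using minimal_invariant_exists[of A, OF bounded_clinear_A fin nz] by blast
  note V = minimal_invariant_cadjointD[of A, OF bounded_clinear_A m]
  obtain x where x: "x \<in> V" "x \<noteq> 0" using V(2) csubspace_0[OF V(1)] by blast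
  have "J x \<noteq> 0" using x(2) isometry_norm[OF isometry_J, of x] by auto
  then have g: "gen (J ` V) = UNIV"
    by (rule irreducible_gen_eq_UNIV[OF irr, rotated 2]) (use V(3) x(1) in \<open>auto simp: Sd_J\<close>)
  have "cyclic_subspace (algA) V"
    unfolding cyclic_subspace_iff[of A, OF bounded_clinear_A]
  proof (intro allI impI)
    fix N assume "csubspace N \<and> V \<subseteq> N \<and> (\<forall>i. \<forall>x\<in>N. A i x \<in> N)"
    then show "N = UNIV" by (intro Jd_gen_subset[OF _ _ _ g]) auto
  qed
  then show ?thesis using unital m by blast
qed

lemma irreducible_iff:
  assumes nz: "(UNIV :: 'v set) \<noteq> {0}"
  shows "irreducible_algebra (wotS) \<longleftrightarrow>
           (\<exists>v. range (\<lambda>x. x - (\<Sum>i\<in>UNIV. A i (Ad i x))) = cspan {v} \<and> v \<noteq> 0 \<and>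
              cyclic_vector (algA) v) \<or>
           ((\<lambda>x. \<Sum>i\<in>UNIV. A i (Ad i x)) = id \<and>
              (\<exists>V\<^sub>0. minimal_invariant (cadjoint ` algA) V\<^sub>0 \<and>
                 cyclic_subspace (algA) V\<^sub>0))" (is "?I \<longleftrightarrow> ?C1 \<or> ?C2")
proof (intro iffI, rule irreducible_imp[OF _ nz], assumption, elim disjE)
  assume ?C1
  then obtain v where v: "range (\<lambda>x. x - (\<Sum>i\<in>UNIV. A i (Ad i x))) = cspan {v}" "v \<noteq> 0"
    "cyclic_vector (algA) v" by blast
  obtain w where "defect w = w" "\<And>y. defect y \<in> cspan {w}" "gen {w} = UNIV"
    by (rule cyclic_wandering_vector[OF v]) blast
  then show ?I by (rule irreducible_if_cyclic_wandering_vector)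
next
  assume C2: ?C2
  then have unital: "(\<lambda>x. \<Sum>i\<in>UNIV. A i (Ad i x)) = id" by blast
  have "{X. bounded_clinear X \<and> cp_map A X = X} = {\<lambda>x. c *\<^sub>C x |c. True}"
    using C2 fixed_points_scalar_iff[OF nz] by (rule iffD1[rotated])
  from commutant_scalar_if_fixed_points_scalar[OF unital this]
  show ?I by (rule irreducible_if_commutant_scalar)
qed

end

lemma bessel:
  assumes F: "finite F" and e: "\<And>i j. i \<in> F \<Longrightarrow> j \<in> F \<Longrightarrow> cinner (e i) (e j) = (if i = j then 1 else 0)"
  shows "(\<Sum>i\<in>F. (cmod (cinner x (e i)))\<^sup>2) \<le> (norm x)\<^sup>2"
proof -
  define y where "y = (\<Sum>i\<in>F. cinner x (e i) *\<^sub>C e i)"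
  have ye: "cinner y (e j) = cinner x (e j)" if "j \<in> F" for j
  proof -
    have "cinner y (e j) = (\<Sum>i\<in>F. if i = j then cinner x (e i) else 0)"
      unfolding y_def cinner.sum_left using e that by (intro sum.cong) (auto simp: cinner_simps)
    then show ?thesis using F that by simp
  qed
  have xy: "cinner x y = of_real (\<Sum>i\<in>F. (cmod (cinner x (e i)))\<^sup>2)"
    unfolding y_def cinner.sum_right of_real_sum
    by (intro sum.cong refl) (simp add: cinner_simps complex_norm_square mult.commute del: of_real_power)
  have "cinner z y = (\<Sum>i\<in>F. cnj (cinner x (e i)) * cinner z (e i))" for z
    unfolding y_def cinner.sum_right by (simp add: cinner_simps)
  then have yy: "cinner y y = cinner x y" using ye by simp
  have "cinner (x - y) y = 0" using yy by (simp add: cinner_simps)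
  then have "(norm (x - y + y))\<^sup>2 = (norm (x - y))\<^sup>2 + (norm y)\<^sup>2" by (rule norm_pythagoras)
  then have "(norm y)\<^sup>2 \<le> (norm x)\<^sup>2" by simp
  moreover have "(norm y)\<^sup>2 = (\<Sum>i\<in>F. (cmod (cinner x (e i)))\<^sup>2)"
    using arg_cong[OF yy, of Re] xy by (simp add: Re_cinner_self)
  ultimately show ?thesis by simp
qed

lemma ell2_eqI: "(\<And>i. ell2_coeff f i = ell2_coeff g i) \<Longrightarrow> f = g"
  by (simp add: ell2_coeff_inject[symmetric] fun_eq_iff)

lemma cinner_ell2_basis: "cinner f (ell2_basis i) = ell2_coeff f i"
proof -
  have "cinner f (ell2_basis i) = (\<Sum>\<^sub>\<infinity>j\<in>{i}. ell2_coeff f j)"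
    unfolding cinner_ell2_def by (rule infsum_cong_neutral) (auto simp: ell2_coeff_basis)
  then show ?thesis by simp
qed

section \<open>Coordinates and intertwiners\<close>

definition coords :: "('i \<Rightarrow> 'a :: complex_inner) \<Rightarrow> 'a \<Rightarrow> 'i ell2" where
  "coords e x = Abs_ell2 (\<lambda>i. cinner x (e i))"

text \<open>Zero vectors are allowed as padding: the index type of the model space is larger than
  the set of coordinates in use, and the range of \<open>coords e\<close> then consists of the
  families vanishing at the padded indices.\<close>

locale orthonormal_family =
  fixes e :: "'i \<Rightarrow> 'a :: chilbert_space"
  assumes orthogonal: "i \<noteq> j \<Longrightarrow> cinner (e i) (e j) = 0"
    and norm_e: "e i = 0 \<or> norm (e i) = 1"
begin

lemma cinner_e: "e i \<noteq> 0 \<Longrightarrow> cinner (e i) (e i) = 1"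
  using norm_e[of i] by (simp add: cinner_self)

lemma sum_le: "finite F \<Longrightarrow> (\<Sum>i\<in>F. (cmod (cinner x (e i)))\<^sup>2) \<le> (norm x)\<^sup>2"
proof -
  assume F: "finite F"
  have "(\<Sum>i\<in>F. (cmod (cinner x (e i)))\<^sup>2) = (\<Sum>i\<in>{i\<in>F. e i \<noteq> 0}. (cmod (cinner x (e i)))\<^sup>2)"
    using F by (intro sum.mono_neutral_right) (auto simp: cinner.zero_right)
  also have "\<dots> \<le> (norm x)\<^sup>2"
    using F by (intro bessel) (auto simp: cinner_e orthogonal)
  finally show ?thesis .
qed

lemma square_summable_coords: "square_summable (\<lambda>i. cinner x (e i))"
  unfolding square_summable_def
  by (rule nonneg_bdd_above_summable_on) (auto intro!: bdd_aboveI[of _ "(norm x)\<^sup>2"] sum_le)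

lemma ell2_coeff_coords: "ell2_coeff (coords e x) i = cinner x (e i)"
  by (simp add: coords_def Abs_ell2_inverse square_summable_coords)

lemma bounded_clinear_coords: "bounded_clinear (coords e)"
proof (rule bounded_clinearI[of _ 1])
  fix x y c
  show "coords e (x + y) = coords e x + coords e y" "coords e (c *\<^sub>C x) = c *\<^sub>C coords e x"
    by (rule ell2_eqI, simp add: ell2_coeff_coords plus_ell2.rep_eq scaleC_ell2.rep_eq cinner_simps)+
  have "(norm (coords e x))\<^sup>2 \<le> (norm x)\<^sup>2"
    unfolding power2_norm_ell2 ell2_coeff_coords
    by (rule infsum_le_finite_sums) (use square_summable_coords in \<open>auto simp: square_summable_def sum_le\<close>)
  then show "norm (coords e x) \<le> norm x * 1" unfolding mult_1_right by (rule power2_le_imp_le) simp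
qed

lemma cinner_cadjoint_coords: "cinner (cadjoint (coords e) f) (e i) = (if e i = 0 then 0 else ell2_coeff f i)"
proof (cases "e i = 0")
  case False
  have "coords e (e i) = ell2_basis i"
  proof (rule ell2_eqI)
    have "cinner (e i) (e i) = 1" using False norm_e[of i] by (simp add: cinner_self)
    then show "ell2_coeff (coords e (e i)) j = ell2_coeff (ell2_basis i) j" for j
      using orthogonal[of i j] by (simp add: ell2_coeff_coords ell2_coeff_basis)
  qed
  then show ?thesis
    using False by (simp add: cinner_cadjoint_left[OF bounded_clinear_coords] cinner_ell2_basis)
qed (simp add: cinner.zero_right)

lemma coords_cadjoint_coords:
  "ell2_coeff (coords e (cadjoint (coords e) f)) i = (if e i = 0 then 0 else ell2_coeff f i)"
  by (simp add: ell2_coeff_coords cinner_cadjoint_coords)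

lemma range_coords:
  "range (coords e) = {f. \<forall>i. e i = 0 \<longrightarrow> ell2_coeff f i = 0}"
proof
  show "range (coords e) \<subseteq> {f. \<forall>i. e i = 0 \<longrightarrow> ell2_coeff f i = 0}"
    by (auto simp: ell2_coeff_coords cinner.zero_right)
  show "{f. \<forall>i. e i = 0 \<longrightarrow> ell2_coeff f i = 0} \<subseteq> range (coords e)"
  proof safe
    fix f assume f: "\<forall>i. e i = 0 \<longrightarrow> ell2_coeff f i = 0"
    have "coords e (cadjoint (coords e) f) = f"
      by (rule ell2_eqI) (use f in \<open>simp add: coords_cadjoint_coords\<close>)
    then show "f \<in> range (coords e)" by (metis rangeI)
  qed
qed

lemma cadjoint_coords_basis: "cadjoint (coords e) (ell2_basis i) = e i"
proof (rule cinner_eqI)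
  fix x
  have "cinner x (cadjoint (coords e) (ell2_basis i)) = cinner (coords e x) (ell2_basis i)"
    by (rule cinner_cadjoint[OF bounded_clinear_coords, symmetric])
  then show "cinner x (cadjoint (coords e) (ell2_basis i)) = cinner x (e i)"
    by (simp add: cinner_ell2_basis ell2_coeff_coords)
qed

lemma cadjoint_coords_coords:
  assumes total: "closure (cspan (range e)) = UNIV"
  shows "cadjoint (coords e) (coords e x) = x"
proof -
  define D where "D x = cadjoint (coords e) (coords e x) - x" for x
  have D: "bounded_clinear D" unfolding D_def
    by (intro bounded_clinear_minus_op bounded_clinear_ident bounded_clinear_coords
        bounded_clinear_compose[OF bounded_clinear_cadjoint[OF bounded_clinear_coords] bounded_clinear_coords])
  have "closure (cspan (range e)) \<subseteq> {x. D x \<in> {0}}"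
  proof (rule closure_cspan_minimal)
    show "csubspace {x. D x \<in> {0}}" by (rule csubspace_vimage[OF D complex_vector.subspace_single_0])
    show "closed {x. D x \<in> {0}}" by (rule closed_vimage_bounded_clinear[OF D]) simp
    have "coords e (e i) = (if e i = 0 then 0 else ell2_basis i)" for i
      by (rule ell2_eqI)
        (use orthogonal[of i] norm_e[of i] in \<open>auto simp: ell2_coeff_coords ell2_coeff_basis cinner_self
          cinner.zero_left zero_ell2.rep_eq\<close>)
    then have "D (e i) = 0" for i
      by (simp add: D_def cadjoint_coords_basis
          bounded_clinear_zero[OF bounded_clinear_cadjoint[OF bounded_clinear_coords]])
    then show "range e \<subseteq> {x. D x \<in> {0}}" by auto
  qed
  then have "D x = 0" using total by blast
  then show ?thesis by (simp add: D_def)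
qed

lemma isometry_coords:
  assumes total: "closure (cspan (range e)) = UNIV"
  shows "isometry (coords e)"
  unfolding isometry_def
proof (intro conjI allI bounded_clinear_coords)
  fix x
  have "cinner (coords e x) (coords e x) = cinner x x"
    by (simp add: cinner_cadjoint[OF bounded_clinear_coords] cadjoint_coords_coords[OF total])
  then have "(norm (coords e x))\<^sup>2 = (norm x)\<^sup>2" by (metis Re_cinner_self)
  then show "norm (coords e x) = norm x" by (simp add: power2_eq_iff_nonneg)
qed

end

lemma isometry_if_inner:
  assumes T: "bounded_clinear T" and "\<And>x. cinner (T x) (T x) = cinner x x"
  shows "isometry T"
  unfolding isometry_def
proof (intro conjI allI T)
  fix x
  have "(norm (T x))\<^sup>2 = (norm x)\<^sup>2" using assms(2)[of x] by (metis Re_cinner_self)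
  then show "norm (T x) = norm x" by (simp add: power2_eq_iff_nonneg)
qed

lemma isometry_creation: "isometry (creation i)"
proof -
  have n: "norm (creation i f) = norm f" for f
  proof -
    have "(norm (creation i f))\<^sup>2 = (\<Sum>\<^sub>\<infinity>w\<in>range (Cons i). (cmod (ell2_coeff (creation i f) w))\<^sup>2)"
      unfolding power2_norm_ell2
      by (rule infsum_cong_neutral) (auto simp: ell2_coeff_creation split: list.split)
    also have "\<dots> = (\<Sum>\<^sub>\<infinity>w. (cmod (ell2_coeff f w))\<^sup>2)"
      by (subst infsum_reindex) (auto simp: o_def ell2_coeff_creation)
    finally have "(norm (creation i f))\<^sup>2 = (norm f)\<^sup>2" by (simp add: power2_norm_ell2)
    then show ?thesis by (simp add: power2_eq_iff_nonneg)
  qed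
  have "bounded_clinear (creation i)"
  proof (rule bounded_clinearI[of _ 1])
    show "creation i (x + y) = creation i x + creation i y" for x y
      by (rule ell2_eqI) (simp add: ell2_coeff_creation plus_ell2.rep_eq split: list.split)
    show "creation i (c *\<^sub>C x) = c *\<^sub>C creation i x" for c x
      by (rule ell2_eqI) (simp add: ell2_coeff_creation scaleC_ell2.rep_eq split: list.split)
  qed (simp add: n)
  then show ?thesis by (simp add: isometry_def n)
qed

lemma bounded_clinear_creation: "bounded_clinear (creation i)"
  by (rule isometry_bounded_clinear[OF isometry_creation])

lemma ell2_coeff_cadjoint_creation: "ell2_coeff (cadjoint (creation i) f) w = ell2_coeff f (i # w)"
  by (metis cinner_ell2_basis cinner_cadjoint_left[OF bounded_clinear_creation] creation_basis)

text \<open>The order of quantifiers matters: Q is the same polynomial as R in the other tuple, so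
  one Q serves all intertwiners V at once. This is what makes a polynomial act identically on all
  copies of the Fock space.\<close>

lemma intertwine_unital_algebra:
  fixes S :: "'n \<Rightarrow> 'a :: complex_inner \<Rightarrow> 'a" and L :: "'n \<Rightarrow> 'b :: complex_inner \<Rightarrow> 'b"
  assumes "R \<in> unital_algebra (range S)"
  shows "\<exists>Q\<in>unital_algebra (range L). \<forall>V. bounded_clinear V \<and> (\<forall>i x. S i (V x) = V (L i x)) \<longrightarrow>
    (\<forall>x. R (V x) = V (Q x))"
  using assms
proof induction
  case (gen T)
  then obtain i where "T = S i" by blast
  then show ?case by (intro bexI[of _ "L i"] unital_algebra.gen) auto
next
  case one
  show ?case by (rule bexI[OF _ unital_algebra.one]) simp
next
  case (add T R)
  then obtain T' R' where "T' \<in> unital_algebra (range L)" "R' \<in> unital_algebra (range L)"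
    "\<forall>V. bounded_clinear V \<and> (\<forall>i x. S i (V x) = V (L i x)) \<longrightarrow> (\<forall>x. T (V x) = V (T' x))"
    "\<forall>V. bounded_clinear V \<and> (\<forall>i x. S i (V x) = V (L i x)) \<longrightarrow> (\<forall>x. R (V x) = V (R' x))" by blast
  then show ?case
    by (intro bexI[of _ "\<lambda>x. T' x + R' x"] unital_algebra.add) (simp_all add: bounded_clinear_add)
next
  case (scale T c)
  then obtain T' where "T' \<in> unital_algebra (range L)"
    "\<forall>V. bounded_clinear V \<and> (\<forall>i x. S i (V x) = V (L i x)) \<longrightarrow> (\<forall>x. T (V x) = V (T' x))" by blast
  then show ?case
    by (intro bexI[of _ "\<lambda>x. c *\<^sub>C T' x"] unital_algebra.scale) (simp_all add: bounded_clinear_scaleC)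
next
  case (mult T R)
  then obtain T' R' where "T' \<in> unital_algebra (range L)" "R' \<in> unital_algebra (range L)"
    "\<forall>V. bounded_clinear V \<and> (\<forall>i x. S i (V x) = V (L i x)) \<longrightarrow> (\<forall>x. T (V x) = V (T' x))"
    "\<forall>V. bounded_clinear V \<and> (\<forall>i x. S i (V x) = V (L i x)) \<longrightarrow> (\<forall>x. R (V x) = V (R' x))" by blast
  then show ?case
    by (intro bexI[of _ "T' \<circ> R'"] unital_algebra.mult) simp_all
qed

lemma intertwine_unital_algebra':
  fixes S :: "'n \<Rightarrow> 'a :: complex_inner \<Rightarrow> 'a" and L :: "'n \<Rightarrow> 'b :: complex_inner \<Rightarrow> 'b"
  assumes "Q \<in> unital_algebra (range L)"
  shows "\<exists>R\<in>unital_algebra (range S). \<forall>V. bounded_clinear V \<and> (\<forall>i x. S i (V x) = V (L i x)) \<longrightarrow>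
    (\<forall>x. R (V x) = V (Q x))"
  using assms
proof induction
  case (gen T)
  then obtain i where "T = L i" by blast
  then show ?case by (intro bexI[of _ "S i"] unital_algebra.gen) auto
next
  case one
  show ?case by (rule bexI[OF _ unital_algebra.one]) simp
next
  case (add T R)
  then obtain T' R' where "T' \<in> unital_algebra (range S)" "R' \<in> unital_algebra (range S)"
    "\<forall>V. bounded_clinear V \<and> (\<forall>i x. S i (V x) = V (L i x)) \<longrightarrow> (\<forall>x. T' (V x) = V (T x))"
    "\<forall>V. bounded_clinear V \<and> (\<forall>i x. S i (V x) = V (L i x)) \<longrightarrow> (\<forall>x. R' (V x) = V (R x))" by blast
  then show ?case
    by (intro bexI[of _ "\<lambda>x. T' x + R' x"] unital_algebra.add) (simp_all add: bounded_clinear_add)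
next
  case (scale T c)
  then obtain T' where "T' \<in> unital_algebra (range S)"
    "\<forall>V. bounded_clinear V \<and> (\<forall>i x. S i (V x) = V (L i x)) \<longrightarrow> (\<forall>x. T' (V x) = V (T x))" by blast
  then show ?case
    by (intro bexI[of _ "\<lambda>x. c *\<^sub>C T' x"] unital_algebra.scale) (simp_all add: bounded_clinear_scaleC)
next
  case (mult T R)
  then obtain T' R' where "T' \<in> unital_algebra (range S)" "R' \<in> unital_algebra (range S)"
    "\<forall>V. bounded_clinear V \<and> (\<forall>i x. S i (V x) = V (L i x)) \<longrightarrow> (\<forall>x. T' (V x) = V (T x))"
    "\<forall>V. bounded_clinear V \<and> (\<forall>i x. S i (V x) = V (L i x)) \<longrightarrow> (\<forall>x. R' (V x) = V (R x))" by blast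
  then show ?case
    by (intro bexI[of _ "T' \<circ> R'"] unital_algebra.mult) simp_all
qed

lemma intertwine_unital_algebraE:
  fixes S :: "'n \<Rightarrow> 'a :: complex_inner \<Rightarrow> 'a" and L :: "'n \<Rightarrow> 'b :: complex_inner \<Rightarrow> 'b"
  assumes "R \<in> unital_algebra (range S)"
  obtains Q where "Q \<in> unital_algebra (range L)"
    "\<And>V x. bounded_clinear V \<Longrightarrow> (\<And>i x. S i (V x) = V (L i x)) \<Longrightarrow> R (V x) = V (Q x)"
  using intertwine_unital_algebra[OF assms, of L] by auto

lemma intertwine_unital_algebraE':
  fixes S :: "'n \<Rightarrow> 'a :: complex_inner \<Rightarrow> 'a" and L :: "'n \<Rightarrow> 'b :: complex_inner \<Rightarrow> 'b"
  assumes "Q \<in> unital_algebra (range L)"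
  obtains R where "R \<in> unital_algebra (range S)"
    "\<And>V x. bounded_clinear V \<Longrightarrow> (\<And>i x. S i (V x) = V (L i x)) \<Longrightarrow> R (V x) = V (Q x)"
  using intertwine_unital_algebra'[OF assms, of S] by auto

lemma wot_algebraI:
  assumes "\<And>i. bounded_clinear (S i)" "bounded_clinear T"
    "\<And>F e. finite F \<Longrightarrow> e > 0 \<Longrightarrow>
      \<exists>R\<in>unital_algebra (range S). \<forall>(x, y)\<in>F. cmod (cinner (R x) y - cinner (T x) y) < e"
  shows "T \<in> wot_algebra (range S)"
proof -
  have S: "\<And>T. T \<in> range S \<Longrightarrow> bounded_clinear T" using assms(1) by blast
  show ?thesis using assms(2,3) by (intro iffD2[OF in_wot_algebra_iff[OF S]]) auto
qed

text \<open>On the range of V a polynomial in S acts as the same polynomial in L, so each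
  approximation of matrix coefficients of T restricts to one of the compression.\<close>

lemma wot_algebra_compress:
  fixes S :: "'n \<Rightarrow> 'a :: chilbert_space \<Rightarrow> 'a" and L :: "'n \<Rightarrow> 'b :: chilbert_space \<Rightarrow> 'b"
  assumes S: "\<And>i. bounded_clinear (S i)" and L: "\<And>i. bounded_clinear (L i)"
    and V: "isometry V" "\<And>i x. S i (V x) = V (L i x)" and T: "T \<in> wot_algebra (range S)"
  shows "(\<lambda>x. cadjoint V (T (V x))) \<in> wot_algebra (range L)"
proof (rule wot_algebraI[OF L])
  have bV: "bounded_clinear V" by (rule isometry_bounded_clinear[OF V(1)])
  show "bounded_clinear (\<lambda>x. cadjoint V (T (V x)))"
    by (intro bounded_clinear_compose[OF bounded_clinear_cadjoint[OF bV]]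
        bounded_clinear_compose[OF wot_algebraD(1)[OF S T] bV])
  fix F :: "('b \<times> 'b) set" and e :: real assume F: "finite F" "e > 0"
  obtain R where R: "R \<in> unital_algebra (range S)"
    "\<forall>(x, y)\<in>(\<lambda>(x, y). (V x, V y)) ` F. cmod (cinner (R x) y - cinner (T x) y) < e"
    using wot_algebraD(2)[OF S T finite_imageI[OF F(1)] F(2)] by blast
  obtain Q where Q: "Q \<in> unital_algebra (range L)" "\<And>x. R (V x) = V (Q x)"
    using intertwine_unital_algebra[OF R(1), of L] bV V(2) by blast
  have "cmod (cinner (Q x) y - cinner (cadjoint V (T (V x))) y) < e" if "(x, y) \<in> F" for x y
  proof -
    have "cinner (R (V x)) (V y) = cinner (Q x) y" by (simp add: Q(2) isometry_cinner[OF V(1)])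
    then show ?thesis using R(2) that by (force simp: cinner_cadjoint_left[OF bV])
  qed
  then show "\<exists>R\<in>unital_algebra (range L). \<forall>(x, y)\<in>F. cmod (cinner (R x) y - cinner (cadjoint V (T (V x))) y) < e"
    using Q(1) by blast
qed

lemma unitarily_equivalent_wot_algebra:
  fixes S :: "'n \<Rightarrow> 'a :: chilbert_space \<Rightarrow> 'a" and L :: "'n \<Rightarrow> 'b :: chilbert_space \<Rightarrow> 'b"
  assumes S: "\<And>i. bounded_clinear (S i)" and L: "\<And>i. bounded_clinear (L i)"
    and U: "isometry U" "range U = UNIV" "\<And>i x. U (S i x) = L i (U x)"
  shows "unitarily_equivalent (wot_algebra (range S)) UNIV (wot_algebra (range L))"
proof -
  have bU: "bounded_clinear U" by (rule isometry_bounded_clinear[OF U(1)])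
  have UdU: "cadjoint U (U x) = x" for x by (rule isometry_cadjoint[OF U(1)])
  have UUd: "U (cadjoint U y) = y" for y
  proof -
    obtain x where "y = U x" using U(2) by blast
    then show ?thesis by (simp add: UdU)
  qed
  have iUd: "isometry (cadjoint U)"
  proof (rule isometry_if_inner[OF bounded_clinear_cadjoint[OF bU]])
    show "cinner (cadjoint U x) (cadjoint U x) = cinner x x" for x
      by (simp add: cinner_cadjoint_left[OF bU] UUd)
  qed
  have SUd: "S i (cadjoint U x) = cadjoint U (L i x)" for i x
    by (metis U(3) UUd UdU)
  have "(\<lambda>T. U \<circ> T) ` wot_algebra (range S) = (\<lambda>X. X \<circ> U) ` wot_algebra (range L)"
  proof
    show "(\<lambda>T. U \<circ> T) ` wot_algebra (range S) \<subseteq> (\<lambda>X. X \<circ> U) ` wot_algebra (range L)"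
    proof safe
      fix T assume T: "T \<in> wot_algebra (range S)"
      from wot_algebra_compress[OF S L iUd SUd T]
      have X: "(\<lambda>x. U (T (cadjoint U x))) \<in> wot_algebra (range L)" by (simp add: cadjoint_cadjoint[OF bU])
      show "U \<circ> T \<in> (\<lambda>X. X \<circ> U) ` wot_algebra (range L)"
        by (rule image_eqI[OF _ X]) (simp add: fun_eq_iff UdU)
    qed
    show "(\<lambda>X. X \<circ> U) ` wot_algebra (range L) \<subseteq> (\<lambda>T. U \<circ> T) ` wot_algebra (range S)"
    proof safe
      fix X assume X: "X \<in> wot_algebra (range L)"
      have T: "(\<lambda>x. cadjoint U (X (U x))) \<in> wot_algebra (range S)"
        by (rule wot_algebra_compress[OF L S U(1) _ X]) (simp add: U(3))
      show "X \<circ> U \<in> (\<lambda>T. U \<circ> T) ` wot_algebra (range S)"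
        by (rule image_eqI[OF _ T]) (simp add: fun_eq_iff UUd)
    qed
  qed
  then show ?thesis unfolding unitarily_equivalent_def using U(1,2) by blast
qed

section \<open>Orbits of wandering vectors\<close>

context row_isometry
begin

text \<open>Common first letters are cancelled by isometry and different ones give orthogonal
  vectors. When one word is used up before the other, the wandering hypotheses apply.\<close>

lemma cinner_wandering:
  assumes x: "\<And>i u. cinner (S i (W u x)) y = 0" and y: "\<And>i u. cinner x (S i (W u y)) = 0"
  shows "cinner (W u x) (W w y) = (if u = w then cinner x y else 0)"
proof (induction u arbitrary: w)
  case Nil
  then show ?case using y by (cases w) (simp_all add: word_op_simps)
next
  case (Cons i u)
  show ?case
  proof (cases w)
    case Nil then show ?thesis using x by (simp add: word_op_simps)
  next
    case (Cons j v)
    have "cinner (S i (W u x)) (S j (W v y)) =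
        (if i = j then cinner (W u x) (W v y) else 0)"
      using orthogonal_S[of i j] isometry_cinner[OF isometry_S] by auto
    then show ?thesis using Cons.IH[of v] Cons by (auto simp: word_op_simps)
  qed
qed

text \<open>The words applied to the normalized w form an orthonormal basis indexed by words, and
  the coordinates with respect to it carry each \<open>S i\<close> to the corresponding creation
  operator.\<close>

lemma unitarily_equivalent_free_semigroup_algebra:
  assumes w: "w \<noteq> 0" "\<And>i. Sd i w = 0" "gen {w} = UNIV"
  shows "unitarily_equivalent (wotS) UNIV
    (free_semigroup_algebra :: ('n list ell2 \<Rightarrow> 'n list ell2) set)"
proof -
  define x where "x = of_real (inverse (norm w)) *\<^sub>C w"
  have x1: "norm x = 1" using w(1) by (simp add: x_def norm_scaleC norm_inverse)
  have Sdx: "Sd i x = 0" for i by (simp add: x_def bounded_clinear_scaleC[OF bounded_clinear_Sd] w(2))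
  define e where "e u = W u x" for u
  have ee: "cinner (e u) (e v) = (if u = v then 1 else 0)" for u v
  proof -
    have "cinner (S i (W u x)) x = 0" "cinner x (S i (W u x)) = 0" for i u
      by (simp_all add: cinner_S cinner_Sd[symmetric] Sdx cinner.zero_left cinner.zero_right)
    then show ?thesis unfolding e_def by (subst cinner_wandering) (auto simp: cinner_self x1)
  qed
  have ne: "norm (e u) = 1" for u by (simp add: e_def isometry_norm[OF isometry_word] x1)
  interpret e: orthonormal_family e by unfold_locales (auto simp: ee ne)
  have e0: "e u \<noteq> 0" for u using ne[of u] by auto
  have total: "closure (cspan (range e)) = UNIV"
  proof -
    have "gen {w} \<subseteq> closure (cspan (range e))"
      unfolding gen_def
    proof (rule closure_cspan_minimal)
      show "{W u y |u y. y \<in> {w}} \<subseteq> closure (cspan (range e))"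
      proof safe
        fix u
        have "w = of_real (norm w) *\<^sub>C x" using w(1) by (simp add: x_def scaleC_scaleC flip: of_real_mult)
        then have "W u w = of_real (norm w) *\<^sub>C e u"
          using bounded_clinear_scaleC[OF bounded_clinear_word_S, of u "of_real (norm w)" x] by (simp add: e_def)
        moreover have "of_real (norm w) *\<^sub>C e u \<in> cspan (range e)"
          by (intro complex_vector.span_scale complex_vector.span_base) simp
        ultimately show "W u w \<in> closure (cspan (range e))" using closure_subset by force
      qed
    qed (use closed_csubspace_closure_span in auto)
    then show ?thesis using w(3) by blast
  qed
  show ?thesis
    unfolding free_semigroup_algebra_def
  proof (rule unitarily_equivalent_wot_algebra[OF bounded_clinear_S bounded_clinear_creation])
    show "isometry (coords e)" by (rule e.isometry_coords[OF total])
    show "range (coords e) = UNIV" unfolding e.range_coords by (simp add: e0)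
    show "coords e (S i y) = creation i (coords e y)" for i y
    proof (rule ell2_eqI)
      fix u
      show "ell2_coeff (coords e (S i y)) u = ell2_coeff (creation i (coords e y)) u"
      proof (cases u)
        case Nil
        then show ?thesis
          by (simp add: e.ell2_coeff_coords ell2_coeff_creation e_def cinner_S word_op_simps Sdx cinner.zero_right)
      next
        case (Cons j v)
        then show ?thesis
          by (simp add: e.ell2_coeff_coords ell2_coeff_creation e_def cinner_S word_op_simps Sd_S cinner.zero_right)
      qed
    qed
  qed
qed

end

section \<open>Amplification inside a Cuntz tuple\<close>

lemma finite_UN_words: "finite (\<Union>k<n. words k :: 'n :: finite list set)"
  by (rule finite_UN_I[OF finite_lessThan finite_words])

lemma word_op_append: "word_op T (u @ w) x = word_op T u (word_op T w x)"
  by (induction u) (simp_all add: word_op_simps)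

lemma sum_UN_words: "(\<Sum>u\<in>(\<Union>k<n. words k). f u) = (\<Sum>k<n. \<Sum>u\<in>words k. f (u :: 'n :: finite list))"
  by (rule sum.UNION_disjoint) (simp, simp, auto simp: words_def)

context row_isometry
begin

text \<open>The direct sum of copies of T indexed by the words of length m, when x is read as the
  family of its blocks \<open>Wd w x\<close>. In the Cuntz case these blocks determine x, so this is
  the full amplification, realized on the original space.\<close>

definition amp :: "nat \<Rightarrow> ('h \<Rightarrow> 'h) \<Rightarrow> 'h \<Rightarrow> 'h" where
  "amp m T x = (\<Sum>w\<in>words m. W w (T (Wd w x)))"

lemma bounded_clinear_amp: "bounded_clinear T \<Longrightarrow> bounded_clinear (amp m T)"
  unfolding amp_def[abs_def]
  by (intro bounded_clinear_setsum bounded_clinear_compose[OF bounded_clinear_word_S]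
      bounded_clinear_compose[OF _ bounded_clinear_Wd])

lemma Wd_amp:
  assumes "u \<in> words m"
  shows "Wd u (amp m T x) = T (Wd u x)"
proof -
  have "Wd u (amp m T x) =
      (\<Sum>w\<in>words m. if w = u then T (Wd u x) else 0)"
    unfolding amp_def bounded_clinear_sum[OF bounded_clinear_Wd]
    using assms by (intro sum.cong) (auto simp: Wd_W words_def)
  then show ?thesis using assms by simp
qed

lemma cinner_word: "cinner (W w x) y = cinner x (Wd w y)"
  by (rule cinner_cadjoint[OF bounded_clinear_word_S])

lemma cinner_amp:
  "cinner (amp m T x) y = (\<Sum>w\<in>words m. cinner (T (Wd w x)) (Wd w y))"
  by (simp add: amp_def cinner.sum_left cinner_word)

lemma cadjoint_amp:
  assumes T: "bounded_clinear T"
  shows "cadjoint (amp m T) = amp m (cadjoint T)"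
proof (rule cadjoint_unique[OF bounded_clinear_amp[OF T]])
  show "cinner (amp m T x) y = cinner x (amp m (cadjoint T) y)" for x y
  proof -
    have "cinner x (amp m (cadjoint T) y) =
        (\<Sum>w\<in>words m. cinner (Wd w x) (cadjoint T (Wd w y)))"
      by (simp add: amp_def cinner.sum_right cinner_cadjoint_left[OF bounded_clinear_word_S])
    then show ?thesis by (simp add: cinner_amp cinner_cadjoint[OF T])
  qed
qed

lemma amp_amp: "amp m T (amp m R x) = amp m (\<lambda>x. T (R x)) x"
  unfolding amp_def[of m T] amp_def[of m "\<lambda>x. T (R x)"] by (intro sum.cong) (simp_all add: Wd_amp)

end

text \<open>\<open>V\<close> is the image of the minimal invariant subspace \<open>V\<^sub>0\<close> of case (2) in the space of the dilation.\<close>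

locale irreducible_cuntz = row_isometry S
  for S :: "'n :: finite \<Rightarrow> 'h :: chilbert_space \<Rightarrow> 'h" +
  fixes V :: "'h set"
  assumes defect_0: "defect x = 0"
    and V: "csubspace V" and fin_V: "finite_cdim V" and V_nz: "V \<noteq> {0}"
    and Sd_V: "x \<in> V \<Longrightarrow> cadjoint (S i) x \<in> V"
    and min_V: "csubspace N \<Longrightarrow> N \<noteq> {0} \<Longrightarrow> (\<And>i x. x \<in> N \<Longrightarrow> cadjoint (S i) x \<in> N) \<Longrightarrow> N \<subseteq> V \<Longrightarrow> N = V"
    and commutant: "bounded_clinear T \<Longrightarrow> (\<And>i x. T (S i x) = S i (T x)) \<Longrightarrow>
      (\<And>i x. T (cadjoint (S i) x) = cadjoint (S i) (T x)) \<Longrightarrow> \<exists>c. \<forall>x. T x = c *\<^sub>C x"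
begin

lemma closed_V: "closed V"
  by (rule closed_finite_cdim[OF V fin_V])

lemma S_orthocompl_V: "x \<in> orthocompl V \<Longrightarrow> S i x \<in> orthocompl V"
  by (rule orthocompl_invariant[OF bounded_clinear_S Sd_V])

lemma word_orthocompl_V: "x \<in> orthocompl V \<Longrightarrow> W w x \<in> orthocompl V"
  by (induction w) (simp_all add: word_op_simps S_orthocompl_V)

lemma Wd_V: "x \<in> V \<Longrightarrow> Wd w x \<in> V"
  by (induction w arbitrary: x) (simp_all add: Wd_Cons Sd_V)

lemma sum_S_Sd: "(\<Sum>i\<in>UNIV. S i (Sd i x)) = x"
  using defect_0[of x] by (simp add: defect_def)

lemma amp_ident: "amp m (\<lambda>x. x) x = x"
proof (induction m arbitrary: x)
  case 0 then show ?case by (simp add: amp_def word_op_simps(1)[of S x] word_op_simps(1)[of S "Wd [] x"])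
next
  case (Suc m)
  have "amp (Suc m) (\<lambda>x. x) x = (\<Sum>i\<in>UNIV. S i (amp m (\<lambda>x. x) (Sd i x)))"
    by (simp only: amp_def sum_words_Suc Wd_Cons word_op_simps(2) bounded_clinear_sum[OF bounded_clinear_S])
  then show ?case by (simp add: Suc sum_S_Sd)
qed

lemma amp_eqI:
  assumes "\<And>w. w \<in> words m \<Longrightarrow> Wd w x = Wd w y"
  shows "x = y"
proof -
  have "amp m (\<lambda>x. x) x = amp m (\<lambda>x. x) y" unfolding amp_def using assms by (intro sum.cong) auto
  then show ?thesis by (simp add: amp_ident)
qed

lemma row_isometry_amp: "row_isometry (\<lambda>i. amp m (S i))"
proof
  fix i
  show "isometry (amp m (S i))"
  proof (rule isometry_if_inner[OF bounded_clinear_amp[OF bounded_clinear_S]])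
    show "cinner (amp m (S i) x) (amp m (S i) x) = cinner x x" for x
      by (simp add: cinner_cadjoint[OF bounded_clinear_amp[OF bounded_clinear_S]] cadjoint_amp[OF bounded_clinear_S]
          amp_amp Sd_S amp_ident)
  qed
next
  fix i j :: 'n and x y assume ij: "i \<noteq> j"
  have "Sd i (S j z) = 0" for z using ij by (simp add: Sd_S)
  then have "amp m (\<lambda>x. Sd i (S j x)) y = 0"
    by (simp add: amp_def bounded_clinear_zero[OF bounded_clinear_word_S])
  then show "cinner (amp m (S i) x) (amp m (S j) y) = 0"
    by (simp add: cinner_cadjoint[OF bounded_clinear_amp[OF bounded_clinear_S]] cadjoint_amp[OF bounded_clinear_S]
        amp_amp cinner.zero_right)
qed

lemma word_op_amp: "word_op (\<lambda>i. amp m (S i)) u x = amp m (W u) x"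
proof (induction u)
  case Nil
  have "W [] = (\<lambda>x. x)" by (simp add: word_op_Nil id_def)
  then show ?case by (simp add: amp_ident word_op_simps(1)[of "\<lambda>i. amp m (S i)" x])
next
  case (Cons i u)
  have "W (i # u) = (\<lambda>x. S i (W u x))" by (simp add: word_op_Cons o_def)
  then show ?case using Cons by (simp add: word_op_simps(2)[of "\<lambda>i. amp m (S i)" i u x] amp_amp)
qed

abbreviation P :: "'h \<Rightarrow> 'h" where "P \<equiv> proj V"

lemmas P_in = proj_in[OF V closed_V]
  and P_orth = proj_orth[OF V closed_V]
  and P_ident = proj_ident[OF V closed_V]
  and P_0 = proj_0[OF V closed_V]
  and cinner_P = cinner_proj[OF V closed_V]
  and bounded_clinear_P = bounded_clinear_proj[OF V closed_V]

text \<open>The complement of V is invariant under the tuple, so compression to V is multiplicative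
  on words.\<close>

lemma P_word_P: "P (W u (P x)) = P (W u x)"
proof -
  have "P (W u (x - P x)) = 0"
    by (intro P_0 word_orthocompl_V P_orth)
  then show ?thesis by (simp add: bounded_clinear_diff[OF bounded_clinear_word_S] bounded_clinear_diff[OF bounded_clinear_P])
qed

text \<open>A vector of \<open>V\<close> whose orbit under the compressed tuple is square summable vanishes: such vectors form
  an invariant subspace, and it is not all of \<open>V\<close> because the trace of \<open>\<Phi>\<^sup>k (I) = I\<close> does not tend to \<open>0\<close>.\<close>

lemma square_summable_orbit_zero:
  assumes x: "x \<in> V" and bd: "\<And>F. finite F \<Longrightarrow> (\<Sum>u\<in>F. (norm (P (W u x)))\<^sup>2) \<le> B"
  shows "x = 0"
proof -
  define N where "N = {x \<in> V. \<exists>B. \<forall>F. finite F \<longrightarrow> (\<Sum>u\<in>F. (norm (P (W u x)))\<^sup>2) \<le> B}"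
  have bW: "bounded_clinear (\<lambda>x. P (W u x))" for u
    by (intro bounded_clinear_compose[OF bounded_clinear_P bounded_clinear_word_S])
  have cN: "csubspace N"
  proof (rule csubspaceI)
    show "0 \<in> N"
      by (auto simp: N_def csubspace_0[OF V] bounded_clinear_zero[OF bW] intro!: exI[of _ 0])
    fix x y c assume x: "x \<in> N"
    then obtain B where B: "\<And>F. finite F \<Longrightarrow> (\<Sum>u\<in>F. (norm (P (W u x)))\<^sup>2) \<le> B"
      by (auto simp: N_def)
    have "(\<Sum>u\<in>F. (norm (P (W u (c *\<^sub>C x))))\<^sup>2) \<le> (cmod c)\<^sup>2 * B" if "finite F" for F
      using mult_left_mono[OF B[OF that], of "(cmod c)\<^sup>2"]
      by (simp add: bounded_clinear_scaleC[OF bW] norm_scaleC power_mult_distrib sum_distrib_left)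
    then show "c *\<^sub>C x \<in> N" using x by (auto simp: N_def csubspace_scale[OF V])
    assume y: "y \<in> N"
    then obtain B' where B': "\<And>F. finite F \<Longrightarrow> (\<Sum>u\<in>F. (norm (P (W u y)))\<^sup>2) \<le> B'"
      by (auto simp: N_def)
    have "(\<Sum>u\<in>F. (norm (P (W u (x + y))))\<^sup>2) \<le> 2 * B + 2 * B'" if F: "finite F" for F
    proof -
      have "(norm (P (W u (x + y))))\<^sup>2 \<le> 2 * (norm (P (W u x)))\<^sup>2 + 2 * (norm (P (W u y)))\<^sup>2" for u
      proof -
        let ?a = "P (W u x)" and ?b = "P (W u y)"
        have "(norm (?a + ?b))\<^sup>2 \<le> (norm ?a + norm ?b)\<^sup>2" by (intro power_mono norm_triangle_ineq norm_ge_zero)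
        also have "\<dots> \<le> 2 * (norm ?a)\<^sup>2 + 2 * (norm ?b)\<^sup>2"
          using zero_le_power2[of "norm ?a - norm ?b"] unfolding power2_sum power2_diff by linarith
        finally show ?thesis by (simp add: bounded_clinear_add[OF bW])
      qed
      then have "(\<Sum>u\<in>F. (norm (P (W u (x + y))))\<^sup>2) \<le>
          (\<Sum>u\<in>F. 2 * (norm (P (W u x)))\<^sup>2 + 2 * (norm (P (W u y)))\<^sup>2)"
        by (intro sum_mono)
      also have "\<dots> = 2 * (\<Sum>u\<in>F. (norm (P (W u x)))\<^sup>2) + 2 * (\<Sum>u\<in>F. (norm (P (W u y)))\<^sup>2)"
        by (simp add: sum.distrib sum_distrib_left)
      finally show ?thesis using B[OF F] B'[OF F] by linarith
    qed
    then show "x + y \<in> N" using x y by (auto simp: N_def csubspace_add[OF V])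
  qed
  have NV: "N \<subseteq> V" by (auto simp: N_def)
  \<comment> \<open>Appending a letter on the right is injective on words, so the orbit sums of
    \<open>P (S i x)\<close> are partial sums of the orbit of x.\<close>
  have PSN: "P (S i x) \<in> N" if x: "x \<in> N" for i x
  proof -
    obtain B where B: "\<And>F. finite F \<Longrightarrow> (\<Sum>u\<in>F. (norm (P (W u x)))\<^sup>2) \<le> B"
      using x by (auto simp: N_def)
    have "(\<Sum>u\<in>F. (norm (P (W u (P (S i x)))))\<^sup>2) \<le> B" if F: "finite F" for F
    proof -
      have "P (W u (P (S i x))) = P (W (u @ [i]) x)" for u
        unfolding P_word_P by (simp add: word_op_append[of S u "[i]" x] word_op_simps(2)[of S i "[]" x] word_op_simps(1)[of S x])
      then have "(\<Sum>u\<in>F. (norm (P (W u (P (S i x)))))\<^sup>2) = (\<Sum>u\<in>(\<lambda>u. u @ [i]) ` F. (norm (P (W u x)))\<^sup>2)"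
        by (subst sum.reindex) (auto simp: inj_on_def)
      also have "\<dots> \<le> B" using F by (intro B) simp
      finally show ?thesis .
    qed
    then show ?thesis by (auto simp: N_def P_in)
  qed
  \<comment> \<open>Invariant under the adjoints, so minimality makes it 0 or V. The trace count
    excludes 0, and then N itself is 0.\<close>
  define N' where "N' = V \<inter> orthocompl N"
  have cN': "csubspace N'"
    unfolding N'_def by (intro complex_vector.subspace_inter V csubspace_orthocompl)
  have SdN': "Sd i y \<in> N'" if y: "y \<in> N'" for i y
  proof -
    have "cinner (Sd i y) z = 0" if z: "z \<in> N" for z
    proof -
      have "cinner (Sd i y) z = cinner (P y) (S i z)"
        using y by (simp add: cinner_Sd N'_def P_ident)
      also have "\<dots> = cinner y (P (S i z))" by (rule cinner_P)
      also have "\<dots> = 0" using y by (intro orthocomplD[OF _ PSN[OF z]]) (simp add: N'_def)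
      finally show ?thesis .
    qed
    then show ?thesis using y Sd_V by (auto simp: N'_def orthocompl_def)
  qed
  have "N' \<noteq> {0}"
  proof
    assume N'0: "N' = {0}"
    have fN: "finite_cdim N" by (rule finite_cdim_subset[OF fin_V NV])
    note clN = closed_finite_cdim[OF cN fN]
    have "V \<subseteq> N"
    proof
      fix x assume x: "x \<in> V"
      have "x - proj N x \<in> N'" unfolding N'_def
        using x NV proj_in[OF cN clN] proj_orth[OF cN clN] csubspace_diff[OF V] by blast
      then show "x \<in> N" using N'0 proj_in[OF cN clN, of x] by simp
    qed
    obtain E where E: "finite E" "orthonormal E" "cspan E = V" "card E = cdim V"
      using orthonormal_basis_exists[OF V fin_V] .
    have EV: "v \<in> V" if "v \<in> E" for v using that E(3) complex_vector.span_base by blast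
    have "\<exists>B. \<forall>F. finite F \<longrightarrow> (\<Sum>u\<in>F. (norm (P (W u v)))\<^sup>2) \<le> B" if "v \<in> E" for v
      using EV[OF that] \<open>V \<subseteq> N\<close> by (auto simp: N_def)
    then obtain B where B: "\<And>v F. v \<in> E \<Longrightarrow> finite F \<Longrightarrow> (\<Sum>u\<in>F. (norm (P (W u v)))\<^sup>2) \<le> B v"
      by metis
    have parseval: "(norm z)\<^sup>2 = (\<Sum>v\<in>E. (cmod (cinner z v))\<^sup>2)" if "z \<in> V" for z
      by (rule orthonormal_parseval[OF E(1,2)]) (simp add: E(3) that)
    \<comment> \<open>A Hilbert-Schmidt norm may be computed from the adjoint. On that side each
      basis vector spreads its unit mass over the words of length k, so every level contributes the
      dimension of V, and a uniform bound over all levels is impossible.\<close>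
    have level: "(\<Sum>u\<in>words k. \<Sum>v\<in>E. (norm (P (W u v)))\<^sup>2) = card E" for k
    proof -
      have "(\<Sum>v\<in>E. (norm (P (W u v)))\<^sup>2) = (\<Sum>v\<in>E. (norm (Wd u v))\<^sup>2)" for u
      proof -
        have "(\<Sum>v\<in>E. (norm (P (W u v)))\<^sup>2) = (\<Sum>v\<in>E. \<Sum>v'\<in>E. (cmod (cinner (P (W u v)) v'))\<^sup>2)"
          by (intro sum.cong refl parseval P_in)
        also have "\<dots> = (\<Sum>v\<in>E. \<Sum>v'\<in>E. (cmod (cinner (Wd u v') v))\<^sup>2)"
        proof (intro sum.cong refl)
          fix v v' assume "v' \<in> E"
          then have "cinner (P (W u v)) v' = cinner (W u v) v'"
            by (simp add: cinner_P P_ident EV)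
          also have "\<dots> = cnj (cinner (Wd u v') v)"
            unfolding cinner_word by (rule cinner_commute)
          finally show "(cmod (cinner (P (W u v)) v'))\<^sup>2 = (cmod (cinner (Wd u v') v))\<^sup>2"
            by simp
        qed
        also have "\<dots> = (\<Sum>v'\<in>E. \<Sum>v\<in>E. (cmod (cinner (Wd u v') v))\<^sup>2)" by (rule sum.swap)
        also have "\<dots> = (\<Sum>v'\<in>E. (norm (Wd u v'))\<^sup>2)"
          by (intro sum.cong refl parseval[symmetric] Wd_V EV)
        finally show ?thesis .
      qed
      then have "(\<Sum>u\<in>words k. \<Sum>v\<in>E. (norm (P (W u v)))\<^sup>2) =
          (\<Sum>v\<in>E. \<Sum>u\<in>words k. (norm (Wd u v))\<^sup>2)"
        by (simp add: sum.swap[of _ E])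
      also have "\<dots> = (\<Sum>v\<in>E. (norm v)\<^sup>2)"
        using sum_words_Wd_eq[of UNIV] defect_0 by simp
      also have "\<dots> = (\<Sum>v\<in>E. 1)"
      proof (intro sum.cong refl)
        fix v assume "v \<in> E"
        then have "cinner v v = 1" using E(2) by (simp add: orthonormal_def)
        then show "(norm v)\<^sup>2 = 1" by (metis Re_cinner_self one_complex.sel(1))
      qed
      finally show ?thesis by simp
    qed
    have bound: "real n * real (card E) \<le> sum B E" for n
    proof -
      have "real n * real (card E) = (\<Sum>k<n. \<Sum>u\<in>words k. \<Sum>v\<in>E. (norm (P (W u v)))\<^sup>2)"
        by (simp add: level)
      also have "\<dots> = (\<Sum>v\<in>E. \<Sum>u\<in>(\<Union>k<n. words k). (norm (P (W u v)))\<^sup>2)"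
        unfolding sum_UN_words[symmetric] by (rule sum.swap)
      also have "\<dots> \<le> sum B E" by (intro sum_mono B finite_UN_words)
      finally show ?thesis .
    qed
    have "card E > 0"
      using E(1,3) V_nz by (metis card_gt_0_iff complex_vector.span_empty)
    then obtain n where "sum B E < real n * real (card E)"
      using reals_Archimedean3[of "real (card E)"] by auto
    then show False using bound[of n] by simp
  qed
  then have "N' = V" using min_V[OF cN' _ SdN'] by (simp add: N'_def)
  moreover have "x \<in> N" using x bd by (auto simp: N_def)
  ultimately have "cinner x x = 0" using x orthocomplD[of x N x] by (auto simp: N'_def)
  then show ?thesis by simp
qed

end

context row_isometry
begin

lemma orthocompl_genI:
  assumes "\<And>w x. x \<in> X \<Longrightarrow> cinner y (W w x) = 0"
  shows "y \<in> orthocompl (gen X)"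
proof -
  have "gen X \<subseteq> orthocompl {y}"
    unfolding gen_def
  proof (rule closure_cspan_minimal)
    show "{W w x |w x. x \<in> X} \<subseteq> orthocompl {y}"
      using assms cinner_sym_0[of y] by (auto simp: orthocompl_def)
  qed (rule csubspace_orthocompl closed_orthocompl)+
  then show ?thesis using cinner_sym_0[of y] by (auto simp: orthocompl_def)
qed

text \<open>The condition on \<open>amp m id\<close> covers the unit of the algebra: for a general
  row isometry it is only the projection onto the sum of the ranges of the words of length
  m.\<close>

lemma amp_unital_algebra_invariant:
  assumes K: "csubspace K" "\<And>i x. x \<in> K \<Longrightarrow> amp m (S i) x \<in> K" "\<And>x. x \<in> K \<Longrightarrow> amp m id x \<in> K"
    and R: "R \<in> algS" and x: "x \<in> K"
  shows "amp m R x \<in> K"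
  using R x
proof (induction arbitrary: x)
  case (gen T) then show ?case using K(2) by auto
next
  case one then show ?case by (rule K(3))
next
  case (add T R)
  have "amp m (\<lambda>x. T x + R x) x = amp m T x + amp m R x"
    by (simp add: amp_def bounded_clinear_add[OF bounded_clinear_word_S] sum.distrib)
  then show ?case using add csubspace_add[OF K(1)] by simp
next
  case (scale T c)
  have "amp m (\<lambda>x. c *\<^sub>C T x) x = c *\<^sub>C amp m T x"
    by (simp add: amp_def bounded_clinear_scaleC[OF bounded_clinear_word_S] complex_vector.scale_sum_right)
  then show ?case using scale csubspace_scale[OF K(1)] by simp
next
  case (mult T R)
  have "amp m (T \<circ> R) x = amp m T (amp m R x)" unfolding amp_amp o_def ..
  moreover have "amp m T (amp m R x) \<in> K" using mult by blast
  ultimately show ?case by (simp only:)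
qed

lemma csubspace_amp_orbit: "csubspace {amp m R x |R. R \<in> algS}"
proof (rule csubspaceI)
  have z: "amp m (\<lambda>x. c *\<^sub>C T x) x = c *\<^sub>C amp m T x" for c T
    by (simp add: amp_def bounded_clinear_scaleC[OF bounded_clinear_word_S] complex_vector.scale_sum_right)
  have p: "amp m (\<lambda>x. T x + R x) x = amp m T x + amp m R x" for T R
    by (simp add: amp_def bounded_clinear_add[OF bounded_clinear_word_S] sum.distrib)
  have "(\<lambda>x. 0 *\<^sub>C id x) \<in> algS" by (intro unital_algebra.scale unital_algebra.one)
  moreover have "0 = amp m (\<lambda>x. 0 *\<^sub>C id x) x"
    using trans[OF z[of 0 id] complex_vector.scale_zero_left] by (rule sym)
  ultimately show "0 \<in> {amp m R x |R. R \<in> algS}" by blast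
  fix u v c assume "u \<in> {amp m R x |R. R \<in> algS}"
  then obtain R where R: "R \<in> algS" "u = amp m R x" by blast
  show "c *\<^sub>C u \<in> {amp m R x |R. R \<in> algS}"
    using unital_algebra.scale[OF R(1), of c] z[of c R, symmetric] unfolding R(2) by blast
  assume "v \<in> {amp m R x |R. R \<in> algS}"
  then obtain R' where R': "R' \<in> algS" "v = amp m R' x" by blast
  show "u + v \<in> {amp m R x |R. R \<in> algS}"
    using unital_algebra.add[OF R(1) R'(1)] p[of R R', symmetric] unfolding R(2) R'(2) by blast
qed

end

context irreducible_cuntz
begin

lemma amp_id: "amp m id x = x"
  unfolding id_def by (rule amp_ident)

text \<open>The blocks \<open>W\<^sub>u\<^sup>* Q W\<^sub>v\<close> of \<open>Q\<close> commute with the tuple and its adjoints, so they are scalars and commute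
  with \<open>T\<close>.\<close>

lemma amp_commutes_reducing:
  assumes T: "bounded_clinear T"
    and Q: "bounded_clinear Q" "\<And>i x. Q (amp m (S i) x) = amp m (S i) (Q x)"
      "\<And>i x. Q (amp m (Sd i) x) = amp m (Sd i) (Q x)"
  shows "amp m T (Q x) = Q (amp m T x)"
proof -
  define q where "q u v x = Wd u (Q (W v x))" for u v x
  have ampW: "amp m R (W v x) = W v (R x)"
    if "v \<in> words m" "R 0 = 0" for R v x
  proof -
    have "amp m R (W v x) = (\<Sum>w\<in>words m. if w = v then W v (R x) else 0)"
      unfolding amp_def using that
      by (intro sum.cong) (auto simp: Wd_W words_def bounded_clinear_zero[OF bounded_clinear_word_S])
    then show ?thesis using that by simp
  qed
  have "\<exists>c. \<forall>x. q u v x = c *\<^sub>C x" if u: "u \<in> words m" and v: "v \<in> words m" for u v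
  proof (rule commutant)
    show "bounded_clinear (q u v)" unfolding q_def
      by (intro bounded_clinear_compose[OF bounded_clinear_Wd] bounded_clinear_compose[OF Q(1) bounded_clinear_word_S])
    show "q u v (S i x) = S i (q u v x)" for i x
      unfolding q_def ampW[where R = "S i", OF v bounded_clinear_zero[OF bounded_clinear_S], symmetric] Q(2) by (rule Wd_amp[OF u])
    show "q u v (Sd i x) = Sd i (q u v x)" for i x
      unfolding q_def ampW[where R = "Sd i", OF v bounded_clinear_zero[OF bounded_clinear_Sd], symmetric] Q(3) by (rule Wd_amp[OF u])
  qed
  then obtain c where c: "\<And>u v x. u \<in> words m \<Longrightarrow> v \<in> words m \<Longrightarrow> q u v x = c u v *\<^sub>C x" by metis
  have WQ: "Wd u (Q (amp m R x)) = (\<Sum>v\<in>words m. c u v *\<^sub>C R (Wd v x))"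
    if u: "u \<in> words m" for u R
  proof -
    have "Wd u (Q (amp m R x)) = (\<Sum>v\<in>words m. q u v (R (Wd v x)))"
      by (simp add: amp_def q_def bounded_clinear_sum[OF Q(1)] bounded_clinear_sum[OF bounded_clinear_Wd])
    then show ?thesis using u by (simp add: c)
  qed
  show ?thesis
  proof (rule amp_eqI)
    fix u :: "'n list" assume u: "u \<in> words m"
    have "Wd u (amp m T (Q x)) = T (Wd u (Q (amp m (\<lambda>x. x) x)))"
      by (simp add: Wd_amp[OF u] amp_ident)
    also have "\<dots> = (\<Sum>v\<in>words m. c u v *\<^sub>C T (Wd v x))"
      unfolding WQ[OF u] by (simp add: bounded_clinear_sum[OF T] bounded_clinear_scaleC[OF T])
    also have "\<dots> = Wd u (Q (amp m T x))" by (rule WQ[OF u, symmetric])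
    finally show "Wd u (amp m T (Q x)) = Wd u (Q (amp m T x))" .
  qed
qed

text \<open>Wold decomposition of the closed cyclic subspace \<open>M\<close> of the amplified tuple: its Cuntz part \<open>Mu\<close> is
  reducing, and the wandering vectors \<open>N\<close> have no component in \<open>V\<close>.\<close>

lemma amp_in_cyclic_subspace:
  assumes T: "bounded_clinear T"
    and approx: "\<And>F e. finite F \<Longrightarrow> e > 0 \<Longrightarrow> (\<And>x y. (x, y) \<in> F \<Longrightarrow> x \<in> orthocompl V) \<Longrightarrow>
      \<exists>R\<in>algS. \<forall>(x, y)\<in>F. cmod (cinner (R x) y - cinner (T x) y) < e"
  shows "amp m T x \<in> closure {amp m R x |R. R \<in> algS}"
proof -
  interpret a: row_isometry "\<lambda>i. amp m (S i)" by (rule row_isometry_amp)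
  have adS: "cadjoint (amp m (S i)) = amp m (Sd i)" for i
    by (rule cadjoint_amp[OF bounded_clinear_S])
  define M where "M = closure {amp m R x |R. R \<in> algS}"
  have M: "csubspace M" "closed M" unfolding M_def by (simp_all add: csubspace_closure csubspace_amp_orbit)
  have "x = amp m id x" by (simp add: amp_id)
  then have xM: "x \<in> M" unfolding M_def using unital_algebra.one[of "range S"]
    by (intro subsetD[OF closure_subset]) blast
  have SM: "amp m (S i) y \<in> M" if "y \<in> M" for i y
  proof -
    have "{amp m R x |R. R \<in> algS} \<subseteq> {y. amp m (S i) y \<in> M}"
    proof safe
      fix R assume R: "R \<in> algS"
      have "amp m (S i) (amp m R x) = amp m (S i \<circ> R) x" unfolding amp_amp o_def ..
      moreover have "S i \<circ> R \<in> algS"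
        using unital_algebra.mult[OF unital_algebra.gen R] by blast
      ultimately show "amp m (S i) (amp m R x) \<in> M"
        unfolding M_def by (intro subsetD[OF closure_subset]) auto
    qed
    then have "M \<subseteq> {y. amp m (S i) y \<in> M}"
      unfolding M_def by (rule closure_minimal)
        (rule closed_vimage_bounded_clinear[OF a.bounded_clinear_S closed_closure])
    then show ?thesis using that by blast
  qed
  \<comment> \<open>The wandering space of the amplified tuple restricted to M; K is the pure part
    that it generates.\<close>
  define N where "N = {y \<in> M. \<forall>i. \<forall>z\<in>M. cinner y (amp m (S i) z) = 0}"
  define K where "K = a.gen N"
  have K: "csubspace K" "closed K" unfolding K_def by (rule a.gen_closed)+
  have SK: "amp m (S i) y \<in> K" if "y \<in> K" for i y using a.S_gen that unfolding K_def .
  have KM: "K \<subseteq> M" unfolding K_def by (rule a.gen_subset[OF M SM]) (auto simp: N_def)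
  define Mu where "Mu = M \<inter> orthocompl K"
  have Mu: "csubspace Mu" "closed Mu" unfolding Mu_def
    by (intro complex_vector.subspace_inter M csubspace_orthocompl closed_Int closed_orthocompl)+
  have NK: "y \<in> K" if "y \<in> N" for y using a.gen_superset that unfolding K_def by blast
  have wordK: "a.W w y \<in> K" if "y \<in> N" for w y
    unfolding K_def by (rule a.word_in_gen[OF that])
  \<comment> \<open>Orthogonality to K is tested on words applied to N: the empty word uses that N
    is wandering, a longer one loses its first letter against \<open>amp m (S i)\<close>.\<close>
  have SMu: "amp m (S i) y \<in> Mu" if y: "y \<in> Mu" for i y
  proof -
    have "amp m (S i) y \<in> orthocompl K"
      unfolding K_def
    proof (rule a.orthocompl_genI)
      fix w z assume z: "z \<in> N"
      show "cinner (amp m (S i) y) (a.W w z) = 0"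
      proof (cases w)
        case Nil
        have "cinner z (amp m (S i) y) = 0" using z y by (simp add: N_def Mu_def)
        then show ?thesis using Nil cinner_sym_0[of z] by (simp add: word_op_simps)
      next
        case (Cons j u)
        have "cinner y (a.W u z) = 0"
          using y wordK[OF z] by (intro orthocomplD) (auto simp: Mu_def)
        then show ?thesis using Cons
          by (simp add: a.cinner_S word_op_simps a.Sd_S cinner.zero_right)
      qed
    qed
    then show ?thesis using y SM by (simp add: Mu_def)
  qed
  have SdMu: "cadjoint (amp m (S i)) y \<in> Mu" if y: "y \<in> Mu" for i y
  proof -
    have yM: "y \<in> M" using y by (simp add: Mu_def)
    \<comment> \<open>The projection of y onto the sum of the images of M under the amplified
      letters. Then y - r is wandering, hence in K, while y is orthogonal to K; so y = r, and the
      adjoint letters send y into M.\<close>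
    define r where "r = (\<Sum>j\<in>UNIV. amp m (S j) (proj M (cadjoint (amp m (S j)) y)))"
    have rj: "cadjoint (amp m (S j)) r = proj M (cadjoint (amp m (S j)) y)" for j
      by (simp add: r_def bounded_clinear_sum[OF a.bounded_clinear_Sd] a.Sd_S)
    have rM: "r \<in> M" unfolding r_def by (intro csubspace_sum[OF M(1)] SM proj_in M)
    have qN: "y - r \<in> N"
      unfolding N_def
    proof (intro CollectI conjI allI ballI csubspace_diff[OF M(1) yM rM])
      fix j z assume z: "z \<in> M"
      have "cinner (cadjoint (amp m (S j)) y) z = cinner (proj M (cadjoint (amp m (S j)) y)) z"
        by (simp add: cinner_proj[OF M] proj_ident[OF M z])
      then show "cinner (y - r) (amp m (S j) z) = 0"
        by (simp add: a.cinner_Sd[symmetric] bounded_clinear_diff[OF a.bounded_clinear_Sd] cinner.diff_left rj)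
    qed
    have "cinner y (y - r) = 0" using y NK[OF qN] by (intro orthocomplD) (auto simp: Mu_def)
    moreover have "cinner r (y - r) = 0"
    proof -
      have "cinner (amp m (S j) (proj M (cadjoint (amp m (S j)) y))) (y - r) = 0" for j
        using qN proj_in[OF M] cinner_sym_0[of "y - r"] by (auto simp: N_def)
      then show ?thesis by (subst r_def) (simp add: cinner.sum_left)
    qed
    ultimately have "cinner (y - r) (y - r) = 0" by (simp only: cinner.diff_left diff_self)
    then have "y = r" by simp
    then have 1: "cadjoint (amp m (S i)) y \<in> M" using rj[of i] proj_in[OF M] by metis
    have "cadjoint (amp m (S i)) y \<in> orthocompl K"
      unfolding K_def
    proof (rule a.orthocompl_genI)
      fix w z assume z: "z \<in> N"
      show "cinner (cadjoint (amp m (S i)) y) (a.W w z) = 0"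
        using y wordK[OF z, of "i # w"]
        by (simp add: a.cinner_Sd word_op_simps Mu_def orthocompl_def)
    qed
    then show ?thesis using 1 by (simp add: Mu_def)
  qed
  note Q = a.proj_reducing_commute(1,2)[OF Mu SMu SdMu]
  have "amp m T (proj Mu x) = proj Mu (amp m T x)"
    by (rule amp_commutes_reducing[OF T bounded_clinear_proj[OF Mu]]) (use Q in \<open>simp_all add: adS\<close>)
  then have u: "amp m T (proj Mu x) \<in> M" using proj_in[OF Mu, of "amp m T x"] by (simp add: Mu_def)
  have NV: "Wd w y \<in> orthocompl V" if y: "y \<in> N" and w: "w \<in> words m" for y w
  proof -
    define h where "h = P (Wd w y)"
    have wand: "cinner (a.W u y) (a.W v y) = (if u = v then cinner y y else 0)" for u v
    proof (rule a.cinner_wandering)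
      show "cinner y (amp m (S i) (a.W u y)) = 0" for i u
        using y wordK[OF y] KM by (auto simp: N_def)
      then show "cinner (amp m (S i) (a.W u y)) y = 0" for i u
        using cinner_sym_0[of y] by blast
    qed
    \<comment> \<open>Up to conjugation the coefficient of \<open>W u h\<close> at v is the
      coefficient of \<open>W w v\<close> along the u-th orbit vector of y. That orbit is orthogonal
      with constant norm, so Bessel's inequality bounds the sum.\<close>
    have key: "(\<Sum>u\<in>F. (cmod (cinner (W u h) v))\<^sup>2) \<le> (norm y)\<^sup>2 * (norm v)\<^sup>2"
      if F: "finite F" and v: "v \<in> V" for F v
    proof (cases "y = 0")
      case True
      then have "h = 0" by (simp add: h_def bounded_clinear_zero[OF bounded_clinear_Wd] bounded_clinear_zero[OF bounded_clinear_P])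
      then show ?thesis by (simp add: bounded_clinear_zero[OF bounded_clinear_word_S] cinner.zero_left)
    next
      case False
      define e where "e u = of_real (inverse (norm y)) *\<^sub>C a.W u y" for u
      have "cinner (e u) (e u') = (if u = u' then 1 else 0)" for u u'
        using False by (simp add: e_def cinner_simps wand cinner_self power2_eq_square field_simps)
      then have B: "(\<Sum>u\<in>F. (cmod (cinner (W w v) (e u)))\<^sup>2) \<le> (norm (W w v))\<^sup>2"
        using F by (intro bessel)
      have "(cmod (cinner (W u h) v))\<^sup>2 = (norm y)\<^sup>2 * (cmod (cinner (W w v) (e u)))\<^sup>2" for u
      proof -
        have "cinner (W u h) v = cinner (P (W u h)) v"
          by (simp add: cinner_P P_ident[OF v])
        also have "\<dots> = cinner (P (W u (Wd w y))) v" by (simp only: h_def P_word_P)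
        also have "\<dots> = cinner (W u (Wd w y)) v"
          by (simp add: cinner_P P_ident[OF v])
        also have "\<dots> = cinner (Wd w (a.W u y)) v"
          by (simp only: word_op_amp Wd_amp[OF w])
        also have "\<dots> = cinner (a.W u y) (W w v)"
          by (rule cinner_cadjoint_left[OF bounded_clinear_word_S])
        finally have "cinner (W w v) (a.W u y) = cnj (cinner (W u h) v)"
          using cinner_commute by metis
        then have "cmod (cinner (W w v) (e u)) = inverse (norm y) * cmod (cinner (W u h) v)"
          by (simp add: e_def cinner_simps norm_mult norm_inverse)
        then have "cmod (cinner (W u h) v) = norm y * cmod (cinner (W w v) (e u))"
          using False by simp
        then show ?thesis by (simp only: power_mult_distrib)
      qed
      then show ?thesis
        using mult_left_mono[OF B, of "(norm y)\<^sup>2"]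
        by (simp add: sum_distrib_left isometry_norm[OF isometry_word])
    qed
    obtain E where E: "finite E" "orthonormal E" "cspan E = V" "card E = cdim V"
      using orthonormal_basis_exists[OF V fin_V] .
    have EV: "v \<in> V" if "v \<in> E" for v using that E(3) complex_vector.span_base by blast
    have parseval: "(norm z)\<^sup>2 = (\<Sum>v\<in>E. (cmod (cinner z v))\<^sup>2)" if "z \<in> V" for z
      by (rule orthonormal_parseval[OF E(1,2)]) (simp add: E(3) that)
    have "h = 0"
    proof (rule square_summable_orbit_zero)
      show "h \<in> V" unfolding h_def by (rule P_in)
      fix F :: "'n list set" assume F: "finite F"
      have "(\<Sum>u\<in>F. (norm (P (W u h)))\<^sup>2) = (\<Sum>u\<in>F. \<Sum>v\<in>E. (cmod (cinner (P (W u h)) v))\<^sup>2)"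
        by (intro sum.cong refl parseval P_in)
      also have "\<dots> = (\<Sum>v\<in>E. \<Sum>u\<in>F. (cmod (cinner (P (W u h)) v))\<^sup>2)" by (rule sum.swap)
      also have "\<dots> = (\<Sum>v\<in>E. \<Sum>u\<in>F. (cmod (cinner (W u h) v))\<^sup>2)"
        by (intro sum.cong refl) (simp add: cinner_P P_ident EV)
      also have "\<dots> \<le> (\<Sum>v\<in>E. (norm y)\<^sup>2 * (norm v)\<^sup>2)" by (intro sum_mono key F EV)
      finally show "(\<Sum>u\<in>F. (norm (P (W u h)))\<^sup>2) \<le> (\<Sum>v\<in>E. (norm y)\<^sup>2 * (norm v)\<^sup>2)" .
    qed
    then show ?thesis
      using P_orth[of "Wd w y"] by (simp add: h_def)
  qed
  define Z where "Z = {z. \<forall>w\<in>words m. Wd w z \<in> orthocompl V}"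
  have Z': "Z = (\<Inter>w\<in>words m. {z. Wd w z \<in> orthocompl V})" by (auto simp: Z_def)
  have KZ: "K \<subseteq> Z"
    unfolding K_def
  proof (rule a.gen_subset)
    show "csubspace Z" unfolding Z'
      by (intro complex_vector.subspace_Inter) (auto intro!: csubspace_vimage bounded_clinear_Wd csubspace_orthocompl)
    show "closed Z" unfolding Z'
      by (intro closed_INT ballI closed_vimage_bounded_clinear bounded_clinear_Wd closed_orthocompl)
    show "amp m (S i) z \<in> Z" if "z \<in> Z" for i z
      using that by (auto simp: Z_def Wd_amp S_orthocompl_V)
    show "N \<subseteq> Z" using NV by (auto simp: Z_def)
  qed
  \<comment> \<open>The part of x in K. All its blocks are orthogonal to V, so the approximation
    hypothesis applies to them.\<close>
  define z where "z = x - proj Mu x"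
  have "z \<in> K"
  proof -
    have zM: "z \<in> M" unfolding z_def using proj_in[OF Mu, of x] by (intro csubspace_diff[OF M(1) xM]) (simp add: Mu_def)
    define t where "t = z - proj K z"
    have "t \<in> M" unfolding t_def using zM proj_in[OF K] KM by (intro csubspace_diff[OF M(1)]) auto
    moreover have "t \<in> orthocompl K" unfolding t_def by (rule proj_orth[OF K])
    ultimately have tMu: "t \<in> Mu" by (simp add: Mu_def)
    have "cinner z t = 0" unfolding z_def by (rule orthocomplD[OF proj_orth[OF Mu] tMu])
    moreover have "cinner (proj K z) t = 0"
      using tMu by (intro orthocomplD'[OF _ proj_in[OF K]]) (simp add: Mu_def)
    ultimately have "cinner t t = 0" by (subst t_def) (simp only: cinner.diff_left diff_self)
    then have "z = proj K z" by (simp add: t_def)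
    then show ?thesis using proj_in[OF K] by metis
  qed
  \<comment> \<open>K is closed, so membership in it is a matter of matrix coefficients, and weak
    approximation of T on the blocks of z is enough.\<close>
  have "amp m T z \<in> orthocompl (orthocompl K)"
    unfolding orthocompl_def[of "orthocompl K"]
  proof (intro CollectI ballI)
    fix y assume y: "y \<in> orthocompl K"
    show "cinner (amp m T z) y = 0"
    proof (rule ccontr)
      assume ne: "cinner (amp m T z) y \<noteq> 0"
      \<comment> \<open>The tolerance per block: strict approximation on all blocks adds up to less
        than the supposedly nonzero coefficient.\<close>
      define e where "e = cmod (cinner (amp m T z) y) / real (card (words m :: 'n list set))"
      have cw: "card (words m :: 'n list set) > 0"
        using ne by (intro Nat.gr0I) (auto simp: amp_def cinner.zero_left)
      have "(words m :: 'n list set) \<noteq> {}" using cw by (metis card.empty less_irrefl)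
      then have ce: "real (card (words m :: 'n list set)) * e = cmod (cinner (amp m T z) y)"
        by (simp add: e_def)
      have e: "e > 0" using ne cw by (simp add: e_def)
      have "\<exists>R\<in>algS.
          \<forall>(x, y)\<in>(\<lambda>w. (Wd w z, Wd w y)) ` words m.
            cmod (cinner (R x) y - cinner (T x) y) < e"
        using \<open>z \<in> K\<close> KZ by (intro approx e) (auto simp: Z_def)
      then obtain R where R: "R \<in> algS"
        "\<And>w. w \<in> words m \<Longrightarrow> cmod (cinner (R (Wd w z)) (Wd w y) -
          cinner (T (Wd w z)) (Wd w y)) < e" by auto
      have "amp m R z \<in> K"
        by (rule amp_unital_algebra_invariant[OF K(1) SK _ R(1) \<open>z \<in> K\<close>])
          (assumption, subst amp_id, assumption)
      then have "cinner (amp m R z) y = 0" by (rule orthocomplD'[OF y])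
      then have "cinner (amp m T z) y = - (\<Sum>w\<in>words m. cinner (R (Wd w z)) (Wd w y) -
          cinner (T (Wd w z)) (Wd w y))"
        by (simp add: cinner_amp sum_subtractf)
      then have "cmod (cinner (amp m T z) y) \<le> (\<Sum>w\<in>words m. cmod (cinner (R (Wd w z)) (Wd w y) -
          cinner (T (Wd w z)) (Wd w y)))"
        by (simp only: norm_minus_cancel norm_sum)
      also have "\<dots> < (\<Sum>w\<in>(words m :: 'n list set). e)"
        using cw by (intro sum_strict_mono R) (auto simp: card_gt_0_iff)
      also have "\<dots> = cmod (cinner (amp m T z) y)" using ce by simp
      finally show False by simp
    qed
  qed
  then have "amp m T z \<in> M" using KM orthocompl_orthocompl[OF K] by auto
  moreover have "amp m T x = amp m T (proj Mu x) + amp m T z"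
    by (simp add: z_def bounded_clinear_add[OF bounded_clinear_amp[OF T], symmetric])
  ultimately have "amp m T x \<in> M" using csubspace_add[OF M(1) u] by simp
  then show ?thesis by (simp add: M_def)
qed

lemma card_words: "card (words m :: 'n list set) = CARD('n) ^ m"
  using card_lists_length_eq[of "UNIV :: 'n set" m] by (simp add: words_def)

text \<open>The finitely many first components are placed in distinct blocks of one vector x. Norm
  approximation of the amplified T at x then approximates T at all of them with a single
  polynomial.\<close>

lemma wot_algebra_if_approx_on_orthocompl:
  assumes n: "CARD('n) \<ge> 2" and T: "bounded_clinear T"
    and approx: "\<And>F e. finite F \<Longrightarrow> e > 0 \<Longrightarrow> (\<And>x y. (x, y) \<in> F \<Longrightarrow> x \<in> orthocompl V) \<Longrightarrow>
      \<exists>R\<in>algS. \<forall>(x, y)\<in>F. cmod (cinner (R x) y - cinner (T x) y) < e"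
  shows "T \<in> wotS"
proof (rule wot_algebraI[OF bounded_clinear_S T])
  fix F :: "('h \<times> 'h) set" and e :: real assume F: "finite F" and e: "e > 0"
  \<comment> \<open>Exceeds the norm of every second component, and the 1 keeps it positive; it
    converts the norm error e / B into the error e for matrix coefficients.\<close>
  define B where "B = 1 + (\<Sum>p\<in>F. norm (snd p))"
  have B: "B > 0" unfolding B_def by (simp add: add_pos_nonneg sum_nonneg)
  have nB: "norm y < B" if "(x, y) \<in> F" for x y
    using member_le_sum[OF that, of "\<lambda>p. norm (snd p)"] F by (simp add: B_def)
  define m where "m = card (fst ` F)"
  have "m < 2 ^ m" by (rule less_exp)
  also have "(2::nat) ^ m \<le> CARD('n) ^ m" using n by (rule power_mono) simp
  finally have "card (fst ` F) \<le> card (words m :: 'n list set)" unfolding card_words m_def by simp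
  then obtain g :: "'h \<Rightarrow> 'n list" where g: "g ` fst ` F \<subseteq> words m" "inj_on g (fst ` F)"
    using card_le_inj[of "fst ` F" "words m :: 'n list set"] F by auto
  define x where "x = (\<Sum>a\<in>fst ` F. W (g a) a)"
  have Wx: "Wd (g b) x = b" if b: "b \<in> fst ` F" for b
  proof -
    have "Wd (g b) x = (\<Sum>a\<in>fst ` F. if a = b then b else 0)"
      unfolding x_def bounded_clinear_sum[OF bounded_clinear_Wd]
    proof (intro sum.cong refl)
      fix a assume a: "a \<in> fst ` F"
      have "length (g b) = length (g a)" using g(1) a b by (auto simp: words_def)
      moreover have "g b = g a \<longleftrightarrow> a = b" using g(2) a b by (auto simp: inj_on_def)
      ultimately show "Wd (g b) (W (g a) a) = (if a = b then b else 0)"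
        by (simp add: Wd_W)
    qed
    then show ?thesis using F b by simp
  qed
  have "amp m T x \<in> closure {amp m R x |R. R \<in> algS}"
    by (rule amp_in_cyclic_subspace[OF T approx])
  then obtain R where R: "R \<in> algS" "norm (amp m R x - amp m T x) < e / B"
    using e B by (auto simp: closure_approachable dist_norm dest!: spec[of _ "e / B"])
  have bR: "bounded_clinear R" using bounded_clinear_unital_algebra[OF R(1)] bounded_clinear_S by blast
  have "cmod (cinner (R a) y - cinner (T a) y) < e" if ay: "(a, y) \<in> F" for a y
  proof -
    have a: "a \<in> fst ` F" using ay by force
    have ga: "g a \<in> words m" using g(1) a by blast
    have "R a - T a = Wd (g a) (amp m R x - amp m T x)"
      by (simp add: bounded_clinear_diff[OF bounded_clinear_Wd] Wd_amp[OF ga] Wx[OF a])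
    moreover have "norm (Wd (g a) z) \<le> norm z" for z
    proof (rule power2_le_imp_le)
      have "(norm (Wd (g a) z))\<^sup>2 \<le> (\<Sum>w\<in>words m. (norm (Wd w z))\<^sup>2)"
        by (rule member_le_sum[OF ga]) auto
      then show "(norm (Wd (g a) z))\<^sup>2 \<le> (norm z)\<^sup>2" using sum_words_Wd_le order_trans by blast
    qed simp
    ultimately have Ra: "norm (R a - T a) < e / B" using R(2) order_le_less_trans by metis
    have "cmod (cinner (R a) y - cinner (T a) y) \<le> norm (R a - T a) * norm y"
      using cinner_bound[of "R a - T a" y] by (simp add: cinner.diff_left)
    also have "\<dots> \<le> norm (R a - T a) * B" using nB[OF ay] by (intro mult_left_mono) auto
    also have "\<dots> < e / B * B" using Ra B by (intro mult_strict_right_mono)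
    also have "\<dots> = e" using B by simp
    finally show ?thesis .
  qed
  then show "\<exists>R\<in>algS. \<forall>(x, y)\<in>F. cmod (cinner (R x) y - cinner (T x) y) < e"
    using R(1) by blast
qed

end

section \<open>The model algebra\<close>

lemma bounded_clinear_model_proj: "bounded_clinear (model_proj d :: 'n model_space \<Rightarrow> 'n model_space)"
proof (rule bounded_clinearI[of _ 1])
  fix x y :: "'n model_space" and c
  show "model_proj d (x + y) = model_proj d x + model_proj d y"
    by (rule ell2_eqI) (simp add: ell2_coeff_model_proj plus_ell2.rep_eq split: sum.split)
  show "model_proj d (c *\<^sub>C x) = c *\<^sub>C model_proj d x"
    by (rule ell2_eqI) (simp add: ell2_coeff_model_proj scaleC_ell2.rep_eq split: sum.split)
  have "(norm (model_proj d x))\<^sup>2 = (\<Sum>\<^sub>\<infinity>p\<in>Inl ` {..<d}. (cmod (ell2_coeff x p))\<^sup>2)"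
    unfolding power2_norm_ell2
    by (rule infsum_cong_neutral) (auto simp: ell2_coeff_model_proj split: sum.split)
  also have "\<dots> \<le> (norm x)\<^sup>2" by (simp add: sum_ell2_coeff_le)
  finally show "norm (model_proj d x) \<le> norm x * 1" unfolding mult_1_right by (rule power2_le_imp_le) simp
qed

text \<open>e lists an orthonormal basis of V, and f one of the wandering space of the tuple on the
  complement of V. Both sequences are continued by zero vectors, since the indices of the model
  space run over all natural numbers.\<close>

locale cuntz_frame = irreducible_cuntz S V
  for S :: "'n :: finite \<Rightarrow> 'h :: chilbert_space \<Rightarrow> 'h" and V +
  fixes e f :: "nat \<Rightarrow> 'h" and d :: nat
  assumes n: "CARD('n) \<ge> 2" and d_pos: "d > 0"
    and e: "cinner (e j) (e k) = (if j = k \<and> j < d then 1 else 0)"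
    and span_e: "cspan (range e) = V"
    and f: "cinner (f k) (f l) = (if k = l \<and> k < d * (CARD('n) - 1) then 1 else 0)"
    and f_orth: "f k \<in> orthocompl V"
    and Sd_f: "cadjoint (S i) (f k) \<in> V"
    and S_V: "x \<in> V \<Longrightarrow> S i x \<in> cspan (V \<union> range f)"
begin

definition \<alpha> :: nat where "\<alpha> = d * (CARD('n) - 1)"

lemma alpha_pos: "0 < \<alpha>"
  using n d_pos by (simp add: \<alpha>_def)

lemma f': "cinner (f k) (f l) = (if k = l \<and> k < \<alpha> then 1 else 0)"
  using f by (simp add: \<alpha>_def)

lemma e_V: "e j \<in> V"
  using complex_vector.span_base[of "e j" "range e"] span_e by simp

lemma word_f_orth: "W w (f k) \<in> orthocompl V"
  by (rule word_orthocompl_V[OF f_orth])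

lemma cinner_word_f:
  "cinner (W u (f k)) (W w (f l)) = (if u = w \<and> k = l \<and> k < \<alpha> then 1 else 0)"
proof -
  have 1: "cinner (S i (W u (f k))) (f l) = 0" for i u k l
    unfolding cinner_S by (rule orthocomplD[OF word_f_orth Sd_f])
  then have "cinner (f l) (S i (W u (f k))) = 0" for i u k l using cinner_sym_0 by blast
  with 1 have "cinner (W u (f k)) (W w (f l)) = (if u = w then cinner (f k) (f l) else 0)"
    by (rule cinner_wandering)
  then show ?thesis by (simp add: f')
qed

definition basis :: "nat + nat \<times> 'n list \<Rightarrow> 'h" where
  "basis p = (case p of Inl j \<Rightarrow> e j | Inr (k, w) \<Rightarrow> W w (f k))"

lemma basis_simps [simp]: "basis (Inl j) = e j" "basis (Inr (k, w)) = W w (f k)"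
  by (simp_all add: basis_def)

lemma cinner_basis:
  "cinner (basis p) (basis q) = (if p = q \<and> (case p of Inl j \<Rightarrow> j < d | Inr (k, w) \<Rightarrow> k < \<alpha>) then 1 else 0)"
proof -
  have "cinner (e j) (W w (f k)) = 0" "cinner (W w (f k)) (e j) = 0" for j k w
    using orthocomplD[OF word_f_orth e_V] orthocomplD'[OF word_f_orth e_V] by auto
  then show ?thesis by (auto simp: e cinner_word_f split: sum.split)
qed

lemma basis_eq_0: "basis p = 0 \<longleftrightarrow> \<not> (case p of Inl j \<Rightarrow> j < d | Inr (k, w) \<Rightarrow> k < \<alpha>)"
  using cinner_eq_0_iff[of "basis p"] unfolding cinner_basis by (simp split: if_splits)

lemma f_eq_0: "k \<ge> \<alpha> \<Longrightarrow> f k = 0"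
  using cinner_eq_0_iff[of "f k"] by (simp add: f')

sublocale b: orthonormal_family basis
proof
  show "cinner (basis p) (basis q) = 0" if "p \<noteq> q" for p q using that by (simp add: cinner_basis)
  show "basis p = 0 \<or> norm (basis p) = 1" for p
  proof (cases "basis p = 0")
    case False
    then have "(norm (basis p))\<^sup>2 = 1"
      using cinner_basis[of p p] basis_eq_0[of p] by (metis Re_cinner_self one_complex.sel(1))
    then show ?thesis using norm_ge_zero[of "basis p"] by (auto simp only: power2_eq_1_iff)
  qed simp
qed

text \<open>The projection onto \<open>gen V\<close> lies in the commutant, so it is a scalar, and V
  is nonzero.\<close>

lemma gen_V: "gen V = UNIV"
proof -
  have r: "csubspace (gen V)" "closed (gen V)" "\<And>i x. x \<in> gen V \<Longrightarrow> S i x \<in> gen V"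
    "\<And>i x. x \<in> gen V \<Longrightarrow> Sd i x \<in> gen V"
    using reducing_gen[of V] Sd_V by blast+
  obtain c where "\<And>x. proj (gen V) x = c *\<^sub>C x"
    using commutant[OF bounded_clinear_proj[OF r(1,2)] proj_reducing_commute(1,2)[OF r]] by blast
  then have "gen V = {0} \<or> gen V = UNIV" by (rule proj_scalar_trivial[OF r(1,2)])
  then show ?thesis using gen_superset[of V] V_nz csubspace_0[OF V] by blast
qed

lemma total: "closure (cspan (range basis)) = UNIV"
proof -
  define M where "M = closure (cspan (range basis))"
  have M: "csubspace M" "closed M" unfolding M_def by (rule closed_csubspace_closure_span)+
  have bM: "basis p \<in> M" for p unfolding M_def by (rule subsetD[OF closure_cspan_superset rangeI])
  have VM: "V \<subseteq> M" unfolding span_e[symmetric]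
  proof (rule complex_vector.span_minimal[OF _ M(1)], safe)
    show "e j \<in> M" for j using bM[of "Inl j"] by simp
  qed
  have "f k \<in> M" for k using bM[of "Inr (k, [])"] by (simp add: word_op_simps)
  then have VfM: "cspan (V \<union> range f) \<subseteq> M"
    using VM by (intro complex_vector.span_minimal[OF _ M(1)]) auto
  have "S i x \<in> M" if "x \<in> M" for i x
  proof -
    have "M \<subseteq> {x. S i x \<in> M}"
      unfolding M_def
    proof (rule closure_cspan_minimal)
      show "csubspace {x. S i x \<in> closure (cspan (range basis))}" "closed {x. S i x \<in> closure (cspan (range basis))}"
        using csubspace_vimage[OF bounded_clinear_S M(1)] closed_vimage_bounded_clinear[OF bounded_clinear_S M(2)]
        by (simp_all add: M_def)
      have "S i (basis p) \<in> M" for p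
      proof (cases p)
        case (Inl j)
        then show ?thesis using S_V[OF e_V] VfM by auto
      next
        case (Inr q)
        then show ?thesis using bM[of "Inr (fst q, i # snd q)"] by (cases q) (simp add: word_op_simps)
      qed
      then show "range basis \<subseteq> {x. S i x \<in> closure (cspan (range basis))}" by (auto simp: M_def)
    qed
    then show ?thesis using that by blast
  qed
  then have "gen V \<subseteq> M" by (intro gen_subset[OF M _ VM])
  then show ?thesis unfolding gen_V M_def by blast
qed

abbreviation U :: "'h \<Rightarrow> 'n model_space" where "U \<equiv> coords basis"

lemmas isometry_U = b.isometry_coords[OF total]
  and cadjoint_U_U = b.cadjoint_coords_coords[OF total]

lemma range_U: "range U = model_carrier d"
  unfolding b.range_coords basis_eq_0 model_carrier_def \<alpha>_def[symmetric]
  by (auto simp: split_sum_all split_paired_all not_less)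

lemma U_eqI: "(\<And>p. cinner x (basis p) = cinner y (basis p)) \<Longrightarrow> x = y"
  by (metis b.ell2_coeff_coords ell2_eqI cadjoint_U_U)

text \<open>Reads off the k-th Fock component of a vector. For k < \<alpha> the adjoint
  \<open>G k\<close> embeds the Fock space as the k-th copy, and it intertwines the creation
  operators with the \<open>S i\<close>.\<close>

definition C :: "nat \<Rightarrow> 'h \<Rightarrow> 'n list ell2" where
  "C k = coords (\<lambda>w. W w (f k))"

abbreviation G :: "nat \<Rightarrow> 'n list ell2 \<Rightarrow> 'h" where "G k \<equiv> cadjoint (C k)"

lemma family_f: "orthonormal_family (\<lambda>w. W w (f k))"
proof
  show "cinner (W u (f k)) (W w (f k)) = 0" if "u \<noteq> w" for u w using that by (simp add: cinner_word_f)
  show "W w (f k) = 0 \<or> norm (W w (f k)) = 1" for w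
    using b.norm_e[of "Inr (k, w)"] by simp
qed

lemma ell2_coeff_C: "ell2_coeff (C k x) w = cinner x (W w (f k))"
  unfolding C_def by (rule orthonormal_family.ell2_coeff_coords[OF family_f])

lemma bounded_clinear_C: "bounded_clinear (C k)"
  unfolding C_def by (rule orthonormal_family.bounded_clinear_coords[OF family_f])

lemma bounded_clinear_G: "bounded_clinear (G k)"
  by (rule bounded_clinear_cadjoint[OF bounded_clinear_C])

lemma component_U: "component k (U x) = C k x"
  by (rule ell2_eqI) (simp add: ell2_coeff_component b.ell2_coeff_coords ell2_coeff_C)

lemma C_V: "x \<in> V \<Longrightarrow> C k x = 0"
  by (rule ell2_eqI) (simp add: ell2_coeff_C zero_ell2.rep_eq orthocomplD'[OF word_f_orth])

lemma G_orth: "G k g \<in> orthocompl V"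
  by (simp add: orthocompl_def cinner_cadjoint_left[OF bounded_clinear_C] C_V cinner.zero_right)

lemma cinner_G_word_f:
  assumes "k < \<alpha>" shows "cinner (G k g) (W w (f l)) = (if k = l then ell2_coeff g w else 0)"
proof -
  have "C k (W w (f l)) = (if k = l then ell2_basis w else 0)"
    by (rule ell2_eqI) (use assms in \<open>simp add: ell2_coeff_C cinner_word_f ell2_coeff_basis zero_ell2.rep_eq\<close>)
  then show ?thesis
    by (simp add: cinner_cadjoint_left[OF bounded_clinear_C] cinner_ell2_basis cinner.zero_right)
qed

lemma C_G: "k < \<alpha> \<Longrightarrow> C l (G k g) = (if k = l then g else 0)"
  by (rule ell2_eqI) (simp add: ell2_coeff_C cinner_G_word_f zero_ell2.rep_eq)

lemma isometry_G: "k < \<alpha> \<Longrightarrow> isometry (G k)"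
  by (rule isometry_if_inner[OF bounded_clinear_G]) (simp add: cinner_cadjoint_left[OF bounded_clinear_C] C_G)

lemma S_G: "S i (G k g) = G k (creation i g)"
proof (rule cinner_eqI_left)
  fix y
  have "C k (Sd i y) = cadjoint (creation i) (C k y)"
    by (rule ell2_eqI) (simp add: ell2_coeff_C ell2_coeff_cadjoint_creation cinner_Sd word_op_simps)
  then show "cinner (S i (G k g)) y = cinner (G k (creation i g)) y"
    by (simp add: cinner_S cinner_cadjoint_left[OF bounded_clinear_C] cinner_cadjoint[OF bounded_clinear_creation])
qed

text \<open>The projections onto the copies of the Fock space add up to the projection onto the
  complement of V.\<close>

lemma sum_G_C: "(\<Sum>k<\<alpha>. G k (C k x)) = x - P x"
proof (rule U_eqI)
  fix p show "cinner (\<Sum>k<\<alpha>. G k (C k x)) (basis p) = cinner (x - P x) (basis p)"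
  proof (cases p)
    case (Inl j)
    then show ?thesis
      by (simp add: cinner.sum_left orthocomplD[OF G_orth e_V] orthocomplD[OF P_orth e_V])
  next
    case (Inr q)
    obtain l w where q: "q = (l, w)" by force
    have "cinner (P x) (W w (f l)) = 0"
      by (rule orthocomplD'[OF word_f_orth P_in])
    then have r: "cinner (x - P x) (basis p) = cinner x (W w (f l))"
      by (simp add: Inr q cinner.diff_left)
    show ?thesis
    proof (cases "l < \<alpha>")
      case True
      have "cinner (\<Sum>k<\<alpha>. G k (C k x)) (basis p) = (\<Sum>k<\<alpha>. if k = l then ell2_coeff (C l x) w else 0)"
        unfolding cinner.sum_left by (intro sum.cong) (auto simp: Inr q cinner_G_word_f)
      then show ?thesis using True r by (simp add: ell2_coeff_C)
    next
      case False
      then show ?thesis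
        by (simp add: Inr q f_eq_0 bounded_clinear_zero[OF bounded_clinear_word_S] cinner.zero_right)
    qed
  qed
qed

lemma model_proj_U: "model_proj d (U x) = U (P x)"
proof (rule ell2_eqI)
  fix p
  show "ell2_coeff (model_proj d (U x)) p = ell2_coeff (U (P x)) p"
  proof (cases p)
    case (Inl j)
    have "cinner (P x) (e j) = cinner x (e j)"
      by (simp add: cinner_P P_ident[OF e_V])
    moreover have "e j = 0" if "\<not> j < d" using basis_eq_0[of "Inl j"] that by simp
    ultimately show ?thesis by (auto simp: Inl ell2_coeff_model_proj b.ell2_coeff_coords cinner.zero_right)
  next
    case (Inr q)
    obtain k w where q: "q = (k, w)" by force
    have "cinner (P x) (W w (f k)) = 0"
      by (rule orthocomplD'[OF word_f_orth P_in])
    then show ?thesis by (simp add: Inr q ell2_coeff_model_proj b.ell2_coeff_coords)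
  qed
qed

lemma zero_plus_ampliation_U: "zero_plus_ampliation \<alpha> X (U x) = U (\<Sum>k<\<alpha>. G k (X (C k x)))"
proof (rule ell2_eqI)
  fix p
  show "ell2_coeff (zero_plus_ampliation \<alpha> X (U x)) p = ell2_coeff (U (\<Sum>k<\<alpha>. G k (X (C k x)))) p"
  proof (cases p)
    case (Inl j)
    then show ?thesis
      by (simp add: ell2_coeff_zero_plus_ampliation b.ell2_coeff_coords cinner.sum_left orthocomplD[OF G_orth e_V])
  next
    case (Inr q)
    obtain l w where q: "q = (l, w)" by force
    show ?thesis
    proof (cases "l < \<alpha>")
      case True
      have "cinner (\<Sum>k<\<alpha>. G k (X (C k x))) (W w (f l)) = (\<Sum>k<\<alpha>. if k = l then ell2_coeff (X (C l x)) w else 0)"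
        unfolding cinner.sum_left by (intro sum.cong) (auto simp: cinner_G_word_f)
      then show ?thesis
        using True by (simp add: Inr q ell2_coeff_zero_plus_ampliation b.ell2_coeff_coords component_U)
    next
      case False
      then show ?thesis
        by (simp add: Inr q ell2_coeff_zero_plus_ampliation b.ell2_coeff_coords f_eq_0
            bounded_clinear_zero[OF bounded_clinear_word_S] cinner.zero_right)
    qed
  qed
qed

text \<open>A polynomial in S is block diagonal with equal blocks on the copies of the Fock space.
  Both properties are equations between matrix coefficients, so they survive weak limits.\<close>

lemma cinner_wot_G:
  assumes T: "T \<in> wotS" and k: "k < \<alpha>" and l: "l < \<alpha>"
  shows "cinner (T (G k g)) (G l h) = (if k = l then cinner (T (G 0 g)) (G 0 h) else 0)"
proof (rule ccontr)
  let ?a = "cinner (T (G k g)) (G l h)" and ?b = "cinner (T (G 0 g)) (G 0 h)"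
  let ?r = "if k = l then ?b else 0"
  assume ne: "?a \<noteq> ?r"
  \<comment> \<open>Half the gap, because two approximation errors have to be absorbed.\<close>
  define t where "t = cmod (?a - ?r) / 2"
  have t: "t > 0" using ne by (simp add: t_def)
  obtain R where R: "R \<in> algS"
    "\<forall>(x, y)\<in>{(G k g, G l h), (G 0 g, G 0 h)}. cmod (cinner (R x) y - cinner (T x) y) < t"
    using wot_algebraD(2)[OF bounded_clinear_S T _ t, of "{(G k g, G l h), (G 0 g, G 0 h)}"] by auto
  obtain Q where Q': "\<And>V x. bounded_clinear V \<Longrightarrow> (\<And>i x. S i (V x) = V (creation i x)) \<Longrightarrow> R (V x) = V (Q x)"
    by (rule intertwine_unital_algebraE[OF R(1), of creation]) blast
  have Q: "R (G k x) = G k (Q x)" for k x by (rule Q'[OF bounded_clinear_G S_G])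
  have Qi: "cinner (R (G i g)) (G j h) = (if i = j then cinner (Q g) h else 0)" if "i < \<alpha>" "j < \<alpha>" for i j
    using that by (simp add: Q cinner_cadjoint[OF bounded_clinear_C, symmetric] cinner_cadjoint_left[OF bounded_clinear_C]
        C_G cinner.zero_left cinner.zero_right)
  have 1: "cmod (cinner (R (G k g)) (G l h) - ?a) < t" "cmod (cinner (R (G 0 g)) (G 0 h) - ?b) < t"
    using R(2) by auto
  have "cmod (?a - ?r) < 2 * t"
  proof (cases "k = l")
    case True
    have "?a - ?r = (cinner (R (G 0 g)) (G 0 h) - ?b) - (cinner (R (G k g)) (G l h) - ?a)"
      using True Qi[OF k l] Qi[OF alpha_pos alpha_pos] by simp
    then have "cmod (?a - ?r) \<le> cmod (cinner (R (G 0 g)) (G 0 h) - ?b) + cmod (cinner (R (G k g)) (G l h) - ?a)"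
      by (simp only: norm_triangle_ineq4)
    then show ?thesis using 1 by linarith
  next
    case False
    then show ?thesis using 1(1) t by (simp add: Qi[OF k l])
  qed
  then show False by (simp add: t_def)
qed

text \<open>T leaves the complement of V invariant and acts there as one X on every copy; whatever T
  does on V is collected in Y.\<close>

lemma wot_algebra_subset_model:
  assumes T: "T \<in> wotS"
  shows "U \<circ> T \<in> (\<lambda>X. X \<circ> U) ` model_algebra d"
proof -
  have bT: "bounded_clinear T" by (rule wot_algebraD(1)[OF bounded_clinear_S T])
  have bU: "bounded_clinear U" by (rule b.bounded_clinear_coords)
  define X where "X g = C 0 (T (G 0 g))" for g
  have X: "X \<in> free_semigroup_algebra"
    using wot_algebra_compress[OF bounded_clinear_S bounded_clinear_creation isometry_G[OF alpha_pos] S_G T]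
    by (simp add: free_semigroup_algebra_def X_def[abs_def] cadjoint_cadjoint[OF bounded_clinear_C])
  \<comment> \<open>Composing with \<open>model_proj d\<close> makes Y vanish on the complement of
    the carrier, as the encoding of operators on a subspace demands.\<close>
  define Y where "Y g = U (T (cadjoint U (model_proj d g)))" for g
  have Y: "Y \<in> bounded_ops_on (model_carrier d)"
    unfolding bounded_ops_on_def
  proof (intro CollectI conjI ballI)
    show "bounded_clinear Y" unfolding Y_def
      by (intro bounded_clinear_compose[OF bU] bounded_clinear_compose[OF bT]
          bounded_clinear_compose[OF bounded_clinear_cadjoint[OF bU] bounded_clinear_model_proj])
    show "range Y \<subseteq> model_carrier d" unfolding Y_def range_U[symmetric] by auto
    fix g :: "'n model_space" assume g: "g \<in> orthocompl (model_carrier d)"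
    have "model_proj d g = 0"
    proof (rule ell2_eqI)
      fix p
      have "ell2_coeff g (Inl j) = 0" if "j < d" for j
      proof -
        have "ell2_basis (Inl j) \<in> (model_carrier d :: 'n model_space set)"
          using that by (auto simp: model_carrier_def ell2_coeff_basis)
        from orthocomplD[OF g this] show ?thesis by (simp add: cinner_ell2_basis)
      qed
      then show "ell2_coeff (model_proj d g) p = ell2_coeff 0 p"
        by (simp add: ell2_coeff_model_proj zero_ell2.rep_eq split: sum.split)
    qed
    then show "Y g = 0"
      by (simp add: Y_def bounded_clinear_zero[OF bU] bounded_clinear_zero[OF bT]
          bounded_clinear_zero[OF bounded_clinear_cadjoint[OF bU]])
  qed
  have CTG: "C l (T (G k g)) = (if k = l then X g else 0)" if "k < \<alpha>" "l < \<alpha>" for k l g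
  proof (rule cinner_eqI_left)
    fix h
    have "cinner (C l (T (G k g))) h = cinner (T (G k g)) (G l h)" by (rule cinner_cadjoint[OF bounded_clinear_C])
    also have "\<dots> = (if k = l then cinner (T (G 0 g)) (G 0 h) else 0)" by (rule cinner_wot_G[OF T that])
    also have "cinner (T (G 0 g)) (G 0 h) = cinner (X g) h"
      unfolding X_def by (rule cinner_cadjoint[OF bounded_clinear_C, symmetric])
    finally show "cinner (C l (T (G k g))) h = cinner (if k = l then X g else 0) h"
      by (simp add: cinner.zero_left)
  qed
  have "U (T x) = Y (model_proj d (U x)) + zero_plus_ampliation \<alpha> X (U x)" for x
  proof -
    have "P (P x) = P x" by (rule proj_idem[OF V closed_V])
    then have 1: "Y (model_proj d (U x)) = U (T (P x))" by (simp add: Y_def model_proj_U cadjoint_U_U)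
    define z where "z = T (x - P x)"
    have "z \<in> orthocompl V" unfolding z_def
      by (rule wot_algebra_invariant[OF bounded_clinear_S T csubspace_orthocompl closed_orthocompl S_orthocompl_V
            P_orth])
    then have "z = (\<Sum>l<\<alpha>. G l (C l z))" using sum_G_C[of z] P_0[of z] by simp
    also have "\<dots> = (\<Sum>l<\<alpha>. G l (X (C l x)))"
    proof (intro sum.cong refl)
      fix l assume "l \<in> {..<\<alpha>}"
      have "C l z = (\<Sum>k<\<alpha>. C l (T (G k (C k x))))"
        unfolding z_def sum_G_C[symmetric] by (simp add: bounded_clinear_sum[OF bT] bounded_clinear_sum[OF bounded_clinear_C])
      also have "\<dots> = (\<Sum>k<\<alpha>. if k = l then X (C l x) else 0)"
        using \<open>l \<in> {..<\<alpha>}\<close> by (intro sum.cong) (auto simp: CTG)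
      finally show "G l (C l z) = G l (X (C l x))" using \<open>l \<in> {..<\<alpha>}\<close> by simp
    qed
    finally have 2: "zero_plus_ampliation \<alpha> X (U x) = U (T (x - P x))"
      by (simp add: zero_plus_ampliation_U z_def)
    show ?thesis unfolding 1 2 bounded_clinear_add[OF bU, symmetric] bounded_clinear_add[OF bT, symmetric] by simp
  qed
  then have "U \<circ> T = (\<lambda>f. Y (model_proj d f) + zero_plus_ampliation \<alpha> X f) \<circ> U" by (simp add: fun_eq_iff)
  moreover have "(\<lambda>f. Y (model_proj d f) + zero_plus_ampliation \<alpha> X f) \<in> model_algebra d"
    unfolding model_algebra_def \<alpha>_def using X Y by blast
  ultimately show ?thesis by (rule image_eqI)
qed

text \<open>Approximation is required only at vectors orthogonal to V, where the term with Y
  vanishes and T consists of \<alpha> copies of X. A polynomial in the creation operators close to X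
  transfers to S through the \<open>G k\<close>.\<close>

lemma model_subset_wot_algebra:
  assumes Y: "Y \<in> bounded_ops_on (model_carrier d)" and X: "X \<in> free_semigroup_algebra"
  shows "(\<lambda>f. Y (model_proj d f) + zero_plus_ampliation \<alpha> X f) \<circ> U \<in> (\<lambda>T. U \<circ> T) ` wotS"
proof -
  have bU: "bounded_clinear U" by (rule b.bounded_clinear_coords)
  have X': "X \<in> wot_algebra (range creation)" using X by (simp add: free_semigroup_algebra_def)
  have bX: "bounded_clinear X" by (rule wot_algebraD(1)[OF bounded_clinear_creation X'])
  have bY: "bounded_clinear Y" "range Y \<subseteq> range U" using Y by (auto simp: bounded_ops_on_def range_U)
  define T where "T x = cadjoint U (Y (U (P x))) + (\<Sum>k<\<alpha>. G k (X (C k x)))" for x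
  have bT: "bounded_clinear T"
    unfolding T_def
    by (intro bounded_clinear_plus bounded_clinear_setsum
        bounded_clinear_compose[OF bounded_clinear_cadjoint[OF bU]] bounded_clinear_compose[OF bY(1)]
        bounded_clinear_compose[OF bU bounded_clinear_P]
        bounded_clinear_compose[OF bounded_clinear_G] bounded_clinear_compose[OF bX bounded_clinear_C])
  have "T \<in> wotS"
  proof (rule wot_algebra_if_approx_on_orthocompl[OF n bT])
    fix F :: "('h \<times> 'h) set" and t :: real
    assume F: "finite F" and t: "t > 0" and FV: "\<And>x y. (x, y) \<in> F \<Longrightarrow> x \<in> orthocompl V"
    define F' where "F' = (\<Union>(x, y)\<in>F. (\<lambda>k. (C k x, C k y)) ` {..<\<alpha>})"
    have "finite F'" using F by (auto simp: F'_def)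
    \<comment> \<open>The errors of the \<alpha> copies add up to less than t.\<close>
    moreover have "t / \<alpha> > 0" using t alpha_pos by simp
    ultimately obtain Q where Q: "Q \<in> unital_algebra (range creation)"
      "\<forall>(x, y)\<in>F'. cmod (cinner (Q x) y - cinner (X x) y) < t / \<alpha>"
      using wot_algebraD(2)[OF bounded_clinear_creation X'] by blast
    obtain R where R: "R \<in> algS"
      "\<And>V x. bounded_clinear V \<Longrightarrow> (\<And>i x. S i (V x) = V (creation i x)) \<Longrightarrow> R (V x) = V (Q x)"
      by (rule intertwine_unital_algebraE'[OF Q(1), of S]) blast
    have RG: "R (G k x) = G k (Q x)" for k x by (rule R(2)[OF bounded_clinear_G S_G])
    have bR: "bounded_clinear R" using bounded_clinear_unital_algebra[OF R(1)] bounded_clinear_S by blast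
    have "cmod (cinner (R x) y - cinner (T x) y) < t" if xy: "(x, y) \<in> F" for x y
    proof -
      have P0: "P x = 0" by (rule P_0[OF FV[OF xy]])
      have "R x = R (\<Sum>k<\<alpha>. G k (C k x))" using sum_G_C[of x] P0 by simp
      also have "\<dots> = (\<Sum>k<\<alpha>. G k (Q (C k x)))" by (simp only: bounded_clinear_sum[OF bR] RG)
      finally have "R x = (\<Sum>k<\<alpha>. G k (Q (C k x)))" .
      moreover have "T x = (\<Sum>k<\<alpha>. G k (X (C k x)))"
        by (simp add: T_def P0 bounded_clinear_zero[OF bU] bounded_clinear_zero[OF bY(1)]
            bounded_clinear_zero[OF bounded_clinear_cadjoint[OF bU]])
      ultimately have "cinner (R x) y - cinner (T x) y =
          (\<Sum>k<\<alpha>. cinner (Q (C k x)) (C k y) - cinner (X (C k x)) (C k y))"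
        by (simp add: cinner.sum_left cinner_cadjoint_left[OF bounded_clinear_C] sum_subtractf)
      then have "cmod (cinner (R x) y - cinner (T x) y) \<le>
          (\<Sum>k<\<alpha>. cmod (cinner (Q (C k x)) (C k y) - cinner (X (C k x)) (C k y)))"
        by (simp only: norm_sum)
      also have "\<dots> < (\<Sum>k<\<alpha>. t / \<alpha>)"
      proof (rule sum_strict_mono)
        fix k assume "k \<in> {..<\<alpha>}"
        then have "(C k x, C k y) \<in> F'" using xy by (auto simp: F'_def)
        then show "cmod (cinner (Q (C k x)) (C k y) - cinner (X (C k x)) (C k y)) < t / \<alpha>" using Q(2) by blast
      qed (use alpha_pos in auto)
      also have "\<dots> = t" using alpha_pos by simp
      finally show ?thesis .
    qed
    then show "\<exists>R\<in>algS. \<forall>(x, y)\<in>F. cmod (cinner (R x) y - cinner (T x) y) < t"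
      using R(1) by blast
  qed
  moreover have "(\<lambda>f. Y (model_proj d f) + zero_plus_ampliation \<alpha> X f) \<circ> U = U \<circ> T"
  proof
    fix x
    obtain z where z: "Y (U (P x)) = U z" using bY(2) by blast
    then have "U (cadjoint U (Y (U (P x)))) = Y (U (P x))" by (simp add: cadjoint_U_U)
    then show "((\<lambda>f. Y (model_proj d f) + zero_plus_ampliation \<alpha> X f) \<circ> U) x = (U \<circ> T) x"
      by (simp add: T_def bounded_clinear_add[OF bU] model_proj_U zero_plus_ampliation_U)
  qed
  ultimately show ?thesis by blast
qed

lemma unitarily_equivalent_model:
  "unitarily_equivalent (wotS) (model_carrier d) (model_algebra d :: ('n model_space \<Rightarrow> 'n model_space) set)"
proof -
  have "(\<lambda>T. U \<circ> T) ` wotS = (\<lambda>X. X \<circ> U) ` model_algebra d"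
  proof
    show "(\<lambda>T. U \<circ> T) ` wotS \<subseteq> (\<lambda>X. X \<circ> U) ` model_algebra d"
      using wot_algebra_subset_model by blast
    show "(\<lambda>X. X \<circ> U) ` model_algebra d \<subseteq> (\<lambda>T. U \<circ> T) ` wotS"
    proof
      fix Z assume "Z \<in> (\<lambda>X. X \<circ> U) ` model_algebra d"
      then obtain Y X where "Y \<in> bounded_ops_on (model_carrier d)" "X \<in> free_semigroup_algebra"
        "Z = (\<lambda>f. Y (model_proj d f) + zero_plus_ampliation \<alpha> X f) \<circ> U"
        unfolding model_algebra_def \<alpha>_def by blast
      then show "Z \<in> (\<lambda>T. U \<circ> T) ` wotS" using model_subset_wot_algebra by blast
    qed
  qed
  then show ?thesis unfolding unitarily_equivalent_def using isometry_U range_U by blast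
qed

end

lemma orthonormal_sequence:
  assumes E: "finite E" "orthonormal E"
  obtains e where "\<And>i j. cinner (e i) (e j) = (if i = j \<and> i < card E then 1 else 0)"
    "range e \<subseteq> insert 0 E" "E \<subseteq> range e"
proof -
  obtain h where h: "bij_betw h {0..<card E} E" using ex_bij_betw_nat_finite[OF E(1)] by blast
  define e where "e i = (if i < card E then h i else 0)" for i
  have hE: "h i \<in> E" if "i < card E" for i using h that by (auto simp: bij_betw_def)
  have inj: "h i = h j \<longleftrightarrow> i = j" if "i < card E" "j < card E" for i j
    using h that by (auto simp: bij_betw_def inj_on_def)
  have "cinner (e i) (e j) = (if i = j \<and> i < card E then 1 else 0)" for i j
    using E(2) hE[of i] hE[of j] inj[of i j]
    by (auto simp: e_def orthonormal_def cinner.zero_left cinner.zero_right)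
  moreover have "range e \<subseteq> insert 0 E" using hE by (auto simp: e_def)
  moreover have "E \<subseteq> range e"
  proof
    fix x assume "x \<in> E"
    then have "x \<in> h ` {0..<card E}" using bij_betw_imp_surj_on[OF h] by simp
    then obtain i where "i < card E" "x = h i" by auto
    then have "x = e i" by (simp add: e_def)
    then show "x \<in> range e" by blast
  qed
  ultimately show ?thesis using that by blast
qed

context irreducible_cuntz
begin

text \<open>The wandering space of the pure part is \<open>(\<Sum> S\<^sub>i V) \<ominus> V\<close>, of dimension \<open>nd - d\<close>.\<close>

lemma wandering_basis:
  obtains F where "finite F" "orthonormal F" "card F = cdim V * (CARD('n) - 1)" "F \<subseteq> orthocompl V"
    "\<And>i x. x \<in> F \<Longrightarrow> Sd i x \<in> V" "\<And>i x. x \<in> V \<Longrightarrow> S i x \<in> cspan (V \<union> F)"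
proof -
  obtain E where E: "finite E" "orthonormal E" "cspan E = V" "card E = cdim V"
    using orthonormal_basis_exists[OF V fin_V] .
  define G where "G = (\<lambda>(i, x). S i x) ` (UNIV \<times> E)"
  have SS: "cinner (S i x) (S j y) = (if i = j then cinner x y else 0)" for i j x y
    using orthogonal_S[of i j] isometry_cinner[OF isometry_S] by auto
  have S_eq: "i = j \<and> x = y" if a: "x \<in> E" "y \<in> E" "S i x = S j y" for i j x y
  proof -
    have xx: "cinner x x = 1" using E(2) a by (simp add: orthonormal_def)
    have "cinner (S i x) (S j y) = cinner (S i x) (S i x)" by (simp only: a(3))
    also have "\<dots> = 1" by (simp add: SS xx)
    finally have "cinner (S i x) (S j y) = 1" .
    then have "i = j" "cinner x y = 1" using SS[of i x j y] by (auto split: if_splits)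
    then show "i = j \<and> x = y" using E(2) a by (auto simp: orthonormal_def split: if_splits)
  qed
  then have inj: "inj_on (\<lambda>(i, x). S i x) (UNIV \<times> E)" by (auto intro!: inj_onI)
  have oG: "orthonormal G"
    unfolding orthonormal_def
  proof (intro ballI)
    fix a b assume "a \<in> G" "b \<in> G"
    then obtain i x j y where ab: "a = S i x" "b = S j y" "x \<in> E" "y \<in> E" by (auto simp: G_def)
    have "cinner x y = (if x = y then 1 else 0)" using E(2) ab(3,4) by (simp add: orthonormal_def)
    then show "cinner a b = (if a = b then 1 else 0)"
      using S_eq[OF ab(3,4), of i j] by (auto simp: ab SS)
  qed
  have fG: "finite G" using E(1) by (simp add: G_def)
  have cG: "card G = CARD('n) * cdim V"
    unfolding G_def card_image[OF inj] by (simp add: card_cartesian_product E(4))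
  define D where "D = cspan G"
  have D: "csubspace D" by (simp add: D_def)
  have SVD: "S i x \<in> D" if "x \<in> V" for i x
  proof -
    have "E \<subseteq> {x. S i x \<in> D}" by (auto simp: D_def G_def intro!: complex_vector.span_base)
    then have "cspan E \<subseteq> {x. S i x \<in> D}"
      by (rule complex_vector.span_minimal) (rule csubspace_vimage[OF bounded_clinear_S D])
    then show ?thesis using that E(3) by blast
  qed
  \<comment> \<open>Vanishing of the defect enters here: x is the sum of the
    \<open>S i (Sd i x)\<close>, and \<open>Sd i x\<close> lies in V. So d dimensions can be removed
    from D.\<close>
  have VD: "V \<subseteq> D"
  proof
    fix x assume "x \<in> V"
    then have "(\<Sum>i\<in>UNIV. S i (Sd i x)) \<in> D" by (intro csubspace_sum[OF D] SVD Sd_V)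
    then show "x \<in> D" by (simp add: sum_S_Sd)
  qed
  have SdD: "Sd i x \<in> V" if "x \<in> D" for i x
  proof -
    have "G \<subseteq> {x. Sd i x \<in> V}"
      using E(3) complex_vector.span_base[of _ E] csubspace_0[OF V] by (auto simp: G_def Sd_S)
    then have "cspan G \<subseteq> {x. Sd i x \<in> V}"
      by (rule complex_vector.span_minimal) (rule csubspace_vimage[OF bounded_clinear_Sd V])
    then show ?thesis using that by (auto simp: D_def)
  qed
  define D0 where "D0 = D \<inter> orthocompl V"
  have cD0: "csubspace D0" unfolding D0_def by (intro complex_vector.subspace_inter D csubspace_orthocompl)
  have "finite_cdim D0" by (rule finite_cdim_subset[OF finite_cdim_cspan[OF fG]]) (auto simp: D0_def D_def)
  then obtain F where F: "finite F" "orthonormal F" "cspan F = D0" "card F = cdim D0"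
    using orthonormal_basis_exists[OF cD0] by blast
  have FD0: "F \<subseteq> D0" using F(3) complex_vector.span_superset by blast
  have EV: "E \<subseteq> V" using E(3) complex_vector.span_superset by blast
  have EF: "cinner x y = 0" "cinner y x = 0" if "x \<in> E" "y \<in> F" for x y
    using that EV FD0 orthocomplD[of y V x] orthocomplD'[of y V x] by (auto simp: D0_def)
  have "E \<inter> F = {}"
  proof (rule ccontr)
    assume "E \<inter> F \<noteq> {}"
    then obtain x where "x \<in> E" "x \<in> F" by blast
    then show False using EF(1)[of x x] E(2) unfolding orthonormal_def by (metis zero_neq_one)
  qed
  have oEF: "orthonormal (E \<union> F)"
    using E(2) F(2) EF \<open>E \<inter> F = {}\<close> unfolding orthonormal_def by (metis Un_iff disjoint_iff)
  have decomp: "x \<in> cspan (V \<union> F)" if "x \<in> D" for x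
  proof -
    have "x - P x \<in> D0"
      unfolding D0_def using that VD P_in P_orth csubspace_diff[OF D] by blast
    then have "x - P x \<in> cspan (V \<union> F)" using F(3) complex_vector.span_mono[of F "V \<union> F"] by blast
    moreover have "P x \<in> cspan (V \<union> F)" using P_in by (simp add: complex_vector.span_base)
    ultimately have "(x - P x) + P x \<in> cspan (V \<union> F)" by (rule complex_vector.span_add)
    then show ?thesis by simp
  qed
  have "cspan (E \<union> F) = D"
  proof
    show "cspan (E \<union> F) \<subseteq> D"
      using EV VD FD0 by (intro complex_vector.span_minimal[OF _ D]) (auto simp: D0_def)
    have "V \<union> F \<subseteq> cspan (E \<union> F)"
      using E(3) complex_vector.span_mono[of E "E \<union> F"] complex_vector.span_superset[of "E \<union> F"] by blast
    then have "cspan (V \<union> F) \<subseteq> cspan (E \<union> F)" by (rule complex_vector.span_minimal) simp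
    then show "D \<subseteq> cspan (E \<union> F)" using decomp by blast
  qed
  then have "card (E \<union> F) = card G"
    using cdim_cspan_orthonormal[OF _ oEF] cdim_cspan_orthonormal[OF fG oG] E(1) F(1) by (simp add: D_def)
  then have "card F = CARD('n) * cdim V - cdim V"
    using card_Un_disjoint[OF E(1) F(1) \<open>E \<inter> F = {}\<close>] E(4) cG by simp
  then have "card F = cdim V * (CARD('n) - 1)" by (simp add: algebra_simps diff_mult_distrib2)
  moreover have "F \<subseteq> orthocompl V" using FD0 by (auto simp: D0_def)
  moreover have "Sd i x \<in> V" if "x \<in> F" for i x using that FD0 by (intro SdD) (auto simp: D0_def)
  moreover have "S i x \<in> cspan (V \<union> F)" if "x \<in> V" for i x by (rule decomp[OF SVD[OF that]])
  ultimately show ?thesis by (rule that[OF F(1,2)])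
qed

lemma unitarily_equivalent_model_algebra:
  assumes n: "CARD('n) \<ge> 2"
  shows "unitarily_equivalent (wotS) (model_carrier (cdim V))
    (model_algebra (cdim V) :: ('n model_space \<Rightarrow> 'n model_space) set)"
proof -
  obtain E where E: "finite E" "orthonormal E" "cspan E = V" "card E = cdim V"
    using orthonormal_basis_exists[OF V fin_V] .
  obtain F where F: "finite F" "orthonormal F" "card F = cdim V * (CARD('n) - 1)" "F \<subseteq> orthocompl V"
    "\<And>i x. x \<in> F \<Longrightarrow> Sd i x \<in> V" "\<And>i x. x \<in> V \<Longrightarrow> S i x \<in> cspan (V \<union> F)"
    by (rule wandering_basis) blast
  obtain e where e: "\<And>i j. cinner (e i) (e j) = (if i = j \<and> i < card E then 1 else 0)"
    "range e \<subseteq> insert 0 E" "E \<subseteq> range e" by (rule orthonormal_sequence[OF E(1,2)]) blast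
  obtain f where f: "\<And>i j. cinner (f i) (f j) = (if i = j \<and> i < card F then 1 else 0)"
    "range f \<subseteq> insert 0 F" "F \<subseteq> range f" by (rule orthonormal_sequence[OF F(1,2)]) blast
  have "E \<noteq> {}" using E(3) V_nz by auto
  then have cE: "card E > 0" using E(1) by (simp add: card_gt_0_iff)
  have "E \<subseteq> V" using complex_vector.span_superset[of E] unfolding E(3) .
  then have "insert 0 E \<subseteq> V" using csubspace_0[OF V] by simp
  with e(2) have eV: "range e \<subseteq> V" by (rule order_trans)
  have f0: "f k = 0 \<or> f k \<in> F" for k using subsetD[OF f(2) rangeI, of k] by simp
  have "cuntz_frame S V e f (cdim V)"
  proof
    show "cspan (range e) = V"
    proof
      show "cspan (range e) \<subseteq> V" by (rule complex_vector.span_minimal[OF eV V])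
      show "V \<subseteq> cspan (range e)" using complex_vector.span_mono[OF e(3)] unfolding E(3) .
    qed
    show "f k \<in> orthocompl V" for k
      using f0[of k] F(4) csubspace_0[OF csubspace_orthocompl, of V] by auto
    show "Sd i (f k) \<in> V" for i k
      using f0[of k] F(5) by (auto simp: bounded_clinear_zero[OF bounded_clinear_Sd] csubspace_0[OF V])
    show "S i x \<in> cspan (V \<union> range f)" if "x \<in> V" for i x
      using F(6)[OF that, of i] complex_vector.span_mono[of "V \<union> F" "V \<union> range f"] f(3) by blast
  qed (use n e f E(4) F(3) cE in simp_all)
  then show ?thesis by (rule cuntz_frame.unitarily_equivalent_model)
qed

end

section \<open>Transfer of the two cases to the dilation\<close>

context dilation
begin

text \<open>J intertwines the \<open>Ad i\<close> with the \<open>Sd i\<close> and is injective, so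
  minimality is carried over to the image. The commutant condition comes from the scalar fixed
  points.\<close>

lemma irreducible_cuntz_image:
  assumes nz: "(UNIV :: 'v set) \<noteq> {0}"
    and unital: "(\<lambda>x. \<Sum>i\<in>UNIV. A i (Ad i x)) = id"
    and m: "minimal_invariant (cadjoint ` algA) V\<^sub>0"
    and cyc: "cyclic_subspace (algA) V\<^sub>0"
  shows "irreducible_cuntz S (J ` V\<^sub>0)" "cdim (J ` V\<^sub>0) = cdim V\<^sub>0"
proof -
  note V = minimal_invariant_cadjointD[of A, OF bounded_clinear_A m]
  obtain E where E: "finite E" "orthonormal E" "cspan E = V\<^sub>0" "card E = cdim V\<^sub>0"
    using orthonormal_basis_exists[OF V(1) finite_cdim_subset[OF fin subset_UNIV]] .
  have injJ: "inj J" by (metis Jd_J injI)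
  have oJE: "orthonormal (J ` E)"
    using E(2) inj_eq[OF injJ] by (auto simp: orthonormal_def isometry_cinner[OF isometry_J])
  have sJE: "cspan (J ` E) = J ` V\<^sub>0"
  proof
    show "cspan (J ` E) \<subseteq> J ` V\<^sub>0"
      using E(3) complex_vector.span_superset[of E]
      by (intro complex_vector.span_minimal csubspace_image bounded_clinear_J V(1)) blast
    have "cspan E \<subseteq> {x. J x \<in> cspan (J ` E)}"
      by (intro complex_vector.span_minimal csubspace_vimage bounded_clinear_J)
        (auto intro: complex_vector.span_base)
    then show "J ` V\<^sub>0 \<subseteq> cspan (J ` E)" using E(3) by blast
  qed
  show "cdim (J ` V\<^sub>0) = cdim V\<^sub>0"
    using cdim_cspan_orthonormal[OF finite_imageI[OF E(1)] oJE] sJE E(4)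
      card_image[of J E] inj_on_subset[OF injJ] by simp
  show "irreducible_cuntz S (J ` V\<^sub>0)"
  proof
    show "defect x = 0" for x by (rule defect_eq_0_if_unital[OF unital])
    show "csubspace (J ` V\<^sub>0)" by (rule csubspace_image[OF bounded_clinear_J V(1)])
    show "finite_cdim (J ` V\<^sub>0)" unfolding sJE[symmetric] by (intro finite_cdim_cspan finite_imageI E(1))
    obtain x where "x \<in> V\<^sub>0" "x \<noteq> 0" using V(2) csubspace_0[OF V(1)] by blast
    then show "J ` V\<^sub>0 \<noteq> {0}" using inj_eq[OF injJ, of x 0] bounded_clinear_zero[OF bounded_clinear_J] by auto
    show "Sd i x \<in> J ` V\<^sub>0" if "x \<in> J ` V\<^sub>0" for i x using that V(3) by (auto simp: Sd_J)
    fix N assume N: "csubspace N" "N \<noteq> {0}" "\<And>i x. x \<in> N \<Longrightarrow> Sd i x \<in> N" "N \<subseteq> J ` V\<^sub>0"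
    define N' where "N' = {x. J x \<in> N}"
    have NJ: "N = J ` N'" using N(4) by (auto simp: N'_def)
    have "N' = V\<^sub>0"
    proof (rule V(4))
      show "csubspace N'" unfolding N'_def by (rule csubspace_vimage[OF bounded_clinear_J N(1)])
      show "N' \<noteq> {0}" using N(2) bounded_clinear_zero[OF bounded_clinear_J] unfolding NJ by auto
      show "Ad i x \<in> N'" if "x \<in> N'" for i x
        using N(3)[of "J x" i] that by (simp add: N'_def Sd_J)
      show "N' \<subseteq> V\<^sub>0"
      proof
        fix x assume "x \<in> N'"
        then have "J x \<in> J ` V\<^sub>0" using N(4) by (auto simp: N'_def)
        then show "x \<in> V\<^sub>0" using injJ by (simp add: inj_image_mem_iff)
      qed
    qed
    then show "N = J ` V\<^sub>0" using NJ by simp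
  next
    fix T assume T: "bounded_clinear T" "\<And>i x. T (S i x) = S i (T x)" "\<And>i x. T (Sd i x) = Sd i (T x)"
    have "{X. bounded_clinear X \<and> cp_map A X = X} = {\<lambda>x. c *\<^sub>C x |c. True}"
      using fixed_points_scalar_iff[OF nz] unital m cyc by blast
    from commutant_scalar_if_fixed_points_scalar[OF unital this T]
    show "\<exists>c. \<forall>x. T x = c *\<^sub>C x" .
  qed
qed

lemma unitarily_equivalent_free:
  assumes v: "range (\<lambda>x. x - (\<Sum>i\<in>UNIV. A i (Ad i x))) = cspan {v}" "v \<noteq> 0"
    and cyc: "cyclic_vector (algA) v"
  shows "unitarily_equivalent (wotS) UNIV
    (free_semigroup_algebra :: ('n list ell2 \<Rightarrow> 'n list ell2) set)"
proof -
  obtain w where w: "w \<noteq> 0" "defect w = w" "gen {w} = UNIV"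
    by (rule cyclic_wandering_vector[OF v cyc]) blast
  have "Sd i w = 0" for i using Sd_defect[of i w] by (simp add: w(2))
  then show ?thesis by (rule unitarily_equivalent_free_semigroup_algebra[OF w(1) _ w(3)])
qed

end

theorem corollary6p6:
  fixes A :: "'n :: finite \<Rightarrow> 'v :: chilbert_space \<Rightarrow> 'v"
  assumes n: "CARD('n) \<ge> 2"
    and fin: "finite_cdim (UNIV :: 'v set)"
    and nonzero: "(UNIV :: 'v set) \<noteq> {0}"
    and contr: "contractive A"
  shows
    "(\<forall>(J :: 'v \<Rightarrow> 'h :: chilbert_space) S. minimal_isometric_dilation A J S \<longrightarrow>
        (irreducible_algebra (wot_algebra (range S)) \<longleftrightarrow>
           (\<exists>v. range (\<lambda>x. x - (\<Sum>i\<in>UNIV. A i (cadjoint (A i) x))) = cspan {v} \<and> v \<noteq> 0 \<and>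
              cyclic_vector (unital_algebra (range A)) v) \<or>
           ((\<lambda>x. \<Sum>i\<in>UNIV. A i (cadjoint (A i) x)) = id \<and>
              (\<exists>V\<^sub>0. minimal_invariant (cadjoint ` unital_algebra (range A)) V\<^sub>0 \<and>
                 cyclic_subspace (unital_algebra (range A)) V\<^sub>0))) \<and>
        (\<forall>v. range (\<lambda>x. x - (\<Sum>i\<in>UNIV. A i (cadjoint (A i) x))) = cspan {v} \<and> v \<noteq> 0 \<and>
             cyclic_vector (unital_algebra (range A)) v \<longrightarrow>
           unitarily_equivalent (wot_algebra (range S)) UNIV
             (free_semigroup_algebra :: ('n list ell2 \<Rightarrow> 'n list ell2) set)) \<and>
        (\<forall>V\<^sub>0. (\<lambda>x. \<Sum>i\<in>UNIV. A i (cadjoint (A i) x)) = id \<and>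
             minimal_invariant (cadjoint ` unital_algebra (range A)) V\<^sub>0 \<and>
             cyclic_subspace (unital_algebra (range A)) V\<^sub>0 \<longrightarrow>
           unitarily_equivalent (wot_algebra (range S)) (model_carrier (cdim V\<^sub>0))
             (model_algebra (cdim V\<^sub>0) :: ('n model_space \<Rightarrow> 'n model_space) set))) \<and>
     ((\<exists>v. range (\<lambda>x. x - (\<Sum>i\<in>UNIV. A i (cadjoint (A i) x))) = cspan {v} \<and> v \<noteq> 0 \<and>
         cyclic_vector (unital_algebra (range A)) v) \<longleftrightarrow>
      cdim (range (\<lambda>x. x - cp_map A id x)) = 1 \<and> cp_limit A = (\<lambda>x. 0)) \<and>
     ((\<lambda>x. \<Sum>i\<in>UNIV. A i (cadjoint (A i) x)) = id \<and>
        (\<exists>V\<^sub>0. minimal_invariant (cadjoint ` unital_algebra (range A)) V\<^sub>0 \<and>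
           cyclic_subspace (unital_algebra (range A)) V\<^sub>0) \<longleftrightarrow>
      {X. bounded_clinear X \<and> cp_map A X = X} = {\<lambda>x. c *\<^sub>C x |c. True})"
proof -
  interpret A: finite_row_contraction A by unfold_locales (fact contr fin)+
  show ?thesis
  proof (intro conjI allI impI)
    fix J :: "'v \<Rightarrow> 'h" and S assume "minimal_isometric_dilation A J S"
    then interpret dilation S A J by (rule dilationI[OF _ contr fin])
    show "irreducible_algebra (wot_algebra (range S)) \<longleftrightarrow>
             (\<exists>v. range (\<lambda>x. x - (\<Sum>i\<in>UNIV. A i (cadjoint (A i) x))) = cspan {v} \<and> v \<noteq> 0 \<and>
                cyclic_vector (unital_algebra (range A)) v) \<or>
             ((\<lambda>x. \<Sum>i\<in>UNIV. A i (cadjoint (A i) x)) = id \<and>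
                (\<exists>V\<^sub>0. minimal_invariant (cadjoint ` unital_algebra (range A)) V\<^sub>0 \<and>
                   cyclic_subspace (unital_algebra (range A)) V\<^sub>0))"
      by (rule irreducible_iff[OF nonzero])
    show "unitarily_equivalent (wot_algebra (range S)) UNIV
        (free_semigroup_algebra :: ('n list ell2 \<Rightarrow> 'n list ell2) set)"
      if "range (\<lambda>x. x - (\<Sum>i\<in>UNIV. A i (cadjoint (A i) x))) = cspan {v} \<and> v \<noteq> 0 \<and>
        cyclic_vector (unital_algebra (range A)) v" for v
      using that by (intro unitarily_equivalent_free) auto
    fix V\<^sub>0 assume "(\<lambda>x. \<Sum>i\<in>UNIV. A i (cadjoint (A i) x)) = id \<and>
      minimal_invariant (cadjoint ` unital_algebra (range A)) V\<^sub>0 \<and>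
      cyclic_subspace (unital_algebra (range A)) V\<^sub>0"
    then have "irreducible_cuntz S (J ` V\<^sub>0)" "cdim (J ` V\<^sub>0) = cdim V\<^sub>0"
      using irreducible_cuntz_image[OF nonzero] by blast+
    then show "unitarily_equivalent (wot_algebra (range S)) (model_carrier (cdim V\<^sub>0))
        (model_algebra (cdim V\<^sub>0) :: ('n model_space \<Rightarrow> 'n model_space) set)"
      using irreducible_cuntz.unitarily_equivalent_model_algebra[OF _ n, of S "J ` V\<^sub>0"] by simp
  qed (rule A.rank_one_cyclic_iff A.fixed_points_scalar_iff[OF nonzero])+
qed

end
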